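(* Let $k\in\{3,4\}$. Every finite simple graph $G$ with $\rho_G^k\le 2-\sigma_G^k$ is SE $k$-choosable.
   Context: For a graph $G$, $V_1(G)$ is the set of vertices of degree $1$, and for $A\subseteq V(G)$, $\|G[A]\|$ is the number of edges of the induced subgraph $G[A]$. Set $\varepsilon_3=6$, $\varepsilon_4=4$, $\nu_k=\varepsilon_k+1$. For $A\subseteq V(G)$ define $\rho_G^k(A)=\varepsilon_k\|G[A]\|-\nu_k|A|+\frac{\varepsilon_k}{2}|A\cap V_1(G)|$, and $\rho_G^k=\max_{A\subseteq V(G)}\rho_G^k(A)$ (the maximum includes $A=\emptyset$, so $\rho_G^k\ge0$). Set $\sigma_G^3=0$ and $\sigma_G^4=|V_1(G)|\bmod 2$. A $k$-list assignment $L$ for $G$ assigns to each vertex $v$ a set $L(v)$ of exactly $k$ colors; an $L$-coloring is a proper vertex coloring $f$ with $f(v)\in L(v)$ for all $v$. For an integer $n$ and $k\ge1$, $n\bmod^* k$ is the unique $m\in\{1,\dots,k\}$ with $n\equiv m\pmod k$. If $|V(G)|=n\ge 1$, an $L$-coloring $f$ of $G$ is strongly equitable (SE) if every color class has at most $\lceil n/k\rceil$ vertices and the number of colors whose class has exactly $\lceil n/k\rceil$ vertices (the full classes) is at most $n\bmod^* k$; the empty graph is regarded as SE $L$-colorable. $G$ is SE $k$-choosable if it has an SE $L$-coloring for every $k$-list assignment $L$. *)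

theory Defs
  imports Main "HOL.Real"
begin

definition simple_graph :: "'a set \<Rightarrow> 'a set set \<Rightarrow> bool" where
  "simple_graph V E \<longleftrightarrow> finite V \<and> (\<forall>e\<in>E. e \<subseteq> V \<and> card e = 2)"

definition degree :: "'a set set \<Rightarrow> 'a \<Rightarrow> nat" where
  "degree E v = card {e\<in>E. v \<in> e}"

definition V1 :: "'a set \<Rightarrow> 'a set set \<Rightarrow> 'a set" where
  "V1 V E = {v\<in>V. degree E v = 1}"

definition induced_edges :: "'a set set \<Rightarrow> 'a set \<Rightarrow> nat" where
  "induced_edges E A = card {e\<in>E. e \<subseteq> A}"

definition eps :: "nat \<Rightarrow> real" where
  "eps k = (if k = 3 then 6 else if k = 4 then 4 else 0)"

definition nu :: "nat \<Rightarrow> real" where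
  "nu k = eps k + 1"

definition rho_set :: "nat \<Rightarrow> 'a set \<Rightarrow> 'a set set \<Rightarrow> 'a set \<Rightarrow> real" where
  "rho_set k V E A = eps k * real (induced_edges E A) - nu k * real (card A)
     + (eps k / 2) * real (card (A \<inter> V1 V E))"

definition rho :: "nat \<Rightarrow> 'a set \<Rightarrow> 'a set set \<Rightarrow> real" where
  "rho k V E = Max {rho_set k V E A | A. A \<subseteq> V}"

definition sigma :: "nat \<Rightarrow> 'a set \<Rightarrow> 'a set set \<Rightarrow> nat" where
  "sigma k V E = (if k = 3 then 0 else card (V1 V E) mod 2)"

definition modstar :: "nat \<Rightarrow> nat \<Rightarrow> nat" where
  "modstar n k = (if n mod k = 0 then k else n mod k)"

definition list_assignment :: "nat \<Rightarrow> 'a set \<Rightarrow> ('a \<Rightarrow> 'c set) \<Rightarrow> bool" where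
  "list_assignment k V L \<longleftrightarrow> (\<forall>v\<in>V. finite (L v) \<and> card (L v) = k)"

definition L_coloring :: "'a set \<Rightarrow> 'a set set \<Rightarrow> ('a \<Rightarrow> 'c set) \<Rightarrow> ('a \<Rightarrow> 'c) \<Rightarrow> bool" where
  "L_coloring V E L f \<longleftrightarrow> (\<forall>v\<in>V. f v \<in> L v) \<and>
     (\<forall>e\<in>E. \<forall>u\<in>e. \<forall>v\<in>e. u \<noteq> v \<longrightarrow> f u \<noteq> f v)"

definition color_class :: "'a set \<Rightarrow> ('a \<Rightarrow> 'c) \<Rightarrow> 'c \<Rightarrow> 'a set" where
  "color_class V f c = {v\<in>V. f v = c}"

definition strongly_equitable :: "nat \<Rightarrow> 'a set \<Rightarrow> ('a \<Rightarrow> 'c) \<Rightarrow> bool" where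
  "strongly_equitable k V f \<longleftrightarrow>
     (let n = card V; m = nat \<lceil>real n / real k\<rceil> in
       (\<forall>c. card (color_class V f c) \<le> m) \<and>
       card {c. card (color_class V f c) = m} \<le> modstar n k)"

definition SE_L_colorable :: "nat \<Rightarrow> 'a set \<Rightarrow> 'a set set \<Rightarrow> ('a \<Rightarrow> 'c set) \<Rightarrow> bool" where
  "SE_L_colorable k V E L \<longleftrightarrow>
     V = {} \<or> (\<exists>f. L_coloring V E L f \<and> strongly_equitable k V f)"

end

theory Submission
  imports Defs
begin

text \<open>Take a graph with the fewest vertices that has no suitable coloring. One deletes a block \<open>S\<close> of \<open>k\<close> vertices such that the remaining
  graph still satisfies the hypothesis, colors the rest, and extends the coloring to \<open>S\<close> with \<open>k\<close> different colors; this works if the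
  vertices of \<open>S\<close> have at most \<open>0, 1, \<dots>, k - 1\<close> neighbours outside \<open>S\<close>. If \<open>k\<close> does not divide the number of vertices, one or two
  vertices of small degree are deleted instead.

  Call a vertex of degree at most 2 light. Deleting \<open>S\<close> can violate the hypothesis only by creating new vertices of degree at most 1 next
  to a dense set. Since \<open>\<rho>\<close> is supermodular, the dense sets can be united: either two different choices of \<open>S\<close> cannot both be blocked,
  or \<open>S\<close> is chosen outside the largest set \<open>M\<close> of maximal potential, where all sets are sparse. If \<open>k\<close> divides the number of vertices,
  the potential of the whole graph is at most 0 by a congruence, and discharging on the complement of \<open>M\<close> produces a reducible
  configuration.\<close>

section \<open>The potential\<close>

text \<open>The weights 2c of an edge and 2c + 1 of a vertex differ by 1: attaching a vertex to a
  set by one edge costs 1, by two edges it gains 2c - 1. Nearly all contradictions are sums of such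
  steps. The obstacle is the half-edges. A vertex whose degree falls below 2 gains c for every
  missing half-edge, so a set of potential as low as 3 - c can become bad after a deletion. A heavy
  vertex has an edge to spare, since its first lost neighbour costs nothing; the dangerous vertices
  are the light ones. They lie on paths of light vertices, and if deletion fails at both ends of
  such a path, the two dense sets found there are joined by the path into a set that is too dense.
  The case k = 4 has a second obstacle: if 4 divides the order, the rest after deleting a block must
  have potential at most 0 and not just at most 2. Either the fourth vertex of the block is chosen
  so as to lower the potential, or the charges of the block are counted. The numbers 0, ..., k - 1
  are those of greedy coloring: a vertex of the block avoids the colors of its outside neighbours
  and those given to earlier vertices of the block.\<close>

text \<open>A graph is given by its vertex set \<open>V\<close> and its neighbourhood function \<open>N\<close>. The case \<open>k = 3\<close> corresponds to
  \<open>c = 3\<close> and the case \<open>k = 4\<close> to \<open>c = 2\<close>, so that always \<open>\<epsilon>\<^sub>k = 2c\<close>. A vertex of degree below 2 carries the missing half-edges as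
  its defect; on sets without isolated vertices \<open>pot\<close> is the function \<open>\<rho>\<close> of the statement.\<close>

definition defect :: "('a \<Rightarrow> 'a set) \<Rightarrow> 'a \<Rightarrow> int" where
  "defect N v = max 0 (2 - int (card (N v)))"

definition pot :: "int \<Rightarrow> ('a \<Rightarrow> 'a set) \<Rightarrow> 'a set \<Rightarrow> int" where
  "pot c N A = (\<Sum>v\<in>A. c * (int (card (N v \<inter> A)) + defect N v) - (2 * c + 1))"

text \<open>The conditions of \<open>nbr_graph\<close> concern every point of the type and force
  empty neighbourhoods outside \<open>V\<close>. Hence a deleted vertex must itself get the empty
  neighbourhood.\<close>

definition del :: "'a set \<Rightarrow> ('a \<Rightarrow> 'a set) \<Rightarrow> 'a \<Rightarrow> 'a set" where
  "del S N v = (if v \<in> S then {} else N v - S)"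

definition light :: "('a \<Rightarrow> 'a set) \<Rightarrow> 'a \<Rightarrow> bool" where
  "light N v \<longleftrightarrow> card (N v) \<le> 2"

definition sparse :: "int \<Rightarrow> 'a set \<Rightarrow> ('a \<Rightarrow> 'a set) \<Rightarrow> bool" where
  "sparse c V N \<longleftrightarrow> (\<forall>A\<subseteq>V. pot c N A \<le> 2)"

definition loss :: "'a set \<Rightarrow> ('a \<Rightarrow> 'a set) \<Rightarrow> 'a \<Rightarrow> int" where
  "loss S N v = defect (del S N) v - defect N v"

locale nbr_graph =
  fixes V :: "'a set" and N :: "'a \<Rightarrow> 'a set" and c :: int
  assumes fin: "finite V" and sub: "N v \<subseteq> V" and sym: "u \<in> N v \<Longrightarrow> v \<in> N u"
    and irr: "v \<notin> N v" and c23: "c = 2 \<or> c = 3"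
begin

lemma finN [simp]: "finite (N v)"
  using sub fin finite_subset by blast

lemma sym_iff: "u \<in> N v \<longleftrightarrow> v \<in> N u"
  using sym by blast

lemma del_graph: "nbr_graph (V - S) (del S N) c"
  by unfold_locales (use fin sub sym irr c23 in \<open>auto simp: del_def split: if_splits\<close>)

lemma del_del: "del T (del S N) = del (S \<union> T) N"
  by (auto simp: del_def fun_eq_iff)

section \<open>Marginals and supermodularity of the potential\<close>

lemma pot_empty [simp]: "pot c N {} = 0"
  by (simp add: pot_def)

lemma pot_insert:
  assumes "A \<subseteq> V" "v \<in> V" "v \<notin> A"
  shows "pot c N (insert v A) = pot c N A + 2*c* int (card (N v \<inter> A)) + c * defect N v - (2*c+1)"
proof -
  have fA: "finite A" using assms fin finite_subset by blast
  have e: "int (card (N u \<inter> insert v A)) = int (card (N u \<inter> A)) + (if u \<in> N v then 1 else 0)" if "u \<in> A" for u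
  proof (cases "u \<in> N v")
    case True
    then have "N u \<inter> insert v A = insert v (N u \<inter> A)" using sym by auto
    then show ?thesis using True assms(3) by simp
  next
    case False
    then have "N u \<inter> insert v A = N u \<inter> A" using sym by auto
    then show ?thesis using False by simp
  qed
  have v: "N v \<inter> insert v A = N v \<inter> A" using irr by auto
  have s: "(\<Sum>u\<in>A. (if u \<in> N v then 1 else 0::int)) = int (card (N v \<inter> A))"
    using fA by (simp add: sum.If_cases Int_commute)
  have "pot c N (insert v A) = c * (int (card (N v \<inter> A)) + defect N v) - (2*c+1)
     + (\<Sum>u\<in>A. c * (int (card (N u \<inter> insert v A)) + defect N u) - (2 * c + 1))"
    unfolding pot_def using fA assms(3) v by simp
  also have "(\<Sum>u\<in>A. c * (int (card (N u \<inter> insert v A)) + defect N u) - (2 * c + 1))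
     = (\<Sum>u\<in>A. (c * (int (card (N u \<inter> A)) + defect N u) - (2 * c + 1)) + c * (if u \<in> N v then 1 else 0))"
    by (rule sum.cong) (auto simp: e algebra_simps)
  also have "\<dots> = pot c N A + c * int (card (N v \<inter> A))"
    unfolding pot_def sum.distrib sum_distrib_left[symmetric] s by simp
  finally show ?thesis by (simp add: algebra_simps)
qed

lemma pot_remove:
  assumes "A \<subseteq> V" "v \<in> A"
  shows "pot c N A = pot c N (A - {v}) + 2*c* int (card (N v \<inter> A)) + c * defect N v - (2*c+1)"
proof -
  have "N v \<inter> (A - {v}) = N v \<inter> A" using irr by auto
  moreover have "insert v (A - {v}) = A" using assms by auto
  ultimately show ?thesis using pot_insert[of "A - {v}" v] assms by auto
qed

text \<open>A vertex has at least as many neighbours in a larger set, so marginals grow with the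
  base set; supermodularity is the set form of this.\<close>

lemma pot_mono_marginal:
  assumes "finite X" "X \<subseteq> V" "B \<subseteq> V" "C \<subseteq> B" "X \<inter> B = {}"
  shows "pot c N (C \<union> X) - pot c N C \<le> pot c N (B \<union> X) - pot c N B"
  using assms
proof (induction X rule: finite_induct)
  case (insert x X)
  have 1: "pot c N (insert x (C \<union> X)) = pot c N (C \<union> X) + 2*c* int (card (N x \<inter> (C \<union> X))) + c * defect N x - (2*c+1)"
    by (rule pot_insert) (use insert in auto)
  have 2: "pot c N (insert x (B \<union> X)) = pot c N (B \<union> X) + 2*c* int (card (N x \<inter> (B \<union> X))) + c * defect N x - (2*c+1)"
    by (rule pot_insert) (use insert in auto)
  have "card (N x \<inter> (C \<union> X)) \<le> card (N x \<inter> (B \<union> X))"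
    by (rule card_mono) (use insert in auto)
  then have "2*c* int (card (N x \<inter> (C \<union> X))) \<le> 2*c* int (card (N x \<inter> (B \<union> X)))"
    using c23 by auto
  moreover have "C \<union> insert x X = insert x (C \<union> X)" "B \<union> insert x X = insert x (B \<union> X)" by auto
  ultimately show ?case using insert 1 2 by auto
qed simp

lemma pot_supermod:
  assumes "A \<subseteq> V" "B \<subseteq> V"
  shows "pot c N A + pot c N B \<le> pot c N (A \<union> B) + pot c N (A \<inter> B)"
proof -
  have "pot c N ((A \<inter> B) \<union> (B - A)) - pot c N (A \<inter> B) \<le> pot c N (A \<union> (B - A)) - pot c N A"
    by (rule pot_mono_marginal) (use assms finite_subset[OF assms(2) fin] in auto)
  moreover have "(A \<inter> B) \<union> (B - A) = B" "A \<union> (B - A) = A \<union> B" by auto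
  ultimately show ?thesis by simp
qed

lemma pot_disjoint:
  assumes "A \<subseteq> V" "B \<subseteq> V" "A \<inter> B = {}" "\<And>v. v \<in> A \<Longrightarrow> N v \<inter> B = {}"
  shows "pot c N (A \<union> B) = pot c N A + pot c N B"
proof -
  have f: "finite A" "finite B" using assms fin finite_subset by blast+
  have a: "N v \<inter> (A \<union> B) = N v \<inter> A" if "v \<in> A" for v using that assms(4)[of v] by blast
  have b: "N v \<inter> (A \<union> B) = N v \<inter> B" if "v \<in> B" for v using that assms(4) sym by blast
  show ?thesis unfolding pot_def sum.union_disjoint[OF f assms(3)] using a b by simp
qed

text \<open>With \<open>pot_add2\<close> this is the bookkeeping of all later contradictions: each
  vertex along a path costs 1, because 2c - (2c + 1) = -1, and the vertex that closes the path at a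
  second neighbour gains 2c - 1.\<close>

lemma pot_add1:
  assumes "A \<subseteq> V" "v \<in> V" "v \<notin> A" "u \<in> N v" "u \<in> A"
  shows "pot c N A - 1 \<le> pot c N (insert v A)"
proof -
  have "0 < card (N v \<inter> A)" using assms by (auto simp: card_gt_0_iff)
  then have "2*c \<le> 2*c* int (card (N v \<inter> A))" using c23 by auto
  moreover have "0 \<le> c * defect N v" using c23 by (auto simp: defect_def)
  ultimately show ?thesis using pot_insert[OF assms(1-3)] by linarith
qed

lemma pot_add2:
  assumes "A \<subseteq> V" "v \<in> V" "v \<notin> A" "u \<in> N v" "u \<in> A" "w \<in> N v" "w \<in> A" "u \<noteq> w"
  shows "pot c N A + 2*c - 1 \<le> pot c N (insert v A)"
proof -
  have "card {u,w} \<le> card (N v \<inter> A)" by (rule card_mono) (use assms in auto)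
  then have "2 \<le> card (N v \<inter> A)" using assms by auto
  then have "4*c \<le> 2*c* int (card (N v \<inter> A))" using c23 by auto
  moreover have "0 \<le> c * defect N v" using c23 by (auto simp: defect_def)
  ultimately show ?thesis using pot_insert[OF assms(1-3)] by linarith
qed

lemma pot_addn:
  assumes "A \<subseteq> V" "v \<in> V" "v \<notin> A" "X \<subseteq> N v" "X \<subseteq> A" 
  shows "pot c N A + 2*c* int (card X) - (2*c+1) \<le> pot c N (insert v A)"
proof -
  have "card X \<le> card (N v \<inter> A)" by (rule card_mono) (use assms in auto)
  then have "2*c* int (card X) \<le> 2*c* int (card (N v \<inter> A))" using c23 by auto
  moreover have "0 \<le> c * defect N v" using c23 by (auto simp: defect_def)
  ultimately show ?thesis using pot_insert[OF assms(1-3)] by linarith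
qed

lemma handshake:
  assumes "X \<subseteq> V" "Y \<subseteq> V"
  shows "(\<Sum>v\<in>X. card (N v \<inter> Y)) = (\<Sum>v\<in>Y. card (N v \<inter> X))"
proof -
  have f: "finite X" "finite Y" using assms fin finite_subset by blast+
  have "(\<Sum>v\<in>X. card (N v \<inter> Y)) = (\<Sum>v\<in>X. \<Sum>u\<in>Y. if u \<in> N v then 1 else 0)"
    using f by (intro sum.cong) (auto simp: sum.If_cases Int_commute)
  also have "\<dots> = (\<Sum>u\<in>Y. \<Sum>v\<in>X. if u \<in> N v then 1 else 0)" by (rule sum.swap)
  also have "\<dots> = (\<Sum>u\<in>Y. \<Sum>v\<in>X. if v \<in> N u then 1 else 0)" by (simp add: sym_iff)
  also have "\<dots> = (\<Sum>v\<in>Y. card (N v \<inter> X))"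
    using f by (intro sum.cong) (auto simp: sum.If_cases Int_commute)
  finally show ?thesis .
qed

text \<open>Needed because for c = 2 the potential of \<open>V\<close> must be known modulo 4,
  whereas its definition alone determines it only modulo 2.\<close>

lemma even_degree_sum:
  assumes "A \<subseteq> V" shows "even (\<Sum>v\<in>A. card (N v \<inter> A))"
proof -
  have "finite A" using assms fin finite_subset by blast
  then show ?thesis using assms
  proof (induction A rule: finite_induct)
    case (insert x A)
    have e: "card (N u \<inter> insert x A) = card (N u \<inter> A) + (if u \<in> N x then 1 else 0)" if "u \<in> A" for u
    proof (cases "u \<in> N x")
      case True
      then have "N u \<inter> insert x A = insert x (N u \<inter> A)" using sym by auto
      then show ?thesis using True insert by simp
    next
      case False
      then have "N u \<inter> insert x A = N u \<inter> A" using sym by auto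
      then show ?thesis using False by simp
    qed
    have v: "N x \<inter> insert x A = N x \<inter> A" using irr by auto
    have s: "(\<Sum>u\<in>A. (if u \<in> N x then 1 else 0::nat)) = card (N x \<inter> A)"
      using insert by (simp add: sum.If_cases Int_commute)
    have "(\<Sum>v\<in>insert x A. card (N v \<inter> insert x A)) = card (N x \<inter> A) + (\<Sum>v\<in>A. card (N v \<inter> A) + (if v \<in> N x then 1 else 0))"
      using insert v e by simp
    also have "\<dots> = 2 * card (N x \<inter> A) + (\<Sum>v\<in>A. card (N v \<inter> A))"
      unfolding sum.distrib s by simp
    finally show ?case using insert by simp
  qed simp
qed

text \<open>The contribution of \<open>v\<close> to the potential of the whole graph, since degree
  plus defect is the maximum of the degree and 2. It is -1 for light vertices and at least c - 1 for
  the others.\<close>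

definition charge :: "'a \<Rightarrow> int" where "charge v = c * max (int (card (N v))) 2 - (2*c+1)"

lemma charge_light: "light N v \<Longrightarrow> charge v = -1"
  by (auto simp: charge_def light_def max_def)

lemma charge_heavy: "\<not> light N v \<Longrightarrow> charge v = c * int (card (N v)) - (2*c+1)"
  by (auto simp: charge_def light_def max_def)

lemma deg_defect: "int (card (N v)) + defect N v = max (int (card (N v))) 2"
  by (auto simp: defect_def)

text \<open>An edge between \<open>M\<close> and its complement counts c at both ends in
  \<open>pot c N V\<close> and nothing in \<open>pot c N M\<close>. The half at the end in
  \<open>M\<close> is booked at the outer end, so that the difference is a sum over the complement
  alone.\<close>

lemma pot_diff:
  assumes "M \<subseteq> V"
  shows "pot c N V - pot c N M = (\<Sum>v\<in>V - M. charge v + c * int (card (N v \<inter> M)))"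
proof -
  have f: "finite M" "finite (V-M)" using assms fin finite_subset by blast+
  have nv: "N v \<inter> V = N v" for v using sub by auto
  have k: "card (N v) = card (N v \<inter> M) + card (N v \<inter> (V - M))" for v
  proof -
    have "N v = (N v \<inter> M) \<union> (N v \<inter> (V - M))" using sub assms by auto
    then show ?thesis using card_Un_disjoint[of "N v \<inter> M" "N v \<inter> (V-M)"] by auto
  qed
  have V: "V = M \<union> (V-M)" using assms by auto
  have "pot c N V = (\<Sum>v\<in>V. charge v)"
    unfolding pot_def charge_def nv deg_defect ..
  also have "\<dots> = (\<Sum>v\<in>M. charge v) + (\<Sum>v\<in>V-M. charge v)"
    using sum.union_disjoint[OF f] V by (metis Diff_disjoint)
  also have "(\<Sum>v\<in>M. charge v) = (\<Sum>v\<in>M. (c * (int (card (N v \<inter> M)) + defect N v) - (2 * c + 1)) + c * int (card (N v \<inter> (V-M))))"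
  proof (rule sum.cong)
    fix v
    have "charge v = c * (int (card (N v)) + defect N v) - (2*c+1)" by (simp add: charge_def deg_defect)
    also have "int (card (N v)) = int (card (N v \<inter> M)) + int (card (N v \<inter> (V-M)))" using k[of v] by simp
    finally show "charge v = (c * (int (card (N v \<inter> M)) + defect N v) - (2 * c + 1)) + c * int (card (N v \<inter> (V-M)))"
      by (simp add: algebra_simps)
  qed simp
  also have "\<dots> = pot c N M + c * int (\<Sum>v\<in>M. card (N v \<inter> (V-M)))"
    unfolding sum.distrib pot_def by (simp add: sum_distrib_left)
  also have "(\<Sum>v\<in>M. card (N v \<inter> (V-M))) = (\<Sum>v\<in>V-M. card (N v \<inter> M))"
    by (rule handshake) (use assms in auto)
  finally show ?thesis by (simp add: sum.distrib sum_distrib_left)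
qed

lemma pot_total: "pot c N V = (\<Sum>v\<in>V. charge v)"
  using pot_diff[of "{}"] by simp

section \<open>Half-edges lost by deleting vertices\<close>

lemma pot_del:
  assumes "A \<subseteq> V - S"
  shows "pot c (del S N) A = pot c N A + c * (\<Sum>v\<in>A. loss S N v)"
proof -
  have "pot c (del S N) A = (\<Sum>v\<in>A. (c * (int (card (N v \<inter> A)) + defect N v) - (2 * c + 1)) + c * loss S N v)"
    unfolding pot_def
  proof (rule sum.cong)
    fix v assume "v \<in> A"
    then have "del S N v \<inter> A = N v \<inter> A" using assms by (auto simp: del_def)
    then show "c * (int (card (del S N v \<inter> A)) + defect (del S N) v) - (2 * c + 1) =
         c * (int (card (N v \<inter> A)) + defect N v) - (2 * c + 1) + c * loss S N v"
      by (simp add: loss_def algebra_simps)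
  qed simp
  then show ?thesis by (simp add: sum.distrib pot_def sum_distrib_left)
qed

lemma loss_0: "N v \<inter> S = {} \<Longrightarrow> v \<notin> S \<Longrightarrow> loss S N v = 0"
  by (simp add: loss_def del_def defect_def Diff_triv)

lemma loss_ge2: "v \<notin> S \<Longrightarrow> 2 \<le> card (N v - S) \<Longrightarrow> loss S N v = 0"
proof -
  assume a: "v \<notin> S" "2 \<le> card (N v - S)"
  have "card (N v - S) \<le> card (N v)" by (rule card_mono) auto
  with a show ?thesis by (simp add: loss_def del_def defect_def)
qed

lemma card_split: "card (N v) = card (N v - S) + card (N v \<inter> S)"
  by (metis finN card_Diff_subset_Int finite_Int Int_lower1 card_mono le_add_diff_inverse2)

lemma loss_le: "v \<notin> S \<Longrightarrow> loss S N v \<le> int (card (N v \<inter> S))"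
  using card_split[of v S] by (simp add: loss_def del_def defect_def)

text \<open>A heavy vertex has degree at least 3, so after its first lost neighbour the degree is
  still at least 2 and nothing is missing.\<close>

lemma loss_heavy_le: "v \<notin> S \<Longrightarrow> \<not> light N v \<Longrightarrow> loss S N v \<le> max 0 (int (card (N v \<inter> S)) - 1)"
  using card_split[of v S] by (simp add: loss_def del_def defect_def light_def)

lemma loss_heavy1: "v \<notin> S \<Longrightarrow> \<not> light N v \<Longrightarrow> card (N v \<inter> S) \<le> 1 \<Longrightarrow> loss S N v = 0"
  using card_split[of v S] by (simp add: loss_def del_def defect_def light_def)

text \<open>The properties of an inclusion-minimal set of potential at least 3.\<close>

definition minbad :: "'a set \<Rightarrow> bool" where
  "minbad A \<longleftrightarrow> A \<subseteq> V \<and> 3 \<le> pot c N A \<and>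
     (\<forall>x\<in>A. light N x \<longrightarrow> N x \<subseteq> A \<and> N x \<noteq> {}) \<and>
     (\<forall>x y. x \<in> A \<longrightarrow> N x = {y} \<longrightarrow> light N y \<longrightarrow> c = 3 \<and> N y \<noteq> {x}) \<and>
     (\<forall>W. W \<subseteq> V \<longrightarrow> (\<forall>w\<in>W. light N w \<and> N w \<subseteq> W) \<longrightarrow> A \<inter> W = {})"

lemma not_sparse_minbad:
  assumes "\<not> sparse c V N"
  obtains A where "minbad A"
proof -
  obtain A0 where "A0 \<subseteq> V" "3 \<le> pot c N A0" using assms by (auto simp: sparse_def not_le)
  then obtain A where A: "A \<subseteq> V" "3 \<le> pot c N A" 
    and m: "\<And>B. B \<subseteq> V \<Longrightarrow> 3 \<le> pot c N B \<Longrightarrow> card A \<le> card B"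
    using ex_has_least_nat[of "\<lambda>B. B \<subseteq> V \<and> 3 \<le> pot c N B" A0 card] by auto
  have fA: "finite A" using A fin finite_subset by blast
  have sm: "pot c N B \<le> 2" if "B \<subset> A" for B
  proof (rule ccontr)
    assume "\<not> ?thesis"
    then have "card A \<le> card B" using m[of B] that A by auto
    then show False using psubset_card_mono[OF fA that] by auto
  qed
  \<comment> \<open>By minimality removing \<open>x\<close> lowers the potential by at least 1. A
    light vertex without neighbours, or with a neighbour outside \<open>A\<close>, has a negative
    marginal in \<open>A\<close>.\<close>
  have 1: "N x \<subseteq> A \<and> N x \<noteq> {}" if "x \<in> A" "light N x" for x
  proof -
    have "pot c N (A - {x}) \<le> 2" using sm that by auto
    then have q: "2*c+2 \<le> 2*c* int (card (N x \<inter> A)) + c * defect N x"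
      using pot_remove[OF A(1) that(1)] A by linarith
    define i where "i = int (card (N x \<inter> A))"
    define d where "d = int (card (N x))"
    have id: "0 \<le> i" "i \<le> d" unfolding i_def d_def by (auto intro: card_mono)
    have dd: "defect N x = 2 - d" using that(2) by (simp add: defect_def light_def d_def)
    have d2: "d \<le> 2" using that(2) by (simp add: light_def d_def)
    have "i = d \<and> d \<noteq> 0"
    proof -
      have "2*c+2 \<le> 2*c*i + c*(2-d)" using q dd i_def by simp
      moreover have "d = 0 \<or> d = 1 \<or> d = 2" using d2 id by auto
      moreover have "i = 0 \<or> i = 1 \<or> i = 2" using d2 id by auto
      ultimately show ?thesis using c23 id by auto
    qed
    then have "card (N x \<inter> A) = card (N x)" "N x \<noteq> {}" unfolding i_def d_def by auto
    then show ?thesis by (metis Int_lower1 Int_lower2 card_subset_eq finN)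
  qed
  \<comment> \<open>Compared with \<open>A - {x, y}\<close>, the set \<open>A\<close> gains c - 1
    from the leaf \<open>x\<close>, and from \<open>y\<close> it gains -c - 1 if \<open>y\<close> is
    also a leaf and -1 if \<open>y\<close> has degree 2. The totals are -2 and c - 2; by minimality
    the total is at least 1, so only c = 3 with degree 2 survives.\<close>
  have 2: "c = 3 \<and> N y \<noteq> {x}" if "x \<in> A" "N x = {y}" "light N y" for x y
  proof -
    have lx: "light N x" using that by (simp add: light_def)
    have yA: "y \<in> A" using 1[OF that(1) lx] that by auto
    have xy: "x \<noteq> y" using irr that by auto
    have xNy: "x \<in> N y" using sym that by auto
    have Ny: "N y \<subseteq> A" using 1[OF yA that(3)] by auto
    have p1: "pot c N A = pot c N (A - {x}) + c - 1"
      using pot_remove[OF A(1) that(1)] that yA by (simp add: defect_def)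
    have "card (N y \<inter> (A - {x})) = card (N y) - 1"
    proof -
      have "N y \<inter> (A - {x}) = N y - {x}" using Ny by auto
      then show ?thesis using xNy by simp
    qed
    moreover have "0 < card (N y)" using xNy by (auto simp: card_gt_0_iff)
    ultimately have i: "int (card (N y \<inter> (A - {x}))) = int (card (N y)) - 1" by simp
    have d: "defect N y = 2 - int (card (N y))" using that by (simp add: defect_def light_def)
    have p2: "pot c N (A - {x}) = pot c N (A - {x} - {y}) + 2*c*(int (card (N y)) - 1) + c*(2 - int (card (N y))) - (2*c+1)"
      using pot_remove[of "A - {x}" y] A yA xy i d by auto
    have "pot c N (A - {x} - {y}) \<le> 2" using sm[of "A - {x} - {y}"] that by auto
    then have g: "3 \<le> 2 + c - 1 + 2*c*(int (card (N y)) - 1) + c*(2 - int (card (N y))) - (2*c+1)" using p1 p2 A by linarith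
    have "card (N y) = 1 \<or> card (N y) = 2" using \<open>0 < card (N y)\<close> that(3) by (auto simp: light_def)
    then have "c = 3 \<and> card (N y) = 2" using g c23 by auto
    then show ?thesis by auto
  qed
  \<comment> \<open>\<open>W\<close> is a union of components made of light vertices, and such
    vertices contribute at most 0, so dropping \<open>W\<close> from \<open>A\<close> would not
    lower the potential.\<close>
  have 3: "A \<inter> W = {}" if W: "W \<subseteq> V" "\<forall>w\<in>W. light N w \<and> N w \<subseteq> W" for W
  proof (rule ccontr)
    assume ne: "A \<inter> W \<noteq> {}"
    have "A = (A - W) \<union> (A \<inter> W)" by auto
    then have "pot c N A = pot c N ((A - W) \<union> (A \<inter> W))" by simp
    also have "\<dots> = pot c N (A - W) + pot c N (A \<inter> W)"
      by (rule pot_disjoint) (use A W sym in blast)+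
    finally have e: "pot c N A = pot c N (A - W) + pot c N (A \<inter> W)" .
    have "pot c N (A \<inter> W) \<le> (\<Sum>v\<in>A \<inter> W. 0)"
      unfolding pot_def
    proof (rule sum_mono)
      fix v assume v: "v \<in> A \<inter> W"
      have "card (N v \<inter> (A \<inter> W)) \<le> card (N v)" by (rule card_mono) auto
      moreover have "card (N v) \<le> 2" using v W by (auto simp: light_def)
      ultimately have "int (card (N v \<inter> (A \<inter> W))) + defect N v \<le> 2" by (simp add: defect_def)
      then have "c * (int (card (N v \<inter> (A \<inter> W))) + defect N v) \<le> c * 2" using c23 by auto
      then show "c * (int (card (N v \<inter> (A \<inter> W))) + defect N v) - (2 * c + 1) \<le> 0" by simp
    qed
    moreover have "pot c N (A - W) \<le> 2" using sm[of "A - W"] ne by auto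
    ultimately show False using e A by simp
  qed
  show ?thesis by (rule that[of A]) (use A 1 2 3 in \<open>auto simp: minbad_def\<close>)
qed

text \<open>\<open>bad S A\<close> is \<open>minbad A\<close> for the graph with \<open>S\<close> deleted, expressed in terms of \<open>N\<close>.\<close>

definition bad :: "'a set \<Rightarrow> 'a set \<Rightarrow> bool" where
  "bad S A \<longleftrightarrow> A \<subseteq> V - S \<and> 3 \<le> pot c N A + c * (\<Sum>v\<in>A. loss S N v) \<and>
     (\<forall>x\<in>A. card (N x - S) \<le> 2 \<longrightarrow> N x - S \<subseteq> A \<and> N x - S \<noteq> {}) \<and>
     (\<forall>x y. x \<in> A \<longrightarrow> N x - S = {y} \<longrightarrow> card (N y - S) \<le> 2 \<longrightarrow> c = 3 \<and> N y - S \<noteq> {x}) \<and>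
     (\<forall>W. W \<subseteq> V - S \<longrightarrow> (\<forall>w\<in>W. card (N w - S) \<le> 2 \<and> N w - S \<subseteq> W) \<longrightarrow> A \<inter> W = {})"

lemma not_sparse_bad:
  assumes "\<not> sparse c (V - S) (del S N)"
  obtains A where "bad S A"
proof -
  interpret D: nbr_graph "V - S" "del S N" c by (rule del_graph)
  obtain A where A: "D.minbad A" using D.not_sparse_minbad assms by blast
  have sub: "A \<subseteq> V - S" and p: "3 \<le> pot c (del S N) A"
    and m1: "\<And>x. x \<in> A \<Longrightarrow> light (del S N) x \<Longrightarrow> del S N x \<subseteq> A \<and> del S N x \<noteq> {}"
    and m2: "\<And>x y. x \<in> A \<Longrightarrow> del S N x = {y} \<Longrightarrow> light (del S N) y \<Longrightarrow> c = 3 \<and> del S N y \<noteq> {x}"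
    and m3: "\<And>W. W \<subseteq> V - S \<Longrightarrow> \<forall>w\<in>W. light (del S N) w \<and> del S N w \<subseteq> W \<Longrightarrow> A \<inter> W = {}"
    using A unfolding D.minbad_def by blast+
  have n: "del S N x = N x - S" if "x \<notin> S" for x using that by (simp add: del_def)
  have l: "light (del S N) x \<longleftrightarrow> card (N x - S) \<le> 2" if "x \<notin> S" for x using n[OF that] by (simp add: light_def)
  have "bad S A"
    unfolding bad_def
  proof (intro conjI ballI allI impI)
    show "A \<subseteq> V - S" by fact
    show "3 \<le> pot c N A + c * (\<Sum>v\<in>A. loss S N v)"
      using p pot_del[OF sub] by simp
  next
    fix x assume x: "x \<in> A" "card (N x - S) \<le> 2"
    then have s: "x \<notin> S" using sub by auto
    show "N x - S \<subseteq> A" "N x - S \<noteq> {}" using m1[OF x(1)] x(2) unfolding l[OF s] n[OF s] by auto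
  next
    fix x y assume h: "x \<in> A" "N x - S = {y}" "card (N y - S) \<le> 2"
    then have s: "x \<notin> S" "y \<notin> S" using sub by auto
    show "c = 3" "N y - S \<noteq> {x}" using m2[OF h(1), of y] h(2,3) unfolding l[OF s(2)] n[OF s(2)] n[OF s(1)] by auto
  next
    fix W assume W: "W \<subseteq> V - S" "\<forall>w\<in>W. card (N w - S) \<le> 2 \<and> N w - S \<subseteq> W"
    have "\<forall>w\<in>W. light (del S N) w \<and> del S N w \<subseteq> W"
    proof
      fix w assume w: "w \<in> W"
      then have s: "w \<notin> S" using W by auto
      show "light (del S N) w \<and> del S N w \<subseteq> W" using W(2) w unfolding l[OF s] n[OF s] by auto
    qed
    then show "A \<inter> W = {}" using m3[OF W(1)] by auto
  qed
  then show ?thesis by (rule that)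
qed

lemma badD:
  assumes "bad S A"
  shows "A \<subseteq> V - S" "3 \<le> pot c N A + c * (\<Sum>v\<in>A. loss S N v)"
    "\<And>x. x \<in> A \<Longrightarrow> card (N x - S) \<le> 2 \<Longrightarrow> N x - S \<subseteq> A"
    "\<And>x. x \<in> A \<Longrightarrow> N x - S \<noteq> {}"
    "\<And>x y. x \<in> A \<Longrightarrow> N x - S = {y} \<Longrightarrow> card (N y - S) \<le> 2 \<Longrightarrow> c = 3"
    "\<And>x y. x \<in> A \<Longrightarrow> N x - S = {y} \<Longrightarrow> N y - S \<noteq> {x}"
    "\<And>W. W \<subseteq> V - S \<Longrightarrow> (\<And>w. w \<in> W \<Longrightarrow> card (N w - S) \<le> 2) \<Longrightarrow> (\<And>w. w \<in> W \<Longrightarrow> N w - S \<subseteq> W) \<Longrightarrow> A \<inter> W = {}"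
proof -
  note b = assms[unfolded bad_def]
  from b show "A \<subseteq> V - S" by (elim conjE)
  from b show "3 \<le> pot c N A + c * (\<Sum>v\<in>A. loss S N v)" by (elim conjE)
  from b have b3: "\<forall>x\<in>A. card (N x - S) \<le> 2 \<longrightarrow> N x - S \<subseteq> A \<and> N x - S \<noteq> {}" by (elim conjE)
  from b have b4: "\<forall>x y. x \<in> A \<longrightarrow> N x - S = {y} \<longrightarrow> card (N y - S) \<le> 2 \<longrightarrow> c = 3 \<and> N y - S \<noteq> {x}" by (elim conjE)
  from b have b5: "\<forall>W. W \<subseteq> V - S \<longrightarrow> (\<forall>w\<in>W. card (N w - S) \<le> 2 \<and> N w - S \<subseteq> W) \<longrightarrow> A \<inter> W = {}" by (elim conjE)
  show "\<And>x. x \<in> A \<Longrightarrow> card (N x - S) \<le> 2 \<Longrightarrow> N x - S \<subseteq> A" using b3 by metis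
  show "\<And>x y. x \<in> A \<Longrightarrow> N x - S = {y} \<Longrightarrow> card (N y - S) \<le> 2 \<Longrightarrow> c = 3" using b4 by metis
  show "\<And>W. W \<subseteq> V - S \<Longrightarrow> (\<And>w. w \<in> W \<Longrightarrow> card (N w - S) \<le> 2) \<Longrightarrow> (\<And>w. w \<in> W \<Longrightarrow> N w - S \<subseteq> W) \<Longrightarrow> A \<inter> W = {}"
  proof -
    fix W assume "W \<subseteq> V - S" "\<And>w. w \<in> W \<Longrightarrow> card (N w - S) \<le> 2" "\<And>w. w \<in> W \<Longrightarrow> N w - S \<subseteq> W"
    then show "A \<inter> W = {}" using b5[rule_format, of W] by simp
  qed
  show "\<And>x. x \<in> A \<Longrightarrow> N x - S \<noteq> {}"
  proof
    fix x assume x: "x \<in> A" "N x - S = {}"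
    then have "card (N x - S) \<le> 2" by (metis card.empty le0)
    then show False using b3[rule_format, OF x(1)] x(2) by simp
  qed
  show "\<And>x y. x \<in> A \<Longrightarrow> N x - S = {y} \<Longrightarrow> N y - S \<noteq> {x}"
  proof
    fix x y assume x: "x \<in> A" "N x - S = {y}" "N y - S = {x}"
    then have "card (N y - S) \<le> 2" by simp
    then show False using b4[rule_format, OF x(1,2)] x(3) by simp
  qed
qed

section \<open>Light vertices and bad sets\<close>

lemma lightI:
  assumes "N v \<subseteq> {a, b}" shows "light N v"
proof -
  have "card (N v) \<le> card {a, b}" by (rule card_mono) (use assms in auto)
  also have "\<dots> \<le> 2" by (cases "a = b") auto
  finally show ?thesis by (simp add: light_def)
qed

lemma light_cases:
  assumes "light N x" "v \<in> N x"
  obtains "N x = {v}" | y where "y \<noteq> v" "N x = {v, y}"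
proof -
  have "card (N x - {v}) \<le> 1" using assms by (simp add: light_def)
  then have "card (N x - {v}) = 0 \<or> card (N x - {v}) = 1" by linarith
  then show ?thesis
  proof
    assume "card (N x - {v}) = 0"
    then have "N x - {v} = {}" by (metis finN finite_Diff card_0_eq)
    then have "N x = {v}" using assms by auto
    then show ?thesis by (rule that(1))
  next
    assume "card (N x - {v}) = 1"
    then obtain y where "N x - {v} = {y}" by (auto simp: card_1_singleton_iff)
    then have "y \<noteq> v" "N x = {v, y}" using assms by auto
    then show ?thesis by (rule that(2))
  qed
qed

lemma heavy_ge3: "\<not> light N v \<Longrightarrow> 3 \<le> card (N v)" by (simp add: light_def)

lemma sparseD: "sparse c V N \<Longrightarrow> A \<subseteq> V \<Longrightarrow> pot c N A \<le> 2" by (simp add: sparse_def)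

lemma finV: "A \<subseteq> V \<Longrightarrow> finite A" using fin finite_subset by blast

lemma inV: "u \<in> N v \<Longrightarrow> u \<in> V" "u \<in> N v \<Longrightarrow> v \<in> V" using sub sym by blast+

lemma loss_sum_restrict:
  assumes "finite A" "\<And>x. x \<in> A \<Longrightarrow> x \<notin> D \<Longrightarrow> loss S N x = 0"
  shows "(\<Sum>v\<in>A. loss S N v) = (\<Sum>v\<in>A \<inter> D. loss S N v)"
  by (rule sum.mono_neutral_right) (use assms in auto)

lemma bad_loss_pos:
  assumes "sparse c V N" "bad S A" shows "0 < (\<Sum>v\<in>A. loss S N v)"
proof (rule ccontr)
  assume "\<not> ?thesis"
  then have "c * (\<Sum>v\<in>A. loss S N v) \<le> 0" using c23 by auto
  moreover have "pot c N A \<le> 2" using assms badD(1) sparseD by blast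
  ultimately show False using badD(2)[OF assms(2)] by linarith
qed

lemma no_loss_sparse:
  assumes "sparse c V N" "\<And>v. v \<in> V \<Longrightarrow> v \<notin> S \<Longrightarrow> loss S N v = 0"
  shows "sparse c (V - S) (del S N)"
proof (rule ccontr)
  assume "\<not> ?thesis"
  then obtain A where A: "bad S A" by (rule not_sparse_bad)
  have "(\<Sum>v\<in>A. loss S N v) = 0" using assms(2) badD(1)[OF A] by (intro sum.neutral) blast
  then show False using bad_loss_pos[OF assms(1) A] by simp
qed

text \<open>If the only vertex of a bad set that lost an edge is the light vertex \<open>y\<close>, the bad set consists of a dense set \<open>C\<close> and of the rest
  of the path of light vertices through \<open>y\<close>. For \<open>c = 2\<close> that rest is \<open>y\<close> alone, for \<open>c = 3\<close> it has one or two vertices.\<close>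

lemma peel:
  assumes sp: "sparse c V N" and A: "bad S A" and y: "N y = {s, y1}" "s \<in> S" "y1 \<notin> S" "y \<notin> S"
    and L: "\<And>x. x \<in> A \<Longrightarrow> x \<noteq> y \<Longrightarrow> loss S N x = 0"
  shows "(\<not> light N y1 \<and> (\<exists>C. C \<subseteq> V - S - {y} \<and> y1 \<in> C \<and> 4 - c \<le> pot c N C)) \<or>
     (c = 3 \<and> light N y1 \<and> (\<exists>y2. N y1 = {y, y2} \<and> \<not> light N y2 \<and> y2 \<noteq> y \<and> y2 \<notin> S \<and>
        (\<exists>C. C \<subseteq> V - S - {y, y1} \<and> y2 \<in> C \<and> 2 \<le> pot c N C)))"
proof -
  have AV: "A \<subseteq> V" "A \<inter> S = {}" using badD(1)[OF A] by auto
  have fA: "finite A" using AV finV by blast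
  have sy: "s \<noteq> y1" using y by auto
  have ly: "light N y" by (rule lightI) (use y in auto)
  have yA: "y \<in> A"
  proof (rule ccontr)
    assume "y \<notin> A"
    then have "(\<Sum>v\<in>A. loss S N v) = 0" using L by (intro sum.neutral) auto
    then show False using bad_loss_pos[OF sp A] by simp
  qed
  have l1: "loss S N y \<le> 1" using loss_le[OF y(4)] y by (simp add: Int_insert_left)
  have "(\<Sum>v\<in>A. loss S N v) = (\<Sum>v\<in>A \<inter> {y}. loss S N v)"
    by (rule loss_sum_restrict[OF fA]) (use L in auto)
  also have "\<dots> \<le> 1" using yA l1 by simp
  finally have "c * (\<Sum>v\<in>A. loss S N v) \<le> c" using c23 by auto
  then have pA: "3 - c \<le> pot c N A" using badD(2)[OF A] by linarith
  have nyS: "N y - S = {y1}" using y by auto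
  have y1A: "y1 \<in> A" using badD(3)[OF A yA] nyS by simp
  have ny1: "N y \<inter> A = {y1}" using y AV y1A by auto
  have yy1: "y \<noteq> y1" using y irr by auto
  define B where "B = A - {y}"
  \<comment> \<open>One lost half-edge is worth c, so \<open>A\<close> has potential at least 3 - c
    in the original graph. Now \<open>y\<close> hangs on the rest of \<open>A\<close> by a single
    edge, and removing it gains 1.\<close>
  have pB: "4 - c \<le> pot c N B"
    using pot_remove[OF AV(1) yA] pA ny1 y sy by (simp add: defect_def B_def)
  have B: "B \<subseteq> V - S - {y}" "y1 \<in> B" using AV y1A yy1 by (auto simp: B_def)
  show ?thesis
  proof (cases "light N y1")
    case False
    then show ?thesis using B pB by blast
  next
    case True
    have yin: "y \<in> N y1" using y sym by auto
    have noS: "N x \<inter> S = {}" if "x \<in> A" "x \<noteq> y" "light N x" for x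
    proof -
      have "loss S N x = int (card (N x \<inter> S))"
        using card_split[of x S] that AV by (auto simp: loss_def del_def defect_def light_def)
      then show ?thesis using L[OF that(1,2)] by simp
    qed
    have y1S: "N y1 - S = N y1" using noS[OF y1A] yy1 True by auto
    have cy1: "card (N y1 - S) \<le> 2" using True y1S by (simp add: light_def)
    have c3: "c = 3" using badD(5)[OF A yA nyS cy1] .
    have "N y1 \<noteq> {y}" using badD(6)[OF A yA nyS] y1S by simp
    then obtain y2 where y2: "y2 \<noteq> y" "N y1 = {y, y2}" using light_cases[OF True yin] by metis
    have y2A: "y2 \<in> A" using badD(3)[OF A y1A cy1] y1S y2 by auto
    have y21: "y2 \<noteq> y1" using y2 irr by auto
    define C where "C = B - {y1}"
    have "N y1 \<inter> B = {y2}" using y2 y2A by (auto simp: B_def)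
    moreover have "B \<subseteq> V" using B by auto
    ultimately have pC: "2 \<le> pot c N C"
      using pot_remove[of B y1] B(2) pB y2 c3 by (auto simp: defect_def C_def)
    have CV: "C \<subseteq> V" "C \<subseteq> V - S - {y, y1}" "y2 \<in> C" using B y2A y2 y21 by (auto simp: C_def B_def)
    \<comment> \<open>For c = 3 removing \<open>y\<close> and \<open>y1\<close> has already brought
      the potential to 2. A light \<open>y2\<close> could be removed as well, which would leave at
      least 3.\<close>
    have "\<not> light N y2"
    proof
      assume l2: "light N y2"
      have y1in: "y1 \<in> N y2" using y2 sym by auto
      consider "N y2 = {y1}" | y3 where "y3 \<noteq> y1" "N y2 = {y1, y3}" using light_cases[OF l2 y1in] by metis
      then have "3 \<le> pot c N (C - {y2})"
      proof cases
        case 1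
        then have "N y2 \<inter> C = {}" by (auto simp: C_def)
        then show ?thesis using pot_remove[of C y2] CV pC 1 c3 by (auto simp: defect_def)
      next
        case (2 y3)
        then have "N y2 \<inter> C \<subseteq> {y3}" by (auto simp: C_def)
        then have "card (N y2 \<inter> C) \<le> card {y3}" by (rule card_mono[rotated]) simp
        then show ?thesis using pot_remove[of C y2] CV pC 2 c3 by (auto simp: defect_def)
      qed
      moreover have "pot c N (C - {y2}) \<le> 2" by (rule sparseD[OF sp]) (use CV in auto)
      ultimately show False by simp
    qed
    moreover have "y2 \<notin> S" using y2A AV by auto
    ultimately show ?thesis using c3 True y2 CV pC by blast
  qed
qed

lemma pot_union_ge:
  assumes "sparse c V N" "A \<subseteq> V" "B \<subseteq> V"
  shows "pot c N A + pot c N B - 2 \<le> pot c N (A \<union> B)"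
proof -
  have "A \<inter> B \<subseteq> V" using assms by auto
  then show ?thesis using pot_supermod[OF assms(2,3)] sparseD[OF assms(1), of "A \<inter> B"] by linarith
qed

lemma heavy_card_V: "\<not> light N v \<Longrightarrow> 4 \<le> card V"
proof -
  assume h: "\<not> light N v"
  have "N v \<noteq> {}" using h by (auto simp: light_def)
  then have "insert v (N v) \<subseteq> V" using inV by auto
  then have "card (insert v (N v)) \<le> card V" using fin by (rule card_mono[rotated])
  then show ?thesis using h irr by (simp add: light_def)
qed

lemma charge_heavy_ge: "\<not> light N v \<Longrightarrow> 1 \<le> charge v"
proof -
  assume h: "\<not> light N v"
  then have "c * 3 \<le> c * int (card (N v))" using c23 by (auto simp: light_def)
  then show ?thesis using charge_heavy[OF h] c23 by auto
qed

lemma light_exists: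
  assumes "sparse c V N" "V \<noteq> {}" shows "\<exists>x\<in>V. light N x"
proof (rule ccontr)
  assume n: "\<not> ?thesis"
  have "(\<Sum>v\<in>V. 1) \<le> (\<Sum>v\<in>V. charge v)" by (rule sum_mono) (use n charge_heavy_ge in auto)
  then have "int (card V) \<le> 2" using pot_total sparseD[OF assms(1), of V] by simp
  moreover obtain v where "v \<in> V" using assms by auto
  ultimately show False using heavy_card_V n by force
qed

lemma all_light_pot:
  assumes "A \<subseteq> V" "\<forall>v\<in>A. light N v" shows "pot c N A \<le> - int (card A)"
proof -
  have "pot c N A \<le> (\<Sum>v\<in>A. -1)"
    unfolding pot_def
  proof (rule sum_mono)
    fix v assume v: "v \<in> A"
    have "card (N v \<inter> A) \<le> card (N v)" by (rule card_mono) auto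
    moreover have "card (N v) \<le> 2" using v assms by (auto simp: light_def)
    ultimately have "int (card (N v \<inter> A)) + defect N v \<le> 2" by (simp add: defect_def)
    then have "c * (int (card (N v \<inter> A)) + defect N v) \<le> c * 2" using c23 by auto
    then show "c * (int (card (N v \<inter> A)) + defect N v) - (2 * c + 1) \<le> -1" by simp
  qed
  then show ?thesis by simp
qed

lemma light_del: "light N v \<Longrightarrow> light (del S N) v"
proof -
  have "card (del S N v) \<le> card (N v)" by (rule card_mono) (auto simp: del_def)
  then show "light N v \<Longrightarrow> light (del S N) v" by (simp add: light_def)
qed

lemma all_light_sparse:
  assumes "\<forall>v\<in>V. light N v" shows "sparse c V N"
  unfolding sparse_def
proof (intro allI impI)
  fix A assume "A \<subseteq> V"
  then have "pot c N A \<le> - int (card A)" using all_light_pot[of A] assms by auto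
  then show "pot c N A \<le> 2" by linarith
qed

text \<open>Otherwise the heavy vertices form a union of components in which each contributes at
  least 1. As they include the three or more neighbours of \<open>x0\<close>, their potential would
  exceed 2.\<close>

lemma light_next_heavy:
  assumes "sparse c V N" "x0 \<in> V" "\<not> light N x0"
  shows "\<exists>x v. light N x \<and> v \<in> N x \<and> \<not> light N v"
proof (rule ccontr)
  assume n: "\<not> ?thesis"
  define H where "H = {v\<in>V. \<not> light N v}"
  have HV: "H \<subseteq> V" by (auto simp: H_def)
  have cl: "N v \<inter> H = N v" if "v \<in> H" for v using n that sym inV by (auto simp: H_def)
  have "pot c N H = (\<Sum>v\<in>H. charge v)" unfolding pot_def charge_def
    by (rule sum.cong) (auto simp: cl deg_defect)
  moreover have "(\<Sum>v\<in>H. 1) \<le> (\<Sum>v\<in>H. charge v)" by (rule sum_mono) (use charge_heavy_ge in \<open>auto simp: H_def\<close>)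
  ultimately have "int (card H) \<le> 2" using sparseD[OF assms(1) HV] by simp
  moreover have "card (N x0) \<le> card H" by (rule card_mono[OF finV[OF HV]]) (use n assms sym inV in \<open>auto simp: H_def\<close>)
  ultimately show False using heavy_ge3[OF assms(3)] by linarith
qed

section \<open>Deleting one light vertex\<close>

lemma two_heavy_nbrs_loss:
  assumes "\<not> light N v" "v \<notin> S" "N v \<inter> S \<subseteq> {x}" shows "loss S N v = 0"
proof (rule loss_heavy1)
  have "card (N v \<inter> S) \<le> card {x}" by (rule card_mono) (use assms in auto)
  then show "card (N v \<inter> S) \<le> 1" by simp
qed (use assms in auto)

text \<open>The heavy neighbour \<open>v\<close> of \<open>x\<close> loses one edge and hence no
  half-edge. So the obstruction sits at the other neighbour of \<open>x\<close>, which must be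
  light, and \<open>peel\<close> describes what lies beyond it.\<close>

lemma L1_side:
  assumes sp: "sparse c V N" and ns: "\<not> sparse c (V - {x}) (del {x} N)" and lx: "light N x"
    and v: "v \<in> N x" "\<not> light N v"
  obtains y y1 where "N x = {v, y}" "y \<noteq> v" "light N y" "N y = {x, y1}" "y1 \<noteq> x"
    "(\<not> light N y1 \<and> (\<exists>C. C \<subseteq> V - {x, y} \<and> y1 \<in> C \<and> 4 - c \<le> pot c N C)) \<or>
     (c = 3 \<and> light N y1 \<and> (\<exists>y2. N y1 = {y, y2} \<and> \<not> light N y2 \<and> y2 \<noteq> y \<and> y2 \<noteq> x \<and>
        (\<exists>C. C \<subseteq> V - {x, y, y1} \<and> y2 \<in> C \<and> 2 \<le> pot c N C)))"
proof -
  obtain A where A: "bad {x} A" using ns by (rule not_sparse_bad)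
  have AV: "A \<subseteq> V - {x}" using badD(1)[OF A] .
  obtain w where w: "w \<in> A" "loss {x} N w \<noteq> 0"
    using bad_loss_pos[OF sp A] by (metis less_irrefl sum.neutral)
  have wx: "w \<noteq> x" using AV w by auto
  have xw: "x \<in> N w" using loss_0[of w "{x}"] w wx by auto
  have lw: "light N w" using two_heavy_nbrs_loss[of w "{x}" x] w wx by auto
  have wN: "w \<in> N x" using xw sym by auto
  have wv: "w \<noteq> v" using lw v by auto
  have Nx: "N x = {v, w}" using light_cases[OF lx v(1)] wN wv by auto
  have "N w - {x} \<noteq> {}" using badD(4)[OF A w(1)] .
  then obtain y1 where y1: "y1 \<noteq> x" "N w = {x, y1}" using light_cases[OF lw xw] by auto
  have L: "loss {x} N u = 0" if "u \<in> A" "u \<noteq> w" for u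
  proof (cases "u = v")
    case True
    then show ?thesis using two_heavy_nbrs_loss[of v "{x}" x] v that AV by auto
  next
    case False
    then have "x \<notin> N u" using sym[of x u] Nx that by auto
    then show ?thesis using loss_0[of u "{x}"] that AV by auto
  qed
  have e: "V - {x} - {w} = V - {x, w}" "V - {x} - {w, y1} = V - {x, w, y1}" by auto
  show ?thesis
  proof (rule that[OF Nx wv lw y1(2,1)])
    show "(\<not> light N y1 \<and> (\<exists>C. C \<subseteq> V - {x, w} \<and> y1 \<in> C \<and> 4 - c \<le> pot c N C)) \<or>
     (c = 3 \<and> light N y1 \<and> (\<exists>y2. N y1 = {w, y2} \<and> \<not> light N y2 \<and> y2 \<noteq> w \<and> y2 \<noteq> x \<and>
        (\<exists>C. C \<subseteq> V - {x, w, y1} \<and> y2 \<in> C \<and> 2 \<le> pot c N C)))"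
      using peel[OF sp A y1(2) _ _ _ L] y1 wx unfolding e by auto
  qed
qed

text \<open>Delete an end vertex of a path of light vertices. If this fails at both ends, there are dense sets at both ends of the path; their union
  together with the path has potential at least 3.\<close>

lemma remove_light:
  assumes sp: "sparse c V N" and ne: "V \<noteq> {}"
  obtains x where "x \<in> V" "light N x" "sparse c (V - {x}) (del {x} N)"
    "(\<exists>v\<in>N x. \<not> light N v) \<or> (\<forall>v\<in>V. light N v)"
proof (cases "\<forall>v\<in>V. light N v")
  case True
  obtain x where x: "x \<in> V" using ne by auto
  interpret D: nbr_graph "V - {x}" "del {x} N" c by (rule del_graph)
  show ?thesis by (rule that[of x]) (use True x light_del D.all_light_sparse in auto)
next
  case False
  then obtain x v where x: "light N x" "v \<in> N x" "\<not> light N v" using light_next_heavy[OF sp] by blast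
  show ?thesis
  proof (cases "sparse c (V - {x}) (del {x} N)")
    case True
    then show ?thesis using that[of x] x inV by blast
  next
    case ns: False
    obtain y y1 where y: "N x = {v, y}" "y \<noteq> v" "light N y" "N y = {x, y1}" "y1 \<noteq> x"
      and o: "(\<not> light N y1 \<and> (\<exists>C. C \<subseteq> V - {x, y} \<and> y1 \<in> C \<and> 4 - c \<le> pot c N C)) \<or>
     (c = 3 \<and> light N y1 \<and> (\<exists>y2. N y1 = {y, y2} \<and> \<not> light N y2 \<and> y2 \<noteq> y \<and> y2 \<noteq> x \<and>
        (\<exists>C. C \<subseteq> V - {x, y, y1} \<and> y2 \<in> C \<and> 2 \<le> pot c N C)))"
      by (rule L1_side[OF sp ns x(1,2,3)])
    have xV: "x \<in> V" "y \<in> V" "y1 \<in> V" using inV y x by blast+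
    have xy: "x \<noteq> y" using y irr by auto
    from o show ?thesis
    proof
      assume h: "\<not> light N y1 \<and> (\<exists>C. C \<subseteq> V - {x, y} \<and> y1 \<in> C \<and> 4 - c \<le> pot c N C)"
      then obtain C where C: "C \<subseteq> V - {x, y}" "y1 \<in> C" "4 - c \<le> pot c N C" by blast
      show ?thesis
      proof (cases "sparse c (V - {y}) (del {y} N)")
        case True
        then show ?thesis using that[of y] y h xV by auto
      next
        case ns2: False
        obtain C' where C': "C' \<subseteq> V - {x, y}" "v \<in> C'" "4 - c \<le> pot c N C'"
        proof -
          have "y1 \<in> N y" using y by auto
          from L1_side[OF sp ns2 y(3) this] h obtain z z1 where z: "N y = {y1, z}" "z \<noteq> y1" "N z = {y, z1}" "z1 \<noteq> y"
           and o2: "(\<not> light N z1 \<and> (\<exists>C. C \<subseteq> V - {y, z} \<and> z1 \<in> C \<and> 4 - c \<le> pot c N C)) \<or>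
     (c = 3 \<and> light N z1 \<and> (\<exists>y2. N z1 = {z, y2} \<and> \<not> light N y2 \<and> y2 \<noteq> z \<and> y2 \<noteq> y \<and>
        (\<exists>C. C \<subseteq> V - {y, z, z1} \<and> y2 \<in> C \<and> 2 \<le> pot c N C)))" by metis
          have "z = x" using z y by auto
          moreover have "z1 = v" using z y \<open>z = x\<close> by auto
          ultimately have "\<exists>C. C \<subseteq> V - {y, x} \<and> v \<in> C \<and> 4 - c \<le> pot c N C" using o2 x by auto
          then show ?thesis using that by (metis insert_commute)
        qed
        define U where "U = C \<union> C'"
        have U: "U \<subseteq> V" "x \<notin> U" "y \<notin> U" "v \<in> U" "y1 \<in> U" using C C' by (auto simp: U_def)
        \<comment> \<open>Two sets of potential at least 4 - c whose intersection has at most 2. The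
          path \<open>x\<close>, \<open>y\<close> adds -1 and then 2c - 1, so the total is at least
          4.\<close>
        have "6 - 2*c \<le> pot c N U" using pot_union_ge[OF sp, of C C'] C C' Diff_subset unfolding U_def
          by (smt (verit) subset_trans)
        moreover have "pot c N U - 1 \<le> pot c N (insert x U)"
          by (rule pot_add1[of _ _ v]) (use U y xV in auto)
        moreover have "pot c N (insert x U) + 2*c - 1 \<le> pot c N (insert y (insert x U))"
          by (rule pot_add2[of _ _ x y1]) (use U y xV xy in auto)
        moreover have "pot c N (insert y (insert x U)) \<le> 2" by (rule sparseD[OF sp]) (use U xV in auto)
        ultimately show ?thesis by linarith
      qed
    next
      assume h: "c = 3 \<and> light N y1 \<and> (\<exists>y2. N y1 = {y, y2} \<and> \<not> light N y2 \<and> y2 \<noteq> y \<and> y2 \<noteq> x \<and>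
        (\<exists>C. C \<subseteq> V - {x, y, y1} \<and> y2 \<in> C \<and> 2 \<le> pot c N C))"
      then obtain y2 C where y2: "N y1 = {y, y2}" "\<not> light N y2" "y2 \<noteq> y" "y2 \<noteq> x" and
        C: "C \<subseteq> V - {x, y, y1}" "y2 \<in> C" "2 \<le> pot c N C" by blast
      have c3: "c = 3" and l1: "light N y1" using h by auto
      have yy1: "y \<noteq> y1" using y irr by auto
      show ?thesis
      proof (cases "sparse c (V - {y1}) (del {y1} N)")
        case True
        then show ?thesis using that[of y1] y2 l1 xV by auto
      next
        case ns2: False
        obtain C' where C': "C' \<subseteq> V - {x, y, y1}" "v \<in> C'" "2 \<le> pot c N C'"
        proof -
          have "y2 \<in> N y1" using y2 by auto
          from L1_side[OF sp ns2 l1 this] y2 obtain z z1 where z: "N y1 = {y2, z}" "z \<noteq> y2" "N z = {y1, z1}" "z1 \<noteq> y1"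
           and o2: "(\<not> light N z1 \<and> (\<exists>C. C \<subseteq> V - {y1, z} \<and> z1 \<in> C \<and> 4 - c \<le> pot c N C)) \<or>
     (c = 3 \<and> light N z1 \<and> (\<exists>y2. N z1 = {z, y2} \<and> \<not> light N y2 \<and> y2 \<noteq> z \<and> y2 \<noteq> y1 \<and>
        (\<exists>C. C \<subseteq> V - {y1, z, z1} \<and> y2 \<in> C \<and> 2 \<le> pot c N C)))" by metis
          have zy: "z = y" using z y2 by auto
          have z1: "z1 = x" using z y zy by auto
          from o2 obtain y3 C' where "N x = {y, y3}" "\<not> light N y3" "y3 \<noteq> y" "C' \<subseteq> V - {y1, y, x}" "y3 \<in> C'" "2 \<le> pot c N C'"
            using zy z1 x(1) by auto
          moreover from this have "y3 = v" using y by auto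
          ultimately show ?thesis using that[of C'] by auto
        qed
        define U where "U = C \<union> C'"
        have U: "U \<subseteq> V" "x \<notin> U" "y \<notin> U" "y1 \<notin> U" "v \<in> U" "y2 \<in> U" using C C' by (auto simp: U_def)
        have "2 \<le> pot c N U" using pot_union_ge[OF sp, of C C'] C C' Diff_subset unfolding U_def
          by (smt (verit) subset_trans)
        moreover have "pot c N U - 1 \<le> pot c N (insert x U)"
          by (rule pot_add1[of _ _ v]) (use U y xV in auto)
        moreover have "pot c N (insert x U) - 1 \<le> pot c N (insert y (insert x U))"
          by (rule pot_add1[of _ _ x]) (use U y xV xy in auto)
        moreover have "pot c N (insert y (insert x U)) + 2*c - 1 \<le> pot c N (insert y1 (insert y (insert x U)))"
          by (rule pot_add2[of _ _ y y2]) (use U y y2 xV xy yy1 in auto)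
        moreover have "pot c N (insert y1 (insert y (insert x U))) \<le> 2" by (rule sparseD[OF sp]) (use U xV in auto)
        ultimately show ?thesis using c3 by linarith
      qed
    qed
  qed
qed

section \<open>Deleting two adjacent vertices\<close>

lemma light_two:
  assumes "light N x" "a \<in> N x" "b \<in> N x" "a \<noteq> b" shows "N x = {a, b}"
proof -
  have "{a, b} = N x" by (rule card_seteq) (use assms in \<open>auto simp: light_def\<close>)
  then show ?thesis by simp
qed

lemma bad_not_sparse_loss:
  assumes "sparse c V N" "bad S A" "\<And>u. u \<in> A \<Longrightarrow> loss S N u = 0" shows False
  using bad_loss_pos[OF assms(1,2)] assms(3) by simp

text \<open>The counterpart of \<open>L1_side\<close> for two adjacent light vertices
  \<open>x\<close>, \<open>y\<close> with a heavy vertex \<open>v\<close> at the far side of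
  \<open>x\<close>: the deletion can fail only because of what lies behind \<open>y\<close>, where
  the path must continue with a light vertex.\<close>

lemma pair_side:
  assumes sp: "sparse c V N" and ns: "\<not> sparse c (V - {x, y}) (del {x, y} N)"
    and lx: "light N x" and ly: "light N y" and Nx: "N x = {y, v}" and hv: "\<not> light N v"
  obtains y1 y2 where "light N y1" "N y = {x, y1}" "y1 \<noteq> x" "N y1 = {y, y2}" "y2 \<noteq> y" "y2 \<noteq> x"
    "(\<not> light N y2 \<and> (\<exists>C. C \<subseteq> V - {x, y, y1} \<and> y2 \<in> C \<and> 4 - c \<le> pot c N C)) \<or>
     (c = 3 \<and> light N y2 \<and> (\<exists>y3. N y2 = {y1, y3} \<and> \<not> light N y3 \<and> y3 \<noteq> y1 \<and>
        (\<exists>C. C \<subseteq> V - {x, y, y1, y2} \<and> y3 \<in> C \<and> 2 \<le> pot c N C)))"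
proof -
  have xV: "x \<in> V" "y \<in> V" "v \<in> V" using Nx inV by blast+
  have vy: "v \<noteq> y" using hv ly by auto
  have vx: "v \<noteq> x" "x \<noteq> y" using Nx irr[of x] by auto
  have xNy: "x \<in> N y" using Nx sym by auto
  obtain A where A: "bad {x, y} A" using ns by (rule not_sparse_bad)
  have AV: "A \<subseteq> V - {x, y}" using badD(1)[OF A] .
  have Nxu: "u \<in> N x \<Longrightarrow> u \<in> A \<Longrightarrow> u = v" for u using Nx AV by auto
  consider "N y = {x}" | y1 where "y1 \<noteq> x" "N y = {x, y1}" using light_cases[OF ly xNy] by metis
  then show ?thesis
  proof cases
    case 1
    have "loss {x, y} N u = 0" if "u \<in> A" for u
    proof (cases "u = v")
      case True
      then show ?thesis using two_heavy_nbrs_loss[of v "{x,y}" x] hv that AV sym[of y v] 1 vx by auto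
    next
      case False
      then have "x \<notin> N u" "y \<notin> N u" using sym[of x u] sym[of y u] Nxu that 1 AV by auto
      then show ?thesis using loss_0[of u "{x,y}"] that AV by auto
    qed
    then show ?thesis using bad_not_sparse_loss[OF sp A] by blast
  next
    case (2 y1)
    have y1y: "y1 \<noteq> y" using 2 irr[of y] by auto
    have yNy1: "y \<in> N y1" using 2 sym by auto
    show ?thesis
    proof (cases "light N y1")
      case False
      show ?thesis
      proof (cases "y1 = v")
        case nv: False
        have "loss {x, y} N u = 0" if "u \<in> A" for u
        proof -
          have u: "u \<noteq> x" "u \<noteq> y" using that AV by auto
          consider "u = v" | "u = y1" | "u \<noteq> v" "u \<noteq> y1" by blast
          then show ?thesis
          proof cases
            case 1
            then show ?thesis using two_heavy_nbrs_loss[of v "{x,y}" x] hv u sym[of y v] 2 nv vx by auto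
          next
            case c2: 2
            then show ?thesis using two_heavy_nbrs_loss[of y1 "{x,y}" y] False u sym[of x y1] Nx nv y1y by auto
          next
            case 3
            then have "x \<notin> N u" "y \<notin> N u" using sym[of x u] sym[of y u] u Nx 2 by auto
            then show ?thesis using loss_0[of u "{x,y}"] u by auto
          qed
        qed
        then show ?thesis using bad_not_sparse_loss[OF sp A] by blast
      next
        \<comment> \<open>Here \<open>x\<close>, \<open>y\<close>, \<open>v\<close> form a triangle.
          \<open>v\<close> loses two neighbours and so at most one half-edge; adding
          \<open>x\<close> and \<open>y\<close> to the bad set gives 3 - c - 1 + (2c - 1) = c + 1,
          which exceeds 2.\<close>
        case True
        have L0: "loss {x, y} N u = 0" if "u \<in> A" "u \<noteq> v" for u
        proof -
          have "x \<notin> N u" "y \<notin> N u" using sym[of x u] sym[of y u] Nx 2 that AV True by auto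
          then show ?thesis using loss_0[of u "{x,y}"] that AV by auto
        qed
        have vA: "v \<in> A" using bad_not_sparse_loss[OF sp A] L0 by blast
        have "loss {x, y} N v \<le> max 0 (int (card (N v \<inter> {x,y})) - 1)" 
          by (rule loss_heavy_le) (use hv vx vy in auto)
        also have "card (N v \<inter> {x,y}) \<le> card {x,y}" by (rule card_mono) auto
        then have "max 0 (int (card (N v \<inter> {x,y})) - 1) \<le> 1" using vx by simp
        finally have lv: "loss {x, y} N v \<le> 1" .
        have "(\<Sum>u\<in>A. loss {x,y} N u) = (\<Sum>u\<in>A \<inter> {v}. loss {x,y} N u)"
          by (rule loss_sum_restrict) (use L0 finV[of A] AV in auto)
        also have "\<dots> \<le> 1" using vA lv by simp
        finally have "c * (\<Sum>u\<in>A. loss {x,y} N u) \<le> c" using c23 by auto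
        then have "3 - c \<le> pot c N A" using badD(2)[OF A] by linarith
        moreover have "pot c N A - 1 \<le> pot c N (insert x A)"
          by (rule pot_add1[of _ _ v]) (use AV xV vA Nx in auto)
        moreover have "pot c N (insert x A) + 2*c - 1 \<le> pot c N (insert y (insert x A))"
          by (rule pot_add2[of _ _ x v]) (use AV xV vA 2 True vx in auto)
        moreover have "pot c N (insert y (insert x A)) \<le> 2" by (rule sparseD[OF sp]) (use AV xV in auto)
        ultimately show ?thesis using c23 by linarith
      qed
    next
      case l1: True
      have y1v: "y1 \<noteq> v" using l1 hv by auto
      have L0: "loss {x, y} N u = 0" if "u \<in> A" "u \<noteq> y1" for u
      proof (cases "u = v")
        case True
        then show ?thesis using two_heavy_nbrs_loss[of v "{x,y}" x] hv that AV sym[of y v] 2 y1v vx by auto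
      next
        case False
        then have "x \<notin> N u" "y \<notin> N u" using sym[of x u] sym[of y u] Nx 2 that AV by auto
        then show ?thesis using loss_0[of u "{x,y}"] that AV by auto
      qed
      have y1A: "y1 \<in> A" using bad_not_sparse_loss[OF sp A] L0 by blast
      have "N y1 - {x,y} \<noteq> {}" using badD(4)[OF A y1A] .
      then obtain y2 where y2: "y2 \<noteq> y" "N y1 = {y, y2}" using light_cases[OF l1 yNy1] by auto
      have y2x: "y2 \<noteq> x" using sym[of x y1] Nx y2 y1v y1y by auto
      have e: "V - {x,y} - {y1} = V - {x,y,y1}" "V - {x,y} - {y1,y2} = V - {x,y,y1,y2}" by auto
      show ?thesis
        by (rule that[OF l1 2(2,1) y2(2,1) y2x])
          (use peel[OF sp A y2(2) _ _ _ L0] y2 y2x 2(1) y1y in \<open>auto simp: e\<close>)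
    qed
  qed
qed

text \<open>If a light path starts next to a heavy vertex, its first two or its last two vertices
  can be deleted: failure at both ends gives two dense sets whose union with the path has potential
  at least 3.\<close>

lemma adjacent_pair:
  assumes sp: "sparse c V N" and lx: "light N x" and ly: "light N y" and xy: "y \<in> N x"
  obtains s t where "s \<in> V" "t \<in> V" "s \<noteq> t" "card (N s - {t}) \<le> 1" "card (N t - {s}) \<le> 2"
    "sparse c (V - {s, t}) (del {s, t} N)"
proof -
  note concl = that
  have fin1: "thesis" if "light N a" "light N b" "b \<in> N a" "sparse c (V - {a, b}) (del {a, b} N)" for a b
  proof -
    have "a \<in> N b" using that sym by auto
    then have "card (N a - {b}) \<le> 1" "card (N b - {a}) \<le> 1" using that by (simp_all add: light_def)
    then show ?thesis using that concl[of a b] inV irr by (metis le_trans one_le_numeral)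
  qed
  show ?thesis
  proof (cases "\<exists>x y v. light N x \<and> light N y \<and> y \<in> N x \<and> v \<in> N x \<and> \<not> light N v")
    case True
    then obtain x y v where h: "light N x" "light N y" "y \<in> N x" "v \<in> N x" "\<not> light N v" by blast
    have "y \<noteq> v" using h by auto
    then have Nx: "N x = {y, v}" using light_two[OF h(1,3,4)] by auto
    have xV: "x \<in> V" "y \<in> V" "v \<in> V" using Nx inV by blast+
    have xy: "x \<noteq> y" using h irr by auto
    show ?thesis
    proof (cases "sparse c (V - {x, y}) (del {x, y} N)")
      case True
      then show ?thesis using fin1 h by blast
    next
      case ns: False
      obtain y1 y2 where y: "light N y1" "N y = {x, y1}" "y1 \<noteq> x" "N y1 = {y, y2}" "y2 \<noteq> y" "y2 \<noteq> x" and
        o: "(\<not> light N y2 \<and> (\<exists>C. C \<subseteq> V - {x, y, y1} \<and> y2 \<in> C \<and> 4 - c \<le> pot c N C)) \<or>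
     (c = 3 \<and> light N y2 \<and> (\<exists>y3. N y2 = {y1, y3} \<and> \<not> light N y3 \<and> y3 \<noteq> y1 \<and>
        (\<exists>C. C \<subseteq> V - {x, y, y1, y2} \<and> y3 \<in> C \<and> 2 \<le> pot c N C)))"
        by (rule pair_side[OF sp ns h(1,2) Nx h(5)])
      have yV: "y1 \<in> V" "y2 \<in> V" using y inV by blast+
      have y1y: "y1 \<noteq> y" using y irr by auto
      from o show ?thesis
      proof
        assume o1: "\<not> light N y2 \<and> (\<exists>C. C \<subseteq> V - {x, y, y1} \<and> y2 \<in> C \<and> 4 - c \<le> pot c N C)"
        then obtain C where C: "C \<subseteq> V - {x, y, y1}" "y2 \<in> C" "4 - c \<le> pot c N C" by blast
        show ?thesis
        proof (cases "sparse c (V - {y1, y}) (del {y1, y} N)")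
          case True
          then show ?thesis using fin1[of y1 y] y h by auto
        next
          case ns2: False
          obtain C' where C': "C' \<subseteq> V - {x, y, y1}" "v \<in> C'" "4 - c \<le> pot c N C'"
          proof -
            from pair_side[OF sp ns2 y(1) h(2) y(4)] o1 obtain z1 z2 where
              z: "N y = {y1, z1}" "z1 \<noteq> y1" "N z1 = {y, z2}" "z2 \<noteq> y" and
              o2: "(\<not> light N z2 \<and> (\<exists>C. C \<subseteq> V - {y1, y, z1} \<and> z2 \<in> C \<and> 4 - c \<le> pot c N C)) \<or>
     (c = 3 \<and> light N z2 \<and> (\<exists>y3. N z2 = {z1, y3} \<and> \<not> light N y3 \<and> y3 \<noteq> z1 \<and>
        (\<exists>C. C \<subseteq> V - {y1, y, z1, z2} \<and> y3 \<in> C \<and> 2 \<le> pot c N C)))" by metis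
            have z1: "z1 = x" using z y by auto
            have z2: "z2 = v" using z Nx z1 by auto
            have "\<exists>C. C \<subseteq> V - {y1, y, x} \<and> v \<in> C \<and> 4 - c \<le> pot c N C" using o2 h z1 z2 by auto
            then show ?thesis using that by (metis insert_commute)
          qed
          define U where "U = C \<union> C'"
          have U: "U \<subseteq> V" "x \<notin> U" "y \<notin> U" "y1 \<notin> U" "v \<in> U" "y2 \<in> U" using C C' by (auto simp: U_def)
          have "6 - 2*c \<le> pot c N U" using pot_union_ge[OF sp, of C C'] C C' Diff_subset unfolding U_def
            by (smt (verit) subset_trans)
          moreover have "pot c N U - 1 \<le> pot c N (insert x U)"
            by (rule pot_add1[of _ _ v]) (use U Nx xV in auto)
          moreover have "pot c N (insert x U) - 1 \<le> pot c N (insert y (insert x U))"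
            by (rule pot_add1[of _ _ x]) (use U y xV xy in auto)
          moreover have "pot c N (insert y (insert x U)) + 2*c - 1 \<le> pot c N (insert y1 (insert y (insert x U)))"
            by (rule pot_add2[of _ _ y y2]) (use U y xV yV xy y1y in auto)
          moreover have "pot c N (insert y1 (insert y (insert x U))) \<le> 2" by (rule sparseD[OF sp]) (use U xV yV in auto)
          ultimately show ?thesis by linarith
        qed
      next
        assume o1: "c = 3 \<and> light N y2 \<and> (\<exists>y3. N y2 = {y1, y3} \<and> \<not> light N y3 \<and> y3 \<noteq> y1 \<and>
          (\<exists>C. C \<subseteq> V - {x, y, y1, y2} \<and> y3 \<in> C \<and> 2 \<le> pot c N C))"
        then obtain y3 C where y3: "N y2 = {y1, y3}" "\<not> light N y3" "y3 \<noteq> y1" and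
          C: "C \<subseteq> V - {x, y, y1, y2}" "y3 \<in> C" "2 \<le> pot c N C" by blast
        have c3: "c = 3" and l2: "light N y2" using o1 by auto
        have y21: "y2 \<noteq> y1" using y irr by auto
        show ?thesis
        proof (cases "sparse c (V - {y2, y1}) (del {y2, y1} N)")
          case True
          then show ?thesis using fin1[of y2 y1] y y3 l2 by auto
        next
          case ns2: False
          obtain C' where C': "C' \<subseteq> V - {x, y, y1, y2}" "v \<in> C'" "2 \<le> pot c N C'"
          proof -
            from pair_side[OF sp ns2 l2 y(1) y3(1,2)] obtain z1 z2 where
              z: "N y1 = {y2, z1}" "z1 \<noteq> y2" "N z1 = {y1, z2}" "z2 \<noteq> y1" and
              o2: "(\<not> light N z2 \<and> (\<exists>C. C \<subseteq> V - {y2, y1, z1} \<and> z2 \<in> C \<and> 4 - c \<le> pot c N C)) \<or>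
     (c = 3 \<and> light N z2 \<and> (\<exists>y3. N z2 = {z1, y3} \<and> \<not> light N y3 \<and> y3 \<noteq> z1 \<and>
        (\<exists>C. C \<subseteq> V - {y2, y1, z1, z2} \<and> y3 \<in> C \<and> 2 \<le> pot c N C)))" by metis
            have z1: "z1 = y" using z y by auto
            have z2: "z2 = x" using z y z1 by auto
            from o2 obtain u C' where u: "N x = {y, u}" "u \<noteq> y" "C' \<subseteq> V - {y2, y1, y, x}" "u \<in> C'" "2 \<le> pot c N C'"
              using h z1 z2 by auto
            have "u = v" using u Nx by auto
            then show ?thesis using that[of C'] u by auto
          qed
          define U where "U = C \<union> C'"
          have U: "U \<subseteq> V" "x \<notin> U" "y \<notin> U" "y1 \<notin> U" "y2 \<notin> U" "v \<in> U" "y3 \<in> U" using C C' by (auto simp: U_def)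
          have "2 \<le> pot c N U" using pot_union_ge[OF sp, of C C'] C C' Diff_subset unfolding U_def
            by (smt (verit) subset_trans)
          moreover have "pot c N U - 1 \<le> pot c N (insert x U)"
            by (rule pot_add1[of _ _ v]) (use U Nx xV in auto)
          moreover have "pot c N (insert x U) - 1 \<le> pot c N (insert y (insert x U))"
            by (rule pot_add1[of _ _ x]) (use U y xV xy in auto)
          moreover have "pot c N (insert y (insert x U)) - 1 \<le> pot c N (insert y1 (insert y (insert x U)))"
            by (rule pot_add1[of _ _ y]) (use U y xV yV xy y1y in auto)
          moreover have "pot c N (insert y1 (insert y (insert x U))) + 2*c - 1 \<le> pot c N (insert y2 (insert y1 (insert y (insert x U))))"
            by (rule pot_add2[of _ _ y1 y3]) (use U y y3 xV yV xy y1y y21 in auto)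
          moreover have "pot c N (insert y2 (insert y1 (insert y (insert x U)))) \<le> 2" by (rule sparseD[OF sp]) (use U xV yV in auto)
          ultimately show ?thesis using c3 by linarith
        qed
      qed
    qed
  next
    case n: False
    \<comment> \<open>Now a light vertex with a light neighbour has no heavy neighbour, so
      \<open>W\<close> is a union of components. A minimal bad set avoids what is left of them, and
      outside them nothing is lost.\<close>
    define W where "W = {x\<in>V. light N x \<and> (\<exists>y\<in>N x. light N y)}"
    have cl: "N w \<subseteq> W" if "w \<in> W" for w
    proof
      fix u assume u: "u \<in> N w"
      have "light N u" using n that u unfolding W_def by blast
      moreover have "w \<in> N u" "u \<in> V" using u sym inV by blast+
      ultimately show "u \<in> W" using that by (auto simp: W_def)
    qed
    have xW: "x \<in> W" "y \<in> W" using lx ly xy inV sym[of y x] by (auto simp: W_def)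
    have "sparse c (V - {x, y}) (del {x, y} N)"
    proof (rule ccontr)
      assume "\<not> ?thesis"
      then obtain A where A: "bad {x, y} A" by (rule not_sparse_bad)
      have AW: "A \<inter> (W - {x,y}) = {}"
      proof (rule badD(7)[OF A])
        show "W - {x,y} \<subseteq> V - {x,y}" by (auto simp: W_def)
      next
        fix w assume w: "w \<in> W - {x,y}"
        have "card (N w - {x,y}) \<le> card (N w)" by (rule card_mono) auto
        then show "card (N w - {x, y}) \<le> 2" using w by (auto simp: W_def light_def)
        show "N w - {x, y} \<subseteq> W - {x, y}" using cl w by auto
      qed
      have "loss {x, y} N u = 0" if "u \<in> A" for u
      proof (rule loss_0)
        show us: "u \<notin> {x, y}" using that badD(1)[OF A] by auto
        then have uW: "u \<notin> W" using AW that by auto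
        show "N u \<inter> {x, y} = {}" using cl[OF xW(1)] cl[OF xW(2)] uW sym[of x u] sym[of y u] by auto
      qed
      then show False using bad_not_sparse_loss[OF sp A] by blast
    qed
    then show ?thesis using fin1 lx ly xy by blast
  qed
qed

text \<open>Only light neighbours of \<open>v\<close> other than \<open>x\<close> lose anything, and
  each loses at most one half-edge. If the bad set contains one of them, it is removed and a dense
  set \<open>C\<close> of potential at least 4 - c remains. If it contains both, putting
  \<open>v\<close> back yields 3 - 2c + 4c - (2c + 1) = 2.\<close>

lemma bad_star:
  assumes sp: "sparse c V N" and v: "card (N v) = 3" and x: "x \<in> N v" "light N x"
    and nl: "\<And>a b. light N a \<Longrightarrow> light N b \<Longrightarrow> b \<notin> N a"
    and ns: "\<not> sparse c (V - {x, v}) (del {x, v} N)"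
  shows "(\<exists>x' y C. x' \<in> N v \<and> x' \<noteq> x \<and> light N x' \<and> N x' = {v, y} \<and> y \<noteq> v \<and> C \<subseteq> V - {v} \<and>
       C \<inter> {u\<in>N v. light N u} = {} \<and> y \<in> C \<and> 4 - c \<le> pot c N C) \<or>
     (\<forall>u\<in>N v. light N u) \<and> (\<exists>Z\<subseteq>V. v \<in> Z \<and> N v - {x} \<subseteq> Z \<and> x \<notin> Z \<and> 2 \<le> pot c N Z)"
proof -
  have hv: "\<not> light N v" using v by (simp add: light_def)
  have vx: "v \<noteq> x" using hv x by auto
  have xV: "x \<in> V" "v \<in> V" using x inV by blast+
  have vNx: "v \<in> N x" using x sym by auto
  obtain A where A: "bad {x, v} A" using ns by (rule not_sparse_bad)
  have AV: "A \<subseteq> V - {x, v}" "A \<subseteq> V" using badD(1)[OF A] by auto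
  have fA: "finite A" using AV finV by blast
  \<comment> \<open>A heavy \<open>g\<close> could lose a half-edge only if adjacent to both
    \<open>x\<close> and \<open>v\<close>. With \<open>j\<close> >= 1 neighbours of \<open>v\<close>
    in \<open>A\<close>, adding \<open>v\<close> and \<open>x\<close> to \<open>A\<close> then gives
    at least 3 - cj + 2cj - (2c + 1) + (2c - 1) = 1 + cj, which exceeds 2.\<close>
  have nog: "loss {x, v} N g = 0" if g: "g \<in> A" "\<not> light N g" for g
  proof (rule ccontr)
    assume l: "loss {x, v} N g \<noteq> 0"
    have gS: "g \<noteq> x" "g \<noteq> v" using g AV by auto
    have "\<not> N g \<inter> {x,v} \<subseteq> {x}" "\<not> N g \<inter> {x,v} \<subseteq> {v}" 
      using two_heavy_nbrs_loss[of g "{x,v}" x] two_heavy_nbrs_loss[of g "{x,v}" v] l g gS by auto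
    then have gx: "x \<in> N g" "v \<in> N g" by auto
    then have gN: "g \<in> N x" "g \<in> N v" using sym by auto
    have Nx: "N x = {v, g}" using light_two[OF x(2) vNx gN(1)] gS by auto
    define J where "J = N v \<inter> A"
    have gJ: "g \<in> J" using gN g by (simp add: J_def)
    have out: "loss {x, v} N u = 0" if "u \<in> A" "u \<notin> J" for u
    proof (rule loss_0)
      show "N u \<inter> {x, v} = {}" using that Nx sym[of x u] sym[of v u] gJ AV by (auto simp: J_def)
      show "u \<notin> {x, v}" using that AV by auto
    qed
    have one: "loss {x, v} N u \<le> 1" if "u \<in> J" for u
    proof (cases "light N u")
      case True
      have u: "u \<notin> {x, v}" using that AV by (auto simp: J_def)
      have "x \<notin> N u" using nl[OF True x(2)] .
      then have "card (N u \<inter> {x,v}) \<le> card {v}" by (intro card_mono) auto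
      then show ?thesis using loss_le[OF u] by simp
    next
      case False
      have u: "u \<notin> {x, v}" using that AV by (auto simp: J_def)
      have "card (N u \<inter> {x,v}) \<le> card {x,v}" by (intro card_mono) auto
      then show ?thesis using loss_heavy_le[OF u False] vx by simp
    qed
    have "(\<Sum>u\<in>A. loss {x,v} N u) = (\<Sum>u\<in>A \<inter> J. loss {x,v} N u)" by (rule loss_sum_restrict[OF fA out])
    also have "A \<inter> J = J" by (auto simp: J_def)
    also have "(\<Sum>u\<in>J. loss {x,v} N u) \<le> (\<Sum>u\<in>J. 1)" by (rule sum_mono) (rule one)
    finally have "c * (\<Sum>u\<in>A. loss {x,v} N u) \<le> c * int (card J)" using c23 by auto
    then have "3 \<le> pot c N A + c * int (card J)" using badD(2)[OF A] by linarith
    moreover have "pot c N A + 2*c*int (card J) - (2*c+1) \<le> pot c N (insert v A)"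
      by (rule pot_addn) (use AV xV in \<open>auto simp: J_def\<close>)
    moreover have "pot c N (insert v A) + 2*c - 1 \<le> pot c N (insert x (insert v A))"
      by (rule pot_add2[of _ _ v g]) (use AV xV Nx g gS vx in auto)
    moreover have "pot c N (insert x (insert v A)) \<le> 2" by (rule sparseD[OF sp]) (use AV xV in auto)
    moreover have "c \<le> c * int (card J)"
    proof -
      have "finite J" "J \<noteq> {}" using gJ fA by (auto simp: J_def)
      then have "1 \<le> card J" by (simp add: Suc_leI card_gt_0_iff)
      then show ?thesis using c23 by auto
    qed
    moreover have "2*c*int (card J) = c * int (card J) + c * int (card J)" by simp
    ultimately show False using c23 by linarith
  qed
  define J where "J = {u \<in> N v. light N u} \<inter> A"
  have JA: "J \<subseteq> A" "J \<subseteq> N v - {x}" "finite J" using AV fA by (auto simp: J_def)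
  have out: "loss {x, v} N u = 0" if "u \<in> A" "u \<notin> J" for u
  proof (cases "light N u")
    case True
    then have "x \<notin> N u" "v \<notin> N u" using nl[OF True x(2)] that sym[of v u] by (auto simp: J_def)
    then show ?thesis using loss_0[of u "{x,v}"] that AV by auto
  qed (use nog that in auto)
  have one: "loss {x, v} N u \<le> 1" if "u \<in> J" for u
  proof -
    have u: "u \<notin> {x, v}" "light N u" using that AV by (auto simp: J_def)
    have "x \<notin> N u" using nl[OF u(2) x(2)] .
    then have "card (N u \<inter> {x,v}) \<le> card {v}" by (intro card_mono) auto
    then show ?thesis using loss_le[OF u(1)] by simp
  qed
  have "(\<Sum>u\<in>A. loss {x,v} N u) = (\<Sum>u\<in>A \<inter> J. loss {x,v} N u)" by (rule loss_sum_restrict[OF fA out])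
  also have "A \<inter> J = J" using JA by auto
  also have "(\<Sum>u\<in>J. loss {x,v} N u) \<le> (\<Sum>u\<in>J. 1)" by (rule sum_mono) (rule one)
  finally have sl: "(\<Sum>u\<in>A. loss {x,v} N u) \<le> int (card J)" by simp
  then have "c * (\<Sum>u\<in>A. loss {x,v} N u) \<le> c * int (card J)" using c23 by auto
  then have pA: "3 \<le> pot c N A + c * int (card J)" using badD(2)[OF A] by linarith
  have "card (N v - {x}) = 2" using v x by simp
  moreover have "card J \<le> card (N v - {x})" by (rule card_mono) (use JA in auto)
  moreover have "0 < card J" using sl bad_loss_pos[OF sp A] by linarith
  ultimately consider "card J = 1" | "card J = 2" by linarith
  then show ?thesis
  proof cases
    case 1
    then obtain x' where J: "J = {x'}" by (auto simp: card_1_singleton_iff)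
    have x': "x' \<in> N v" "light N x'" "x' \<in> A" "x' \<noteq> x" using J JA by (auto simp: J_def)
    have vN: "v \<in> N x'" using x' sym by auto
    have "N x' - {x, v} \<noteq> {}" using badD(4)[OF A x'(3)] .
    then obtain y where y: "y \<noteq> v" "N x' = {v, y}" using light_cases[OF x'(2) vN] by auto
    have yx: "y \<noteq> x" using nl[OF x'(2) x(2)] y by auto
    have "card (N x' - {x,v}) \<le> card (N x')" by (rule card_mono) auto
    then have "N x' - {x,v} \<subseteq> A" using badD(3)[OF A x'(3)] x'(2) by (simp add: light_def)
    then have yA: "y \<in> A" using y yx by auto
    have yx': "y \<noteq> x'" using y irr by auto
    have "N x' \<inter> A = {y}" using y yA AV by auto
    then have "4 - c \<le> pot c N (A - {x'})"
      using pot_remove[OF AV(2) x'(3)] pA 1 y by (simp add: defect_def)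
    moreover have "(A - {x'}) \<inter> {u\<in>N v. light N u} = {}" using J by (auto simp: J_def)
    moreover have "A - {x'} \<subseteq> V - {v}" "y \<in> A - {x'}" using AV yA yx' by auto
    ultimately show ?thesis using x'(1,2,4) y by (intro disjI1 exI[of _ x'] exI[of _ y] exI[of _ "A - {x'}"] conjI)
  next
    case 2
    then have J: "J = N v - {x}" using JA \<open>card (N v - {x}) = 2\<close> by (metis card_subset_eq finN finite_Diff)
    have "\<forall>u\<in>N v. light N u" using J x(2) by (auto simp: J_def)
    moreover have "2 \<le> pot c N (insert v A)"
    proof -
      have "pot c N A + 2*c*int (card J) - (2*c+1) \<le> pot c N (insert v A)"
        by (rule pot_addn) (use AV xV JA in auto)
      then show ?thesis using 2 pA by simp
    qed
    moreover have "N v - {x} \<subseteq> insert v A" "x \<notin> insert v A" "insert v A \<subseteq> V" using J JA AV vx xV by auto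
    ultimately show ?thesis by blast
  qed
qed

text \<open>\<open>Y a\<close> and \<open>Z a\<close> are the two obstructions of \<open>bad_star\<close>. Two different vertices satisfying \<open>Y\<close>, two satisfying \<open>Z\<close>, or one satisfying both
  give a set of potential at least 3, so that not all light neighbours of \<open>v\<close> can be obstructed.\<close>

lemma star_pair:
  assumes sp: "sparse c V N" and v: "card (N v) = 3" and x: "x \<in> N v" "light N x"
    and nl: "\<And>a b. light N a \<Longrightarrow> light N b \<Longrightarrow> b \<notin> N a"
  shows "\<exists>x. x \<in> N v \<and> light N x \<and> sparse c (V - {x, v}) (del {x, v} N)"
proof (rule ccontr)
  assume concl: "\<not> ?thesis"
  then have ns: "\<not> sparse c (V - {x, v}) (del {x, v} N)" if "x \<in> N v" "light N x" for x using that concl by blast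
  define L where "L = {u\<in>N v. light N u}"
  define Y where "Y = (\<lambda>a. a \<in> L \<and> (\<exists>y C. N a = {v, y} \<and> y \<noteq> v \<and> C \<subseteq> V - {v} \<and> C \<inter> L = {} \<and> y \<in> C \<and> 4 - c \<le> pot c N C))"
  define Z where "Z = (\<lambda>a. L = N v \<and> (\<exists>Z\<subseteq>V. v \<in> Z \<and> N v - {a} \<subseteq> Z \<and> a \<notin> Z \<and> 2 \<le> pot c N Z))"
  have vV: "v \<in> V" "N v \<subseteq> V" using x inV by blast+
  have LV: "L \<subseteq> V" "v \<notin> L" using vV irr by (auto simp: L_def)
  have alt: "(\<exists>b. Y b \<and> b \<noteq> a) \<or> Z a" if "a \<in> L" for a
  proof -
    have a: "a \<in> N v" "light N a" using that by (auto simp: L_def)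
    have "(\<forall>u\<in>N v. light N u) \<Longrightarrow> L = N v" by (auto simp: L_def)
    then show ?thesis using bad_star[OF sp v a nl ns[OF a]] unfolding Y_def Z_def L_def[symmetric]
      by (smt (verit) L_def mem_Collect_eq)
  qed
  have YY: "a = b" if Ya: "Y a" and Yb: "Y b" for a b
  proof (rule ccontr)
    assume ab: "a \<noteq> b"
    obtain y C where C: "a \<in> L" "N a = {v, y}" "y \<noteq> v" "C \<subseteq> V - {v}" "C \<inter> L = {}" "y \<in> C" "4 - c \<le> pot c N C"
      using Ya unfolding Y_def by blast
    obtain y' C' where C': "b \<in> L" "N b = {v, y'}" "y' \<noteq> v" "C' \<subseteq> V - {v}" "C' \<inter> L = {}" "y' \<in> C'" "4 - c \<le> pot c N C'"
      using Yb unfolding Y_def by blast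
    define U where "U = C \<union> C'"
    have U: "U \<subseteq> V" "a \<notin> U" "b \<notin> U" "v \<notin> U" "y \<in> U" "y' \<in> U" using C C' by (auto simp: U_def)
    have aV: "a \<in> V" "b \<in> V" "a \<noteq> v" "b \<noteq> v" using C C' LV by auto
    have "6 - 2*c \<le> pot c N U" using pot_union_ge[OF sp, of C C'] C C' Diff_subset unfolding U_def
      by (smt (verit) subset_trans)
    moreover have "pot c N U - 1 \<le> pot c N (insert a U)"
      by (rule pot_add1[of _ _ y]) (use U C aV in auto)
    moreover have "pot c N (insert a U) - 1 \<le> pot c N (insert b (insert a U))"
      by (rule pot_add1[of _ _ y']) (use U C' aV ab in auto)
    moreover have "pot c N (insert b (insert a U)) + 2*c - 1 \<le> pot c N (insert v (insert b (insert a U)))"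
      by (rule pot_add2[of _ _ a b]) (use U C C' aV ab vV in \<open>auto simp: L_def\<close>)
    moreover have "pot c N (insert v (insert b (insert a U))) \<le> 2" by (rule sparseD[OF sp]) (use U aV vV in auto)
    ultimately show False by linarith
  qed
  have ZZ: "a = b" if Za: "Z a" and Zb: "Z b" and abN: "a \<in> N v" "b \<in> N v" for a b
  proof (rule ccontr)
    assume ab: "a \<noteq> b"
    obtain Z1 where Z1: "Z1 \<subseteq> V" "v \<in> Z1" "a \<notin> Z1" "2 \<le> pot c N Z1" using Za unfolding Z_def by blast
    obtain Z2 where Z2: "Z2 \<subseteq> V" "v \<in> Z2" "b \<notin> Z2" "2 \<le> pot c N Z2" using Zb unfolding Z_def by blast
    have u: "Z1 \<union> Z2 \<subseteq> V" using Z1 Z2 by auto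
    \<comment> \<open>The union has potential at most 2, so the intersection has at least 2. But
      \<open>v\<close> has at most one neighbour in it, and removing \<open>v\<close> would raise
      the potential to at least 3.\<close>
    have "2 \<le> pot c N (Z1 \<inter> Z2)" using pot_supermod[of Z1 Z2] sparseD[OF sp u] Z1 Z2 by linarith
    moreover have "card (N v \<inter> (Z1 \<inter> Z2)) \<le> card (N v - {a, b})" by (rule card_mono) (use Z1 Z2 in auto)
    moreover have "card (N v - {a,b}) = 1" using v abN ab by (simp add: card_Diff_subset)
    moreover have "pot c N (Z1 \<inter> Z2) = pot c N (Z1 \<inter> Z2 - {v}) + 2*c* int (card (N v \<inter> (Z1 \<inter> Z2))) + c * defect N v - (2*c+1)"
      by (rule pot_remove) (use Z1 Z2 in auto)
    moreover have "defect N v = 0" using v by (simp add: defect_def)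
    moreover have "pot c N (Z1 \<inter> Z2 - {v}) \<le> 2" by (rule sparseD[OF sp]) (use Z1 in auto)
    ultimately have "2*c+1 \<le> 2*c* int (card (N v \<inter> (Z1 \<inter> Z2)))" "card (N v \<inter> (Z1 \<inter> Z2)) \<le> 1" by simp_all
    moreover from this(2) have "card (N v \<inter> (Z1 \<inter> Z2)) = 0 \<or> card (N v \<inter> (Z1 \<inter> Z2)) = 1" by linarith
    ultimately show False using c23 by auto
  qed
  have YZ: False if Ya: "Y a" and Zb: "Z a" for a
  proof -
    obtain y C where C: "a \<in> L" "N a = {v, y}" "y \<noteq> v" "C \<subseteq> V - {v}" "C \<inter> L = {}" "y \<in> C" "4 - c \<le> pot c N C"
      using Ya unfolding Y_def by blast
    obtain Z1 where Z1: "Z1 \<subseteq> V" "v \<in> Z1" "a \<notin> Z1" "2 \<le> pot c N Z1" using Zb unfolding Z_def by blast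
    define U where "U = C \<union> Z1"
    have U: "U \<subseteq> V" "a \<notin> U" "v \<in> U" "y \<in> U" using C Z1 by (auto simp: U_def)
    have aV: "a \<in> V" using C LV by auto
    have "4 - c \<le> pot c N U" using pot_union_ge[OF sp, of C Z1] C Z1 Diff_subset unfolding U_def
      by (smt (verit) subset_trans)
    moreover have "pot c N U + 2*c - 1 \<le> pot c N (insert a U)"
      by (rule pot_add2[of _ _ v y]) (use U C aV in auto)
    moreover have "pot c N (insert a U) \<le> 2" by (rule sparseD[OF sp]) (use U aV in auto)
    ultimately show False using c23 by linarith
  qed
  have xL: "x \<in> L" using x by (simp add: L_def)
  show False
  \<comment> \<open>If \<open>Z\<close> holds nowhere, \<open>alt\<close> applied twice produces two
    different vertices with \<open>Y\<close>. Otherwise \<open>Z\<close> holds at a single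
    \<open>z\<close>; the other two neighbours both ask for a vertex with \<open>Y\<close> different
    from themselves, and by \<open>YY\<close> it is the same one, namely \<open>z\<close>.\<close>
  proof (cases "\<exists>z\<in>L. Z z")
    case False
    then show False using alt YY xL by (metis Y_def)
  next
    case True
    then obtain z where z: "z \<in> L" "Z z" by blast
    have L: "L = N v" using z by (simp add: Z_def)
    have "card (L - {z}) = 2" using L v z by simp
    then obtain a b where ab: "L - {z} = {a, b}" "a \<noteq> b" by (auto simp: card_2_iff)
    then have abL: "a \<in> L" "b \<in> L" "a \<noteq> z" "b \<noteq> z" by auto
    have "\<not> Z a" "\<not> Z b" using ZZ z abL L by blast+
    then obtain a' b' where "Y a'" "a' \<noteq> a" "Y b'" "b' \<noteq> b" using alt abL by blast
    moreover from this have "a' = b'" using YY by blast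
    moreover have "a' \<in> L" using \<open>Y a'\<close> by (simp add: Y_def)
    ultimately have "a' = z" using ab by auto
    then show False using YZ \<open>Y a'\<close> z by blast
  qed
qed

text \<open>Two nonadjacent vertices of degree at most 1 can be joined without raising the potential, see \<open>tidy_extension\<close>.\<close>

definition tidy :: bool where
  "tidy \<longleftrightarrow> (\<forall>x\<in>V. \<forall>y\<in>V. x \<noteq> y \<longrightarrow> card (N x) \<le> 1 \<longrightarrow> card (N y) \<le> 1 \<longrightarrow> y \<in> N x)"

text \<open>The degree bounds suit coloring \<open>t\<close> before \<open>s\<close>: either with
  three colors per list and none forbidden, or with four and one forbidden.\<close>

lemma remove_pair:
  assumes sp: "sparse c V N" and p1: "pot c N V \<le> 1" and td: "tidy" and V2: "2 \<le> card V"
  obtains s t where "s \<in> V" "t \<in> V" "s \<noteq> t" "card (N s - {t}) \<le> 1" "card (N t - {s}) \<le> 2"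
    "sparse c (V - {s, t}) (del {s, t} N)"
proof (cases "\<exists>a\<in>V. N a = {}")
  case True
  then obtain a where a: "a \<in> V" "N a = {}" by blast
  interpret D: nbr_graph "V - {a}" "del {a} N" c by (rule del_graph)
  have sa: "sparse c (V - {a}) (del {a} N)"
    by (rule no_loss_sparse[OF sp]) (use a sym[of a] in \<open>auto intro!: loss_0\<close>)
  have "V \<noteq> {a}" using V2 by auto
  then have ne: "V - {a} \<noteq> {}" using a by auto
  obtain x where x: "x \<in> V - {a}" "light (del {a} N) x" "sparse c (V - {a} - {x}) (del {x} (del {a} N))"
    using D.remove_light[OF sa ne] by metis
  have "card (N x - {a}) \<le> 2" using x by (simp add: light_def del_def)
  moreover have "V - {a} - {x} = V - {a, x}" "{a} \<union> {x} = {a, x}" by auto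
  ultimately show ?thesis using that[of a x] x a del_del[of "{x}" "{a}"] by auto
next
  case ni: False
  show ?thesis
  proof (cases "\<exists>x y. light N x \<and> light N y \<and> y \<in> N x")
    case True
    then show ?thesis using adjacent_pair[OF sp] that by metis
  next
    case False
    then have nl: "\<And>a b. light N a \<Longrightarrow> light N b \<Longrightarrow> b \<notin> N a" by blast
    \<comment> \<open>Otherwise double all charges and let each heavy vertex give 1 to every light
      neighbour. Heavy vertices keep at least 2, and a light vertex stays below 0 only if it is a
      leaf, with -1. As \<open>tidy\<close> leaves at most one leaf here and the potential is at
      most 1, there is a single heavy vertex; all its neighbours would be leaves.\<close>
    have "\<exists>v x. card (N v) = 3 \<and> x \<in> N v \<and> light N x"
    proof (rule ccontr)
      assume n: "\<not> ?thesis"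
      define H where "H = {v\<in>V. \<not> light N v}"
      define L where "L = {v\<in>V. light N v}"
      have f: "finite H" "finite L" using fin by (auto simp: H_def L_def)
      have HL: "V = H \<union> L" "H \<inter> L = {}" "H \<subseteq> V" "L \<subseteq> V" by (auto simp: H_def L_def)
      have cH: "2 \<le> 2 * charge v - int (card (N v \<inter> L))" if "v \<in> H" for v
      proof -
        have hv: "\<not> light N v" using that by (simp add: H_def)
        show ?thesis
        proof (cases "card (N v) = 3")
          case True
          then have "N v \<inter> L = {}" using n by (auto simp: L_def)
          then show ?thesis using charge_heavy[OF hv] True c23 by auto
        next
          case False
          then have d: "4 \<le> int (card (N v))" using hv by (simp add: light_def)
          have "card (N v \<inter> L) \<le> card (N v)" by (rule card_mono) auto
          then show ?thesis using charge_heavy[OF hv] d c23 by auto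
        qed
      qed
      have cL: "- (if card (N x) = 1 then 1 else 0::int) \<le> 2 * charge x + int (card (N x \<inter> H))" if "x \<in> L" for x
      proof -
        have lx: "light N x" "x \<in> V" using that by (auto simp: L_def)
        have "N x \<inter> H = N x" using nl[OF lx(1)] inV by (auto simp: H_def)
        moreover have "card (N x) \<noteq> 0" using ni lx by auto
        then have "card (N x) = 1 \<or> card (N x) = 2" using lx(1) unfolding light_def by linarith
        ultimately show ?thesis using charge_light[OF lx(1)] by auto
      qed
      define B where "B = {x\<in>L. card (N x) = 1}"
      have B1: "card B \<le> 1"
      proof (rule ccontr)
        assume "\<not> ?thesis"
        moreover have "finite B" using f by (simp add: B_def)
        ultimately obtain x y where xy: "x \<in> B" "y \<in> B" "x \<noteq> y"
          using card_le_Suc0_iff_eq[of B] by auto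
        then have "y \<in> N x" using td unfolding tidy_def by (simp add: B_def L_def)
        then show False using nl[of x y] xy by (simp add: B_def L_def)
      qed
      have "int (\<Sum>v\<in>H. card (N v \<inter> L)) = int (\<Sum>x\<in>L. card (N x \<inter> H))" using handshake[OF HL(3,4)] by simp
      moreover have "2 * pot c N V = (\<Sum>v\<in>H. 2 * charge v) + (\<Sum>v\<in>L. 2 * charge v)"
        unfolding pot_total using sum.union_disjoint[OF f HL(2), of charge] HL(1) by (simp add: sum_distrib_left)
      ultimately have "2 * pot c N V = (\<Sum>v\<in>H. 2 * charge v - int (card (N v \<inter> L))) + (\<Sum>x\<in>L. 2 * charge x + int (card (N x \<inter> H)))"
        by (simp add: sum.distrib sum_subtractf)
      moreover have "(\<Sum>v\<in>H. 2) \<le> (\<Sum>v\<in>H. 2 * charge v - int (card (N v \<inter> L)))" by (rule sum_mono) (rule cH)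
      moreover have "(\<Sum>x\<in>L. - (if card (N x) = 1 then 1 else 0::int)) \<le> (\<Sum>x\<in>L. 2 * charge x + int (card (N x \<inter> H)))"
        by (rule sum_mono) (rule cL)
      moreover have "(\<Sum>x\<in>L. - (if card (N x) = 1 then 1 else 0::int)) = - int (card B)"
        using f by (simp add: sum_negf sum.If_cases B_def Collect_conj_eq Int_commute)
      ultimately have "2 * int (card H) - int (card B) \<le> 2" using p1 by simp
      then have H1: "card H \<le> 1" using B1 by linarith
      have "V \<noteq> {}" using V2 by auto
      then obtain x where x: "x \<in> V" "light N x" using light_exists[OF sp] by blast
      then obtain v where v: "v \<in> N x" using ni by blast
      have hv: "\<not> light N v" using nl[OF x(2)] v by blast
      have vH: "v \<in> H" using hv v inV by (auto simp: H_def)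
      have Hv: "H = {v}" using H1 vH card_le_Suc0_iff_eq[OF f(1)] by auto
      have leaf: "u \<in> B" if "u \<in> N v" for u
      proof -
        have u: "u \<in> V" "u \<noteq> v" using that inV irr by blast+
        then have lu: "light N u" using Hv by (auto simp: H_def)
        have "v \<in> N u" using that sym by auto
        moreover have "N u \<subseteq> {v}"
        proof
          fix w assume w: "w \<in> N u"
          then have "w \<in> H" using nl[OF lu] inV by (auto simp: H_def)
          then show "w \<in> {v}" using Hv by simp
        qed
        ultimately have "N u = {v}" by auto
        then show ?thesis using lu u by (simp add: B_def L_def)
      qed
      have "card (N v) \<le> card B" by (rule card_mono) (use leaf f in \<open>auto simp: B_def\<close>)
      then show False using B1 heavy_ge3[OF hv] by linarith
    qed
    then obtain v x where v: "card (N v) = 3" "x \<in> N v" "light N x" by blast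
    obtain z where z: "z \<in> N v" "light N z" "sparse c (V - {z, v}) (del {z, v} N)"
      using star_pair[OF sp v nl] by metis
    have "v \<in> N z" using z sym by auto
    then have "card (N z - {v}) \<le> 1" using z by (simp add: light_def)
    moreover have "card (N v - {z}) \<le> 2" using v z by simp
    moreover have "z \<noteq> v" using z irr by auto
    ultimately show ?thesis using that[of z v] z inV by metis
  qed
qed

end

section \<open>Extending a coloring\<close>

text \<open>The quotient is the ceiling of \<open>card V\<close> over \<open>k\<close>. The count of
  full classes is guarded because on the empty set every color of the type has a class of the full
  size 0.\<close>

definition seq_eq :: "nat \<Rightarrow> 'a set \<Rightarrow> ('a \<Rightarrow> 'c) \<Rightarrow> bool" where
  "seq_eq k V f \<longleftrightarrow> (\<forall>c. card {v\<in>V. f v = c} \<le> (card V + k - 1) div k) \<and>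
     (V \<noteq> {} \<longrightarrow> card {c. card {v\<in>V. f v = c} = (card V + k - 1) div k} \<le> modstar (card V) k)"

definition colorable :: "nat \<Rightarrow> ('a \<Rightarrow> 'c set) \<Rightarrow> 'a set \<Rightarrow> ('a \<Rightarrow> 'a set) \<Rightarrow> bool" where
  "colorable k L V N \<longleftrightarrow> (\<exists>f. (\<forall>v\<in>V. f v \<in> L v) \<and> (\<forall>v\<in>V. \<forall>u\<in>N v. f u \<noteq> f v) \<and> seq_eq k V f)"

text \<open>The vertices of the list are colored in this order and get pairwise different colors; \<open>m\<close> is the number of colors that are already
  forbidden, \<open>S\<close> the set of all vertices of the list.\<close>

fun greedy :: "nat \<Rightarrow> ('a \<Rightarrow> 'a set) \<Rightarrow> 'a set \<Rightarrow> nat \<Rightarrow> 'a list \<Rightarrow> bool" where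
  "greedy k N S m [] \<longleftrightarrow> True"
| "greedy k N S m (u # us) \<longleftrightarrow> card (N u - S) + m < k \<and> greedy k N S (Suc m) us"

lemma greedy_colors:
  assumes "greedy k N S m us" "distinct us" "finite F" "card F \<le> m"
    "\<And>u. u \<in> set us \<Longrightarrow> finite (L u) \<and> card (L u) = k" "\<And>u. finite (N u)"
  shows "\<exists>g. (\<forall>u\<in>set us. g u \<in> L u \<and> g u \<notin> F \<and> g u \<notin> f ` (N u - S)) \<and> inj_on g (set us)"
  using assms
proof (induction us arbitrary: m F)
  case (Cons u us)
  have "card (F \<union> f ` (N u - S)) \<le> card F + card (f ` (N u - S))" by (rule card_Un_le)
  also have "card (f ` (N u - S)) \<le> card (N u - S)" by (rule card_image_le) (simp add: Cons)
  finally have "card (F \<union> f ` (N u - S)) < card (L u)" using Cons.prems by simp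
  then have "\<not> L u \<subseteq> F \<union> f ` (N u - S)"
    by (meson card_mono finite_Diff finite_UnI finite_imageI Cons.prems(3,6) leD)
  then obtain a where a: "a \<in> L u" "a \<notin> F" "a \<notin> f ` (N u - S)" by blast
  have "\<exists>g. (\<forall>u\<in>set us. g u \<in> L u \<and> g u \<notin> insert a F \<and> g u \<notin> f ` (N u - S)) \<and> inj_on g (set us)"
    by (rule Cons.IH[of "Suc m"]) (use Cons.prems a in \<open>auto simp: card_insert_if\<close>)
  then obtain g where g: "\<forall>u\<in>set us. g u \<in> L u \<and> g u \<notin> insert a F \<and> g u \<notin> f ` (N u - S)" "inj_on g (set us)" by blast
  have un: "u \<notin> set us" using Cons.prems by simp
  have "inj_on (g(u := a)) (set (u # us))" using g un by (auto simp: inj_on_def)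
  moreover have "\<forall>w\<in>set (u # us). (g(u := a)) w \<in> L w \<and> (g(u := a)) w \<notin> F \<and> (g(u := a)) w \<notin> f ` (N w - S)"
    using g un a by auto
  ultimately show ?case by blast
qed auto

context nbr_graph
begin

lemma extend_coloring:
  assumes us: "distinct us" "set us = S" "S \<subseteq> V" "greedy k N S m us"
    and L: "\<forall>v\<in>V. finite (L v) \<and> card (L v) = k"
    and f: "\<forall>v\<in>V - S. f v \<in> L v" "\<forall>v\<in>V - S. \<forall>u\<in>del S N v. f u \<noteq> f v"
    and F: "finite F" "card F \<le> m"
  obtains h T where "\<forall>v\<in>V. h v \<in> L v" "\<forall>v\<in>V. \<forall>u\<in>N v. h u \<noteq> h v" "T \<inter> F = {}" "finite T" "card T = card S"
    "\<And>c. card {v\<in>V. h v = c} = card {v\<in>V - S. f v = c} + (if c \<in> T then 1 else 0)"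
proof -
  obtain g where g: "\<forall>u\<in>S. g u \<in> L u \<and> g u \<notin> F \<and> g u \<notin> f ` (N u - S)" "inj_on g S"
    using greedy_colors[OF us(4,1) F, of L f] L us by auto
  define h where "h = (\<lambda>v. if v \<in> S then g v else f v)"
  have fS: "finite S" using us by auto
  show ?thesis
  proof (rule that[of h "g ` S"])
    show "\<forall>v\<in>V. h v \<in> L v" using g f by (auto simp: h_def)
    show "\<forall>v\<in>V. \<forall>u\<in>N v. h u \<noteq> h v"
    proof (intro ballI)
      fix v u assume vu: "v \<in> V" "u \<in> N v"
      have uv: "v \<in> N u" "u \<in> V" "u \<noteq> v" using vu sym inV irr by blast+
      consider "u \<in> S" "v \<in> S" | "u \<in> S" "v \<notin> S" | "u \<notin> S" "v \<in> S" | "u \<notin> S" "v \<notin> S" by blast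
      then show "h u \<noteq> h v"
      proof cases
        case 1
        then show ?thesis using g(2) uv by (auto simp: h_def inj_on_def)
      next
        case 2
        then have "g u \<notin> f ` (N u - S)" "f v \<in> f ` (N u - S)" using g uv by auto
        then show ?thesis using 2 by (auto simp: h_def)
      next
        case 3
        then have "g v \<notin> f ` (N v - S)" "f u \<in> f ` (N v - S)" using g vu by auto
        then show ?thesis using 3 by (auto simp: h_def)
      next
        case 4
        then have "u \<in> del S N v" using vu by (auto simp: del_def)
        then show ?thesis using f(2) 4 vu by (auto simp: h_def)
      qed
    qed
    show "g ` S \<inter> F = {}" using g by auto
    show "finite (g ` S)" using fS by simp
    show "card (g ` S) = card S" by (rule card_image) (rule g(2))
    fix c
    have e: "{v\<in>V. h v = c} = {v\<in>V - S. f v = c} \<union> {v\<in>S. g v = c}" using us(3) by (auto simp: h_def)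
    have "card {v\<in>V. h v = c} = card {v\<in>V - S. f v = c} + card {v\<in>S. g v = c}"
      unfolding e by (rule card_Un_disjoint) (use fin fS in auto)
    moreover have "card {v\<in>S. g v = c} = (if c \<in> g ` S then 1 else 0)"
    proof (cases "c \<in> g ` S")
      case True
      then obtain s where "s \<in> S" "c = g s" by auto
      then have "{v\<in>S. g v = c} = {s}" using g(2) by (auto simp: inj_on_def)
      then show ?thesis using True by simp
    next
      case False
      then have e0: "{v\<in>S. g v = c} = {}" by auto
      show ?thesis unfolding e0 using False by simp
    qed
    ultimately show "card {v\<in>V. h v = c} = card {v\<in>V - S. f v = c} + (if c \<in> g ` S then 1 else 0)" by simp
  qed
qed

lemma finite_full: "0 < m \<Longrightarrow> A \<subseteq> V \<Longrightarrow> finite {c. card {v\<in>A. f v = c} = (m::nat)}"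
proof (rule finite_subset)
  assume "0 < m" "A \<subseteq> V"
  show "{c. card {v\<in>A. f v = c} = m} \<subseteq> f ` A"
  proof
    fix c assume "c \<in> {c. card {v\<in>A. f v = c} = m}"
    then have "0 < card {v\<in>A. f v = c}" using \<open>0 < m\<close> by simp
    then have "{v\<in>A. f v = c} \<noteq> {}" by (metis card.empty less_irrefl)
    then show "c \<in> f ` A" by auto
  qed
qed (use finV in auto)

text \<open>The bound on the class size grows by exactly 1 and each class by at most 1, so new full
  classes come from old full ones, while \<open>modstar\<close> is unchanged. If nothing lies
  outside \<open>S\<close>, the full classes are among the \<open>k\<close> colors of
  \<open>T\<close>.\<close>

lemma colorable_block:
  assumes us: "distinct us" "set us = S" "S \<subseteq> V" "greedy k N S 0 us" "length us = k" "0 < k"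
    and L: "\<forall>v\<in>V. finite (L v) \<and> card (L v) = k"
    and c: "colorable k L (V - S) (del S N)"
  shows "colorable k L V N"
proof -
  obtain f where f: "\<forall>v\<in>V - S. f v \<in> L v" "\<forall>v\<in>V - S. \<forall>u\<in>del S N v. f u \<noteq> f v" and q: "seq_eq k (V - S) f"
    using c by (auto simp: colorable_def)
  obtain h T where h: "\<forall>v\<in>V. h v \<in> L v" "\<forall>v\<in>V. \<forall>u\<in>N v. h u \<noteq> h v" and T: "finite T" "card T = card S"
    and hc: "\<And>c. card {v\<in>V. h v = c} = card {v\<in>V - S. f v = c} + (if c \<in> T then 1 else 0)"
    using extend_coloring[OF us(1-4) L f, of "{}"] by auto
  have S: "card S = k" using us distinct_card by fastforce
  define n where "n = card (V - S)"
  have n: "card V = n + k" using S us(3) fin by (metis card_Diff_subset card_mono finV le_add_diff_inverse2 n_def)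
  define m where "m = (n + k - 1) div k"
  have "card V + k - 1 = (n + k - 1) + k" using us(6) n by simp
  then have m1: "(card V + k - 1) div k = m + 1" unfolding m_def using us(6) by (metis div_add_self2 less_numeral_extra(3))
  have mm: "modstar (card V) k = modstar n k" by (simp add: n modstar_def)
  have fc: "card {v\<in>V - S. f v = c} \<le> m" for c using q by (auto simp: seq_eq_def n_def m_def)
  have "card {c. card {v\<in>V. h v = c} = m + 1} \<le> modstar (card V) k"
  proof (cases "V - S = {}")
    case True
    then have n0: "n = 0" "m = 0" using us(6) by (simp_all only: n_def m_def card.empty) auto
    have "{c. card {v\<in>V. h v = c} = m + 1} \<subseteq> T" using hc True n0 by (auto split: if_splits)
    then have "card {c. card {v\<in>V. h v = c} = m + 1} \<le> card T" using T(1) by (rule card_mono[rotated])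
    then have "card {c. card {v\<in>V. h v = c} = m + 1} \<le> k" using T S by simp
    then show ?thesis using mm n0 by (simp add: modstar_def)
  next
    case False
    then have "0 < n" using fin by (auto simp: n_def card_gt_0_iff)
    then have m0: "0 < m" using us(6) by (simp add: m_def div_greater_zero_iff)
    have "{c. card {v\<in>V. h v = c} = m + 1} \<subseteq> {c. card {v\<in>V - S. f v = c} = m}"
    proof
      fix c assume "c \<in> {c. card {v\<in>V. h v = c} = m + 1}"
      then show "c \<in> {c. card {v\<in>V - S. f v = c} = m}" using hc[of c] fc[of c] by (auto split: if_splits)
    qed
    then have "card {c. card {v\<in>V. h v = c} = m + 1} \<le> card {c. card {v\<in>V - S. f v = c} = m}"
      by (rule card_mono[rotated]) (rule finite_full[OF m0], auto)
    also have "\<dots> \<le> modstar n k" using q False by (simp add: seq_eq_def n_def m_def)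
    finally show ?thesis using mm by simp
  qed
  moreover have "card {v\<in>V. h v = c} \<le> m + 1" for c using hc[of c] fc[of c] by auto
  ultimately have "seq_eq k V h" unfolding seq_eq_def m1 by auto
  then show ?thesis using h by (auto simp: colorable_def)
qed

text \<open>Since \<open>k\<close> divides the order of the rest, already the first additional
  vertex raises the ceiling. So only the \<open>r\<close> colors used on \<open>S\<close> can be
  full, and \<open>modstar\<close> allows exactly \<open>r\<close>.\<close>

lemma colorable_short:
  assumes us: "distinct us" "set us = S" "S \<subseteq> V" "greedy k N S 0 us" "length us = r" "0 < r" "r \<le> k"
    and d: "k dvd card (V - S)"
    and L: "\<forall>v\<in>V. finite (L v) \<and> card (L v) = k"
    and c: "colorable k L (V - S) (del S N)"
  shows "colorable k L V N"
proof -
  obtain f where f: "\<forall>v\<in>V - S. f v \<in> L v" "\<forall>v\<in>V - S. \<forall>u\<in>del S N v. f u \<noteq> f v" and q: "seq_eq k (V - S) f"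
    using c by (auto simp: colorable_def)
  obtain h T where h: "\<forall>v\<in>V. h v \<in> L v" "\<forall>v\<in>V. \<forall>u\<in>N v. h u \<noteq> h v" and T: "finite T" "card T = card S"
    and hc: "\<And>c. card {v\<in>V. h v = c} = card {v\<in>V - S. f v = c} + (if c \<in> T then 1 else 0)"
    using extend_coloring[OF us(1-4) L f, of "{}"] by auto
  have S: "card S = r" using us distinct_card by fastforce
  obtain m where m: "card (V - S) = k * m" using d by (auto simp: dvd_def)
  have n: "card V = k * m + r" using S us(3) fin m by (metis card_Diff_subset card_mono finV le_add_diff_inverse2)
  have a: "(k * m + x) div k = m + x div k" for x using us by simp
  have m0: "(card (V - S) + k - 1) div k = m" using us a[of "k - 1"] by (simp add: m)
  have "(r + k - 1) div k = 1" using us by (simp add: div_nat_eqI)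
  then have m1: "(card V + k - 1) div k = m + 1" using us a[of "r + k - 1"] by (simp add: n add.assoc)
  have mm: "modstar (card V) k = r" using us by (cases "r = k") (auto simp: n modstar_def)
  have fc: "card {v\<in>V - S. f v = c} \<le> m" for c using q m0 by (auto simp: seq_eq_def)
  have "{c. card {v\<in>V. h v = c} = m + 1} \<subseteq> T"
  proof
    fix c assume "c \<in> {c. card {v\<in>V. h v = c} = m + 1}"
    then show "c \<in> T" using hc[of c] fc[of c] by (auto split: if_splits)
  qed
  then have "card {c. card {v\<in>V. h v = c} = m + 1} \<le> card T" using T(1) by (rule card_mono[rotated])
  then have "card {c. card {v\<in>V. h v = c} = m + 1} \<le> modstar (card V) k" using T S mm by simp
  moreover have "card {v\<in>V. h v = c} \<le> m + 1" for c using hc[of c] fc[of c] by auto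
  ultimately have "seq_eq k V h" unfolding seq_eq_def m1 by auto
  then show ?thesis using h by (auto simp: colorable_def)
qed

text \<open>Here the full classes of the smaller coloring have to be avoided, which is why the greedy coloring starts with \<open>modstar (card (V - S)) k\<close>
  forbidden colors.\<close>

lemma colorable_partial:
  assumes us: "distinct us" "set us = S" "S \<subseteq> V" "greedy k N S (modstar (card (V - S)) k) us"
    and r: "modstar (card (V - S)) k + length us \<le> k" "V - S \<noteq> {}" "0 < length us"
    and L: "\<forall>v\<in>V. finite (L v) \<and> card (L v) = k"
    and c: "colorable k L (V - S) (del S N)"
  shows "colorable k L V N"
proof -
  obtain f where f: "\<forall>v\<in>V - S. f v \<in> L v" "\<forall>v\<in>V - S. \<forall>u\<in>del S N v. f u \<noteq> f v" and q: "seq_eq k (V - S) f"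
    using c by (auto simp: colorable_def)
  define n where "n = card (V - S)"
  define m where "m = (n + k - 1) div k"
  define F where "F = {c. card {v\<in>V - S. f v = c} = m}"
  have n0: "0 < n" using r(2) fin by (auto simp: n_def card_gt_0_iff)
  have k0: "0 < k" using r(1,3) by linarith
  have m0: "0 < m" using n0 k0 by (simp add: m_def div_greater_zero_iff)
  have fF: "finite F" unfolding F_def by (rule finite_full[OF m0]) auto
  have cF: "card F \<le> modstar (card (V - S)) k" using q r(2) by (auto simp: seq_eq_def F_def m_def n_def)
  obtain h T where h: "\<forall>v\<in>V. h v \<in> L v" "\<forall>v\<in>V. \<forall>u\<in>N v. h u \<noteq> h v" and T: "T \<inter> F = {}" "finite T" "card T = card S"
    and hc: "\<And>c. card {v\<in>V. h v = c} = card {v\<in>V - S. f v = c} + (if c \<in> T then 1 else 0)"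
    using extend_coloring[OF us(1-4) L f fF cF] by auto
  define s where "s = length us"
  have S: "card S = s" using us distinct_card s_def by fastforce
  have n: "card V = n + s" using S us(3) fin by (metis card_Diff_subset card_mono finV le_add_diff_inverse2 n_def)
  \<comment> \<open>The order of the rest is kp + x with x between 1 and k. As x + s is at most k,
    the ceiling p + 1 does not change and the number of allowed full classes rises from x to x +
    s.\<close>
  define x where "x = modstar n k"
  have x: "0 < x" "x + s \<le> k" "0 < s" using r k0 by (auto simp: x_def n_def s_def modstar_def)
  obtain p where p: "n = k * p + x"
  proof (cases "n mod k = 0")
    case True
    then obtain p where p: "n = k * p" by auto
    then have "p \<noteq> 0" using n0 by auto
    then obtain p' where "p = Suc p'" by (cases p) auto
    then show ?thesis using that[of p'] True p by (simp add: x_def modstar_def)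
  next
    case False
    then show ?thesis using that[of "n div k"] by (simp add: x_def modstar_def)
  qed
  have a: "(k * p + y) div k = p + y div k" for y using k0 by simp
  have "(x + k - 1) div k = 1" using x by (simp add: div_nat_eqI)
  then have m1: "m = p + 1" using a[of "x + k - 1"] x by (simp add: m_def p add.assoc)
  have "(x + s + k - 1) div k = 1" using x by (simp add: div_nat_eqI)
  then have m2: "(card V + k - 1) div k = m" using a[of "x + s + k - 1"] x m1 by (simp add: n p add.assoc)
  have mm: "modstar (card V) k = x + s" using x by (cases "x + s = k") (auto simp: n p modstar_def add.assoc)
  have fc: "card {v\<in>V - S. f v = c} \<le> m" for c using q by (auto simp: seq_eq_def n_def m_def)
  have hm: "card {v\<in>V. h v = c} \<le> m" for c
  proof (cases "c \<in> T")
    case True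
    then have "card {v\<in>V - S. f v = c} \<noteq> m" using T by (auto simp: F_def)
    then show ?thesis using hc[of c] fc[of c] True by simp
  qed (use hc fc in auto)
  have "{c. card {v\<in>V. h v = c} = m} \<subseteq> F \<union> T"
  proof
    fix c assume "c \<in> {c. card {v\<in>V. h v = c} = m}"
    then show "c \<in> F \<union> T" using hc[of c] by (auto simp: F_def split: if_splits)
  qed
  then have "card {c. card {v\<in>V. h v = c} = m} \<le> card (F \<union> T)" by (rule card_mono[rotated]) (use fF T in auto)
  also have "\<dots> \<le> card F + card T" by (rule card_Un_le)
  also have "\<dots> \<le> x + s" using cF T S by (simp add: x_def n_def)
  finally have "seq_eq k V h" unfolding seq_eq_def m2 using hm mm by auto
  then show ?thesis using h by (auto simp: colorable_def)
qed

end

section \<open>Irreducible graphs\<close>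

text \<open>The second condition takes over the role of \<open>\<sigma>\<close>: for \<open>c = 2\<close> and \<open>4 dvd card V\<close> the potential of \<open>V\<close> is even, and it is
  2 modulo 4 iff the number of vertices of degree 1 is odd.\<close>

definition in_class :: "int \<Rightarrow> 'a set \<Rightarrow> ('a \<Rightarrow> 'a set) \<Rightarrow> bool" where
  "in_class c V N \<longleftrightarrow> sparse c V N \<and> (c = 2 \<and> 4 dvd card V \<longrightarrow> pot c N V \<le> 0)"

definition kof :: "int \<Rightarrow> nat" where "kof c = (if c = 3 then 3 else 4)"

context nbr_graph
begin

text \<open>The rest may be replaced by a supergraph \<open>N'\<close>, since a coloring of it also
  colors the rest. \<open>no_star_of_lights_3\<close> uses this freedom to add an edge.\<close>

definition reducible :: bool where
  "reducible \<longleftrightarrow> (\<exists>us N'. distinct us \<and> set us \<subseteq> V \<and> length us = kof c \<and> greedy (kof c) N (set us) 0 us \<and>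
     nbr_graph (V - set us) N' c \<and> (\<forall>v. del (set us) N v \<subseteq> N' v) \<and> in_class c (V - set us) N')"

lemma reducibleI:
  assumes "distinct us" "set us \<subseteq> V" "length us = kof c" "greedy (kof c) N (set us) 0 us"
    "in_class c (V - set us) (del (set us) N)"
  shows reducible
  unfolding reducible_def using assms del_graph by blast

lemma pot_eq_sum: "pot c N A = c * (\<Sum>v\<in>A. int (card (N v \<inter> A)) + defect N v) - (2*c+1) * int (card A)"
  unfolding pot_def by (simp add: sum_subtractf sum_distrib_left)

text \<open>The potential has the form c (X - 2n) - n for a set of n vertices.\<close>

lemma pot_mod: 
  "c = 3 \<Longrightarrow> 3 dvd pot c N A + int (card A)"
  "c = 2 \<Longrightarrow> even (pot c N A + int (card A))"
proof -
  define X where "X = (\<Sum>v\<in>A. int (card (N v \<inter> A)) + defect N v)"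
  have e: "pot c N A = c * X - (2*c+1) * int (card A)" unfolding X_def by (rule pot_eq_sum)
  show "3 dvd pot c N A + int (card A)" if "c = 3"
  proof -
    have "pot c N A + int (card A) = 3 * (X - 2 * int (card A))" using e that by simp
    then show ?thesis by (metis dvd_triv_left)
  qed
  show "even (pot c N A + int (card A))" if "c = 2"
  proof -
    have "pot c N A + int (card A) = 2 * (X - 2 * int (card A))" using e that by simp
    then show ?thesis by (metis dvd_triv_left)
  qed
qed

text \<open>The potential of \<open>V\<close> is odd, hence at most 1. Deleting a light vertex
  raises the sum of charges by 1, while the heavy neighbour supplied by \<open>remove_light\<close>
  loses c = 2, so at most 0 remains. This is what \<open>in_class\<close> demands when the new order
  is divisible by 4.\<close>

lemma remove_light_zero:
  assumes sp: "sparse c V N" and c2: "c = 2" and od: "odd (card V)"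
  obtains x where "x \<in> V" "light N x" "sparse c (V - {x}) (del {x} N)" "pot c (del {x} N) (V - {x}) \<le> 0"
proof -
  have ne: "V \<noteq> {}" using od by auto
  obtain x where x: "x \<in> V" "light N x" "sparse c (V - {x}) (del {x} N)"
    and o: "(\<exists>v\<in>N x. \<not> light N v) \<or> (\<forall>v\<in>V. light N v)" using remove_light[OF sp ne] by metis
  interpret D: nbr_graph "V - {x}" "del {x} N" c by (rule del_graph)
  have "pot c (del {x} N) (V - {x}) \<le> 0"
  proof (cases "\<forall>v\<in>V. light N v")
    case True
    then show ?thesis using D.all_light_pot[of "V - {x}"] light_del by fastforce
  next
    case False
    then obtain v where v: "v \<in> N x" "\<not> light N v" using o by blast
    have "pot c N V \<le> 2" using sparseD[OF sp] by simp
    moreover have "odd (pot c N V)" using pot_mod(2)[OF c2, of V] od by simp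
    ultimately have p1: "pot c N V \<le> 1" by presburger
    have le: "D.charge u \<le> charge u" for u
    proof -
      have "card (del {x} N u) \<le> card (N u)" by (rule card_mono) (auto simp: del_def)
      then show ?thesis using c23 by (auto simp: D.charge_def charge_def)
    qed
    have vx: "v \<noteq> x" "v \<in> V" using v x inV by auto
    have "x \<in> N v" using v sym by auto
    then have "card (del {x} N v) = card (N v) - 1" using vx by (simp add: del_def)
    then have lv: "D.charge v = charge v - 2" using D.charge_def[of v] charge_def[of v] heavy_ge3[OF v(2)] c2 by auto
    have "pot c (del {x} N) (V - {x}) = (\<Sum>u\<in>V - {x}. D.charge u)" by (rule D.pot_total)
    also have "\<dots> = D.charge v + (\<Sum>u\<in>V - {x} - {v}. D.charge u)" by (rule sum.remove) (use vx fin in auto)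
    also have "(\<Sum>u\<in>V - {x} - {v}. D.charge u) \<le> (\<Sum>u\<in>V - {x} - {v}. charge u)" by (rule sum_mono) (rule le)
    also have "D.charge v + (\<Sum>u\<in>V - {x} - {v}. charge u) = (\<Sum>u\<in>V - {x}. charge u) - 2"
      using lv sum.remove[of "V - {x}" v charge] vx fin by auto
    also have "(\<Sum>u\<in>V - {x}. charge u) = pot c N V - charge x"
      using pot_total sum.remove[of V x charge] x fin by auto
    finally show ?thesis using charge_light[OF x(2)] p1 by linarith
  qed
  then show ?thesis using that x by blast
qed

text \<open>For c = 3 the three vertices are a block. For c = 2 the rest has odd order, and
  \<open>remove_light_zero\<close> supplies a fourth vertex that brings the potential to at most 0.
  It has at most two outside neighbours and is therefore colored second.\<close>

lemma reducible_by_three: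
  assumes d: "distinct [u0, u1, u2]" "{u0, u1, u2} \<subseteq> V" and kd: "kof c dvd card V" "kof c < card V"
    and o: "card (N u0 - {u0,u1,u2}) \<le> (if c = 3 then 2 else 3)" "card (N u1 - {u0,u1,u2}) \<le> 1" "N u2 \<subseteq> {u0,u1,u2}"
    and sp: "sparse c (V - {u0,u1,u2}) (del {u0,u1,u2} N)"
  shows reducible
proof (cases "c = 3")
  case True
  have e0: "N u2 - {u0,u1,u2} = {}" using o(3) by auto
  have g: "greedy 3 N {u0,u1,u2} 0 [u0,u1,u2]" using o True e0 by simp
  show ?thesis
    by (rule reducibleI[of "[u0,u1,u2]"]) (use d g sp True in \<open>auto simp: kof_def in_class_def\<close>)
next
  case False
  then have c2: "c = 2" using c23 by auto
  define S where "S = {u0,u1,u2}"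
  interpret D: nbr_graph "V - S" "del S N" c by (rule del_graph)
  have cS: "card S = 3" using d by (simp add: S_def)
  have SV: "S \<subseteq> V" using d by (simp add: S_def)
  have cV: "card (V - S) = card V - 3" using cS SV by (simp add: card_Diff_subset finV)
  have "4 dvd card V" "4 < card V" using kd c2 by (auto simp: kof_def)
  then have "odd (card (V - S))" using cV by (auto elim!: dvdE)
  then obtain z where z: "z \<in> V - S" "light (del S N) z" "sparse c (V - S - {z}) (del {z} (del S N))"
      "pot c (del {z} (del S N)) (V - S - {z}) \<le> 0"
    using D.remove_light_zero sp c2 unfolding S_def by metis
  define us where "us = [u0, z, u1, u2]"
  have us: "set us = S \<union> {z}" by (auto simp: us_def S_def)
  have e: "V - S - {z} = V - set us" "del {z} (del S N) = del (set us) N" using us by (auto simp: del_del)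
  have "card (N z - set us) \<le> card (N z - S)" by (rule card_mono) (auto simp: us)
  also have "\<dots> \<le> 2" using z by (simp add: light_def del_def)
  finally have oz: "card (N z - set us) \<le> 2" .
  have m: "card (N u - set us) \<le> card (N u - S)" for u by (rule card_mono) (auto simp: us)
  have e0: "N u2 - set us = {}" using o(3) us by (auto simp: S_def)
  have ou: "card (N u0 - set us) \<le> 3" "card (N u1 - set us) \<le> 1"
    using o(1,2) m[of u0] m[of u1] False by (auto simp: S_def)
  have "greedy 4 N (set us) 0 [u0, z, u1, u2]" using oz ou by (simp add: e0)
  moreover have "distinct us" using d z by (auto simp: us_def S_def)
  moreover have "set us \<subseteq> V" using us SV z by auto
  moreover have "in_class c (V - set us) (del (set us) N)" using z unfolding e in_class_def by auto
  ultimately show ?thesis using c2 by (intro reducibleI[of us]) (auto simp: kof_def us_def)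
qed

end

text \<open>\<open>M\<close> is the largest set of maximal potential; if this is \<open>V\<close> itself, no set has positive potential and \<open>M\<close> is taken to be empty.
  All sets not contained in \<open>M\<close> have potential at most 1, hence configurations outside \<open>M\<close> can be deleted almost without restriction.\<close>

locale irreducible_graph = nbr_graph +
  fixes M :: "'a set"
  assumes sp: "sparse c V N" and td: tidy and kd: "kof c dvd card V" "kof c < card V" and p0: "pot c N V \<le> 0"
    and MV: "M \<subseteq> V" "M \<noteq> V"
    and strong: "(\<forall>A\<subseteq>V. \<not> A \<subseteq> M \<longrightarrow> pot c N A < pot c N M) \<and> (\<forall>A\<subseteq>V. pot c N A \<le> pot c N M) \<or> M = {} \<and> (\<forall>A\<subseteq>V. pot c N A \<le> 0)"
    and irred: "\<not> reducible"
begin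

section \<open>Light vertices outside \<open>M\<close> have heavy neighbours\<close>

lemma M2: "pot c N M \<le> 2" using sparseD[OF sp MV(1)] .

lemma pot_outside_le1: "A \<subseteq> V \<Longrightarrow> \<not> A \<subseteq> M \<Longrightarrow> pot c N A \<le> 1"
proof -
  assume a: "A \<subseteq> V" "\<not> A \<subseteq> M"
  from strong show ?thesis
  proof
    assume "(\<forall>A\<subseteq>V. \<not> A \<subseteq> M \<longrightarrow> pot c N A < pot c N M) \<and> (\<forall>A\<subseteq>V. pot c N A \<le> pot c N M)"
    then have "pot c N A < pot c N M" using a by blast
    then show ?thesis using M2 by linarith
  next
    assume "M = {} \<and> (\<forall>A\<subseteq>V. pot c N A \<le> 0)"
    then have "pot c N A \<le> 0" using a by blast
    then show ?thesis by linarith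
  qed
qed

text \<open>A light vertex of \<open>M\<close> with a neighbour outside has a negative marginal, so
  \<open>M\<close> without it would exceed the maximal potential.\<close>

lemma M_light:
  assumes "x \<in> M" "light N x" shows "N x \<subseteq> M"
proof (rule ccontr)
  assume n: "\<not> ?thesis"
  have mx: "\<forall>A\<subseteq>V. pot c N A \<le> pot c N M" using strong assms by auto
  have "card (N x \<inter> M) < card (N x)" by (rule psubset_card_mono) (use n in auto)
  moreover have "card (N x) = 0 \<or> card (N x) = 1 \<or> card (N x) = 2" using assms(2) unfolding light_def by linarith
  moreover have "pot c N M = pot c N (M - {x}) + 2*c* int (card (N x \<inter> M)) + c * defect N x - (2*c+1)"
    by (rule pot_remove) (use MV assms in auto)
  moreover have "M - {x} \<subseteq> V" using MV by auto
  then have "pot c N (M - {x}) \<le> pot c N M" using mx by blast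
  ultimately have g: "2*c+1 \<le> 2*c* int (card (N x \<inter> M)) + c * defect N x" "card (N x \<inter> M) < card (N x)"
     "card (N x) = 0 \<or> card (N x) = 1 \<or> card (N x) = 2" by linarith+
  have "defect N x = 2 - int (card (N x))" using assms(2) by (simp add: defect_def light_def)
  moreover have "card (N x \<inter> M) = 0 \<or> card (N x \<inter> M) = 1" using g(2,3) by linarith
  ultimately show False using g c23 by auto
qed

lemma M_light': "u \<in> N x \<Longrightarrow> light N u \<Longrightarrow> x \<in> V - M \<Longrightarrow> u \<in> V - M"
  using M_light[of u] sym[of u x] inV by auto

lemma remove_three_not_sparse:
  assumes "u0 \<noteq> u1" "u0 \<noteq> u2" "u1 \<noteq> u2" "{u0, u1, u2} \<subseteq> V" 
    and o: "card (N u0 - {u0,u1,u2}) \<le> (if c = 3 then 2 else 3)" "card (N u1 - {u0,u1,u2}) \<le> 1" "N u2 \<subseteq> {u0,u1,u2}"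
  shows "\<not> sparse c (V - {u0,u1,u2}) (del {u0,u1,u2} N)"
  using reducible_by_three[OF _ assms(4) kd o] irred assms(1-3) by auto

text \<open>Without \<open>b\<close> the potential is at most 1, by the congruence for the new
  order. Thus \<open>remove_pair\<close> applies, and its two vertices together with
  \<open>b\<close> form a reducible triple.\<close>

lemma no_isolated: "b \<in> V \<Longrightarrow> N b \<noteq> {}"
proof
  assume b: "b \<in> V" "N b = {}"
  interpret D: nbr_graph "V - {b}" "del {b} N" c by (rule del_graph)
  have nb: "b \<notin> N v" for v using sym[of b v] b by auto
  have dN: "del {b} N = N" using nb b by (auto simp: del_def fun_eq_iff)
  have sD: "sparse c (V - {b}) (del {b} N)" unfolding dN using sp by (auto simp: sparse_def)
  have tD: "D.tidy" unfolding D.tidy_def unfolding dN using td unfolding tidy_def by auto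
  have cD: "card (V - {b}) = card V - 1" using b fin by simp
  have c5: "3 < card V" using kd by (auto simp: kof_def split: if_splits)
  have pD: "pot c (del {b} N) (V - {b}) \<le> 1"
  proof (cases "c = 3")
    case True
    have "3 dvd card V" using kd True by (simp add: kof_def)
    moreover have "3 dvd pot c (del {b} N) (V - {b}) + int (card V - 1)" using D.pot_mod(1)[OF True, of "V - {b}"] cD by simp
    moreover have "pot c (del {b} N) (V - {b}) \<le> 2" using D.sparseD[OF sD] by simp
    moreover have "int (card V - 1) = int (card V) - 1" using c5 by simp
    ultimately show ?thesis by presburger
  next
    case False
    then have c2: "c = 2" using c23 by simp
    have "4 dvd card V" using kd c2 by (simp add: kof_def)
    moreover have "even (pot c (del {b} N) (V - {b}) + int (card V - 1))" using D.pot_mod(2)[OF c2, of "V - {b}"] cD by simp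
    moreover have "pot c (del {b} N) (V - {b}) \<le> 2" using D.sparseD[OF sD] by simp
    moreover have "int (card V - 1) = int (card V) - 1" using c5 by simp
    ultimately show ?thesis by presburger
  qed
  have "2 \<le> card (V - {b})" using c5 cD by simp
  then obtain s t where st: "s \<in> V - {b}" "t \<in> V - {b}" "s \<noteq> t" "card (N s - {t}) \<le> 1" "card (N t - {s}) \<le> 2"
    "sparse c (V - {b} - {s, t}) (del {s, t} (del {b} N))"
    using D.remove_pair[OF sD pD tD] unfolding dN by metis
  have "{b} \<union> {s,t} = {t,s,b}" by auto
  then have e: "V - {b} - {s,t} = V - {t,s,b}" "del {s,t} (del {b} N) = del {t,s,b} N"
    using del_del[of "{s,t}" "{b}"] by auto
  have "N s - {t,s,b} = N s - {t}" "N t - {t,s,b} = N t - {s}" using nb irr by auto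
  then have o: "card (N t - {t,s,b}) \<le> (if c = 3 then 2 else 3)" "card (N s - {t,s,b}) \<le> 1" using st(4,5) by auto
  have "\<not> sparse c (V - {t,s,b}) (del {t,s,b} N)"
    by (rule remove_three_not_sparse[OF _ _ _ _ o]) (use st(1-3) b in auto)
  then show False using st(6) unfolding e by blast
qed

text \<open>Deleting \<open>a\<close> and \<open>b\<close> costs no half-edge, because the only
  outside vertex concerned is heavy and loses one edge. Any vertex found by
  \<open>remove_light\<close> in the rest completes the triple.\<close>

lemma no_light_leaf:
  assumes "N b = {a}" "light N a" "N a = {b} \<or> (\<exists>y. N a = {b, y} \<and> \<not> light N y)"
  shows False
proof -
  have abV: "a \<in> V" "b \<in> V" "a \<noteq> b" using assms inV irr by blast+
  interpret D: nbr_graph "V - {a,b}" "del {a,b} N" c by (rule del_graph)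
  have sD: "sparse c (V - {a,b}) (del {a,b} N)"
  proof (rule no_loss_sparse[OF sp])
    fix v assume v: "v \<in> V" "v \<notin> {a, b}"
    have bv: "b \<notin> N v" using assms(1) sym[of b v] v by auto
    show "loss {a, b} N v = 0"
    proof (cases "a \<in> N v")
      case True
      then have "\<not> light N v" using sym[of a v] assms(3) v by auto
      then show ?thesis by (rule two_heavy_nbrs_loss[of v "{a,b}" a]) (use v bv in auto)
    next
      case False
      then show ?thesis using bv v by (intro loss_0) auto
    qed
  qed
  have "card V \<noteq> card {a,b}" using kd abV by (auto simp: kof_def split: if_splits)
  then have "V - {a,b} \<noteq> {}" using abV by (metis Diff_eq_empty_iff subset_antisym empty_subsetI insert_subset)
  then obtain z where z: "z \<in> V - {a,b}" "light (del {a,b} N) z" "sparse c (V - {a,b} - {z}) (del {z} (del {a,b} N))"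
    using D.remove_light[OF sD] by metis
  have e: "V - {a,b} - {z} = V - {z,a,b}" "del {z} (del {a,b} N) = del {z,a,b} N" by (auto simp: del_del)
  have "card (N z - {z,a,b}) \<le> card (N z - {a,b})" by (rule card_mono) auto
  also have "\<dots> \<le> 2" using z by (simp add: light_def del_def)
  finally have 1: "card (N z - {z,a,b}) \<le> (if c = 3 then 2 else 3)" by auto
  have "b \<in> N a" using assms(1) sym by auto
  then have "card (N a - {b}) \<le> 1" using assms(2) by (simp add: light_def)
  moreover have "card (N a - {z,a,b}) \<le> card (N a - {b})" by (rule card_mono) auto
  ultimately have 2: "card (N a - {z,a,b}) \<le> 1" by linarith
  show False using remove_three_not_sparse[of z a b, OF _ _ _ _ 1 2] z abV assms(1) unfolding e by auto
qed

text \<open>The counterpart of \<open>pair_side\<close> for three consecutive light vertices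
  \<open>a\<close>, \<open>b\<close>, \<open>e\<close>: the path stops at \<open>a\<close> or meets
  a heavy vertex behind it, so the deletion can fail only because of what lies behind
  \<open>e\<close>.\<close>

lemma triple_side:
  assumes ns: "\<not> sparse c (V - {a, b, e}) (del {a, b, e} N)"
    and la: "light N a" and lb: "light N b" and le: "light N e" and Nb: "N b = {a, e}" and bM: "b \<notin> M" and ae: "a \<noteq> e"
    and Na: "N a = {b} \<or> (\<exists>v. N a = {b, v} \<and> \<not> light N v)"
  obtains y y1 where "light N y" "N e = {b, y}" "y \<noteq> b" "N y = {e, y1}" "y1 \<noteq> e" "y \<noteq> a"
    "(\<not> light N y1 \<and> (\<exists>C. C \<subseteq> V - {a, b, e, y} \<and> y1 \<in> C \<and> 4 - c \<le> pot c N C)) \<or>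
     (c = 3 \<and> light N y1 \<and> (\<exists>y2. N y1 = {y, y2} \<and> \<not> light N y2 \<and> y2 \<noteq> y \<and>
        (\<exists>C. C \<subseteq> V - {a, b, e, y, y1} \<and> y2 \<in> C \<and> 2 \<le> pot c N C)))"
proof -
  have V: "a \<in> V" "b \<in> V" "e \<in> V" using Nb inV by blast+
  have ne: "a \<noteq> b" "b \<noteq> e" using Nb irr[of b] by auto
  have bNe: "b \<in> N e" "b \<in> N a" using Nb sym by auto
  obtain A where A: "bad {a, b, e} A" using ns by (rule not_sparse_bad)
  have AV: "A \<subseteq> V - {a, b, e}" "A \<subseteq> V" using badD(1)[OF A] by auto
  have bN: "b \<notin> N u" if "u \<in> A" for u using that Nb sym[of b u] AV by auto
  have aN: "\<not> light N u \<and> N a = {b, u}" if "u \<in> A" "a \<in> N u" for u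
    using that Na sym[of a u] AV by auto
  have loss1: "loss {a,b,e} N u = 0" if "u \<in> A" "e \<notin> N u" for u
  proof (cases "a \<in> N u")
    case True
    show ?thesis by (rule two_heavy_nbrs_loss[of u _ a]) (use True aN that bN AV in auto)
  next
    case False
    then show ?thesis using that bN AV by (intro loss_0) auto
  qed
  obtain y where y: "y \<in> A" "loss {a,b,e} N y \<noteq> 0" using bad_not_sparse_loss[OF sp A] by blast
  then have eNy: "e \<in> N y" using loss1 by blast
  then have yNe: "y \<in> N e" using sym by auto
  have yb: "y \<noteq> b" "y \<noteq> a" "y \<noteq> e" using y AV by auto
  have Ne: "N e = {b, y}" using light_two[OF le bNe(1) yNe] yb by auto
  have out: "loss {a,b,e} N u = 0" if "u \<in> A" "u \<noteq> y" for u
    using loss1[OF that(1)] sym[of e u] Ne that AV by auto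
  \<comment> \<open>A heavy \<open>y\<close> that loses a half-edge is adjacent to \<open>a\<close>
    as well, which gives a 4-cycle. Adding \<open>a\<close>, \<open>b\<close>, \<open>e\<close> to
    the bad set yields 3 - c - 1 - 1 + (2c - 1) = c >= 2, against the bound 1 for sets that contain
    \<open>b\<close> outside \<open>M\<close>.\<close>
  have ly: "light N y"
  proof (rule ccontr)
    assume hy: "\<not> light N y"
    have "\<not> N y \<inter> {a,b,e} \<subseteq> {e}" using two_heavy_nbrs_loss[of y "{a,b,e}" e] hy y yb by auto
    then have "a \<in> N y" using bN[OF y(1)] by auto
    then have Nay: "N a = {b, y}" using aN y by blast
    have "card (N y \<inter> {a,b,e}) \<le> card {a,e}" by (rule card_mono) (use bN[OF y(1)] in auto)
    then have "card (N y \<inter> {a,b,e}) \<le> 2" using ae by simp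
    then have l: "loss {a,b,e} N y \<le> 1" using loss_heavy_le[of y "{a,b,e}"] hy yb by auto
    have "(\<Sum>u\<in>A. loss {a,b,e} N u) = (\<Sum>u\<in>A \<inter> {y}. loss {a,b,e} N u)"
      by (rule loss_sum_restrict) (use out finV AV in auto)
    also have "\<dots> \<le> 1" using y l by simp
    finally have "c * (\<Sum>u\<in>A. loss {a,b,e} N u) \<le> c" using c23 by auto
    then have "3 - c \<le> pot c N A" using badD(2)[OF A] by linarith
    moreover have "pot c N A - 1 \<le> pot c N (insert a A)"
      by (rule pot_add1[of _ _ y]) (use AV V y Nay in auto)
    moreover have "pot c N (insert a A) - 1 \<le> pot c N (insert b (insert a A))"
      by (rule pot_add1[of _ _ a]) (use AV V y Nb ne in auto)
    moreover have "pot c N (insert b (insert a A)) + 2*c - 1 \<le> pot c N (insert e (insert b (insert a A)))"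
      by (rule pot_add2[of _ _ b y]) (use AV V y Ne ne yb ae in auto)
    moreover have "pot c N (insert e (insert b (insert a A))) \<le> 1"
      by (rule pot_outside_le1) (use AV V bM in auto)
    ultimately show False using c23 by linarith
  qed
  have "N y - {a,b,e} \<noteq> {}" using badD(4)[OF A y(1)] .
  then obtain y1 where y1: "y1 \<noteq> e" "N y = {e, y1}" using light_cases[OF ly eNy] by auto
  have y1S: "y1 \<notin> {a,b,e}" using bN[OF y(1)] aN[OF y(1)] ly y1 by auto
  have ee: "V - {a,b,e} - {y} = V - {a,b,e,y}" "V - {a,b,e} - {y,y1} = V - {a,b,e,y,y1}" by auto
  show ?thesis
    by (rule that[OF ly Ne yb(1) y1(2,1) yb(2)])
      (use peel[OF sp A y1(2) _ y1S _ out] yb in \<open>auto simp: ee\<close>)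
qed

lemma no_light_triple_end:
  assumes la: "light N a" and lb: "light N b" and le: "light N e" and Nb: "N b = {a, e}" and ae: "a \<noteq> e" and bM: "b \<notin> M" 
    and Na: "N a = {b} \<or> (\<exists>v. N a = {b, v} \<and> \<not> light N v)"
  shows False
proof -
  have tri: "\<not> sparse c (V - {a', b', e'}) (del {a', b', e'} N)"
    if h: "light N a'" "light N b'" "light N e'" "N b' = {a', e'}" "a' \<noteq> e'" for a' b' e'
  proof -
    have V: "a' \<in> V" "b' \<in> V" "e' \<in> V" using h inV by blast+
    have ne: "a' \<noteq> b'" "b' \<noteq> e'" using h irr[of b'] by auto
    have i: "b' \<in> N a'" "b' \<in> N e'" using h sym by auto
    have "card (N a' - {a',e',b'}) \<le> card (N a' - {b'})" "card (N e' - {a',e',b'}) \<le> card (N e' - {b'})" by (auto intro: card_mono)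
    then have "card (N a' - {a',e',b'}) \<le> 1" "card (N e' - {a',e',b'}) \<le> 1" using h i by (auto simp: light_def)
    then have "\<not> sparse c (V - {a',e',b'}) (del {a',e',b'} N)"
      by (intro remove_three_not_sparse) (use V ne h in auto)
    moreover have "{a',e',b'} = {a',b',e'}" by auto
    ultimately show ?thesis by simp
  qed
  have V: "a \<in> V" "b \<in> V" "e \<in> V" using Nb inV by blast+
  have ne: "a \<noteq> b" "b \<noteq> e" using Nb irr[of b] by auto
  obtain y y1 where y: "light N y" "N e = {b, y}" "y \<noteq> b" "N y = {e, y1}" "y1 \<noteq> e" "y \<noteq> a" and
    o: "(\<not> light N y1 \<and> (\<exists>C. C \<subseteq> V - {a, b, e, y} \<and> y1 \<in> C \<and> 4 - c \<le> pot c N C)) \<or>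
     (c = 3 \<and> light N y1 \<and> (\<exists>y2. N y1 = {y, y2} \<and> \<not> light N y2 \<and> y2 \<noteq> y \<and>
        (\<exists>C. C \<subseteq> V - {a, b, e, y, y1} \<and> y2 \<in> C \<and> 2 \<le> pot c N C)))"
    by (rule triple_side[OF tri[OF la lb le Nb ae] la lb le Nb bM ae Na])
  have yV: "y \<in> V" "y1 \<in> V" using y inV by blast+
  have ye: "y \<noteq> e" using y irr by auto
  have eM: "e \<notin> M" using M_light[OF _ le] y bM by auto
  have yM: "y \<notin> M" using M_light[OF _ y(1)] y eM by auto
  have aM: "a \<notin> M" using M_light[OF _ la] bM sym[of a b] Nb by auto
  have st: "c = 3 \<Longrightarrow> 2 \<le> pot c N C \<Longrightarrow> C \<subseteq> V \<Longrightarrow> C \<subseteq> M" for C using pot_outside_le1[of C] by force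
  from o show False
  proof
    assume o1: "\<not> light N y1 \<and> (\<exists>C. C \<subseteq> V - {a, b, e, y} \<and> y1 \<in> C \<and> 4 - c \<le> pot c N C)"
    then obtain C where C: "C \<subseteq> V - {a, b, e, y}" "y1 \<in> C" "4 - c \<le> pot c N C" by blast
    have Ne: "N e = {y, b}" using y by auto
    have "N y = {e} \<or> (\<exists>v. N y = {e, v} \<and> \<not> light N v)" using y o1 by auto
    from triple_side[OF tri[OF y(1) le lb Ne y(3)] y(1) le lb Ne eM y(3) this]
    obtain z v where z: "N b = {e, z}" "z \<noteq> e" "N z = {b, v}" "v \<noteq> b" and
      o2: "(\<not> light N v \<and> (\<exists>C. C \<subseteq> V - {y, e, b, z} \<and> v \<in> C \<and> 4 - c \<le> pot c N C)) \<or> (c = 3 \<and> light N v)"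
      by metis
    have za: "z = a" using z Nb ae by auto
    have hv: "\<not> light N v" using Na z za by auto
    obtain C' where C': "C' \<subseteq> V - {a, b, e, y}" "v \<in> C'" "4 - c \<le> pot c N C'"
    proof -
      have "\<exists>C. C \<subseteq> V - {y, e, b, a} \<and> v \<in> C \<and> 4 - c \<le> pot c N C" using o2 hv za by auto
      moreover have "V - {y, e, b, a} = V - {a, b, e, y}" by auto
      ultimately show ?thesis using that by auto
    qed
    \<comment> \<open>A set of positive potential rules out the second alternative of
      \<open>strong\<close>, so \<open>M\<close> is the largest maximizer.\<close>
    have "C \<subseteq> V" "\<not> pot c N C \<le> 0" using C c23 by auto
    then have "(\<forall>A\<subseteq>V. \<not> A \<subseteq> M \<longrightarrow> pot c N A < pot c N M) \<and> (\<forall>A\<subseteq>V. pot c N A \<le> pot c N M)" using strong by blast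
    then have mx: "\<And>A. A \<subseteq> V \<Longrightarrow> \<not> A \<subseteq> M \<Longrightarrow> pot c N A < pot c N M" "\<And>A. A \<subseteq> V \<Longrightarrow> pot c N A \<le> pot c N M" by blast+
    \<comment> \<open>Uniting with \<open>M\<close> keeps potentials at least 4 - c, and the overlap
      has at most \<open>pot c N M\<close>. The path \<open>a\<close>, \<open>b\<close>,
      \<open>e\<close>, \<open>y\<close> adds 2c - 4, so the total is at least 4 -
      \<open>pot c N M\<close>. The resulting set is not inside \<open>M\<close>, hence this must be
      less than \<open>pot c N M\<close>, which is at most 2.\<close>
    define D where "D = C \<union> M" 
    define D' where "D' = C' \<union> M"
    define U where "U = D \<union> D'"
    have CV: "C \<subseteq> V" "C' \<subseteq> V" "D \<subseteq> V" "D' \<subseteq> V" using C C' MV by (auto simp: D_def D'_def)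
    have U: "U \<subseteq> V" "a \<notin> U" "b \<notin> U" "e \<notin> U" "y \<notin> U" "v \<in> U" "y1 \<in> U"
      using C C' MV aM bM eM yM by (auto simp: U_def D_def D'_def)
    have "4 - c \<le> pot c N D" using pot_supermod[OF CV(1) MV(1)] mx(2)[OF le_infI1[OF CV(1)], of M] C(3) unfolding D_def by linarith
    moreover have "4 - c \<le> pot c N D'" using pot_supermod[OF CV(2) MV(1)] mx(2)[OF le_infI1[OF CV(2)], of M] C'(3) unfolding D'_def by linarith
    moreover have "pot c N (D \<inter> D') \<le> pot c N M" using mx(2)[of "D \<inter> D'"] CV by auto
    ultimately have "8 - 2*c - pot c N M \<le> pot c N U" using pot_supermod[OF CV(3,4)] unfolding U_def by linarith
    moreover have "pot c N U - 1 \<le> pot c N (insert a U)"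
      by (rule pot_add1[of _ _ v]) (use U z za V in auto)
    moreover have "pot c N (insert a U) - 1 \<le> pot c N (insert b (insert a U))"
      by (rule pot_add1[of _ _ a]) (use U V ne Nb in auto)
    moreover have "pot c N (insert b (insert a U)) - 1 \<le> pot c N (insert e (insert b (insert a U)))"
      by (rule pot_add1[of _ _ b]) (use U V ne ae y in auto)
    moreover have "pot c N (insert e (insert b (insert a U))) + 2*c - 1 \<le> pot c N (insert y (insert e (insert b (insert a U))))"
      by (rule pot_add2[of _ _ e y1]) (use U V ne ae y yV ye in auto)
    moreover have "pot c N (insert y (insert e (insert b (insert a U)))) < pot c N M"
      by (rule mx(1)) (use U V yV aM in auto)
    ultimately show False using M2 by linarith
  next
    assume o1: "c = 3 \<and> light N y1 \<and> (\<exists>y2. N y1 = {y, y2} \<and> \<not> light N y2 \<and> y2 \<noteq> y \<and>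
        (\<exists>C. C \<subseteq> V - {a, b, e, y, y1} \<and> y2 \<in> C \<and> 2 \<le> pot c N C))"
    then obtain y2 C where y2: "N y1 = {y, y2}" "\<not> light N y2" "y2 \<noteq> y" and
        C: "C \<subseteq> V - {a, b, e, y, y1}" "y2 \<in> C" "2 \<le> pot c N C" by blast
    have c3: "c = 3" and l1: "light N y1" using o1 by auto
    have y1y: "y1 \<noteq> y" using y irr by auto
    have Ny: "N y = {y1, e}" using y by auto
    have "N y1 = {y} \<or> (\<exists>v. N y1 = {y, v} \<and> \<not> light N v)" using y2 by auto
    from triple_side[OF tri[OF l1 y(1) le Ny y(5)] l1 y(1) le Ny yM y(5) this]
    obtain z z1 where z: "N e = {y, z}" "z \<noteq> y" "N z = {e, z1}" "z1 \<noteq> e" and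
      o2: "(\<not> light N z1) \<or> (c = 3 \<and> light N z1 \<and> (\<exists>y2. N z1 = {z, y2} \<and> \<not> light N y2 \<and> y2 \<noteq> z \<and>
        (\<exists>C. C \<subseteq> V - {y1, y, e, z, z1} \<and> y2 \<in> C \<and> 2 \<le> pot c N C)))" by metis
    have zb: "z = b" using z y by auto
    have z1: "z1 = a" using z zb Nb ae by auto
    have "\<exists>y2. N a = {b, y2} \<and> \<not> light N y2 \<and> y2 \<noteq> b \<and> (\<exists>C. C \<subseteq> V - {y1, y, e, b, a} \<and> y2 \<in> C \<and> 2 \<le> pot c N C)"
      using o2 la unfolding zb z1 by blast
    then obtain v C' where v: "N a = {b, v}" "v \<noteq> b" "\<not> light N v" and C': "C' \<subseteq> V - {y1, y, e, b, a}" "v \<in> C'" "2 \<le> pot c N C'"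
      by blast
    define U where "U = C \<union> C'"
    have U: "U \<subseteq> V" "a \<notin> U" "b \<notin> U" "e \<notin> U" "y \<notin> U" "y1 \<notin> U" "v \<in> U" "y2 \<in> U"
      using C C' by (auto simp: U_def)
    have yy1: "y \<in> N y1" using y2 by simp
    have y1n: "y1 \<noteq> a" "y1 \<noteq> b" "y1 \<noteq> e"
    proof -
      show "y1 \<noteq> a" using yy1 v y(1,3) by auto
      show "y1 \<noteq> b" using yy1 Nb y(6) ye by auto
      show "y1 \<noteq> e" by (rule y(5))
    qed
    \<comment> \<open>The union contributes at least 2, the vertices \<open>a\<close>,
      \<open>b\<close>, \<open>e\<close>, \<open>y\<close> cost 1 each, and closing at
      \<open>y1\<close> gains 5; the sum is 3.\<close>
    have "2 \<le> pot c N U" using pot_union_ge[OF sp, of C C'] C C' Diff_subset unfolding U_def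
      by (smt (verit) subset_trans)
    moreover have "pot c N U - 1 \<le> pot c N (insert a U)"
      by (rule pot_add1[of _ _ v]) (use U v V in auto)
    moreover have "pot c N (insert a U) - 1 \<le> pot c N (insert b (insert a U))"
      by (rule pot_add1[of _ _ a]) (use U V ne Nb in auto)
    moreover have "pot c N (insert b (insert a U)) - 1 \<le> pot c N (insert e (insert b (insert a U)))"
      by (rule pot_add1[of _ _ b]) (use U V ne ae y in auto)
    moreover have "pot c N (insert e (insert b (insert a U))) - 1 \<le> pot c N (insert y (insert e (insert b (insert a U))))"
      by (rule pot_add1[of _ _ e]) (use U V ne ae y yV ye in auto)
    moreover have "pot c N (insert y (insert e (insert b (insert a U)))) + 2*c - 1 \<le> pot c N (insert y1 (insert y (insert e (insert b (insert a U)))))"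
      by (rule pot_add2[of _ _ y y2]) (use U V ne ae y y2 yV ye y1n y1y in auto)
    moreover have "pot c N (insert y1 (insert y (insert e (insert b (insert a U))))) \<le> 2"
      by (rule sparseD[OF sp]) (use U V yV in auto)
    ultimately show False using c3 by linarith
  qed
qed

text \<open>By the two preceding lemmas each vertex of \<open>W\<close> has two neighbours, both
  again in \<open>W\<close>. So \<open>W\<close> is a union of cycles of light vertices, and
  deleting three consecutive vertices there harms no set outside.\<close>

lemma light_has_heavy:
  assumes "b \<in> V - M" "light N b" shows "\<exists>v\<in>N b. \<not> light N v"
proof (rule ccontr)
  assume n: "\<not> ?thesis"
  define W where "W = {b\<in>V - M. light N b \<and> (\<forall>v\<in>N b. light N v)}"
  have step: "\<exists>a e. N b = {a, e} \<and> a \<noteq> e \<and> a \<in> W \<and> e \<in> W" if b: "b \<in> W" for b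
  proof -
    have b': "b \<in> V - M" "light N b" "\<And>v. v \<in> N b \<Longrightarrow> light N v" using b by (auto simp: W_def)
    obtain a where a: "a \<in> N b" using no_isolated b' by blast
    have la: "light N a" using a b' by blast
    have bNa: "b \<in> N a" using a sym by blast
    have aM: "a \<in> V - M" using M_light'[OF a la b'(1)] .
    have N1: "N b \<noteq> {a}"
    proof
      assume Nb: "N b = {a}"
      consider "N a = {b}" | y where "y \<noteq> b" "N a = {b, y}" using light_cases[OF la bNa] by metis
      then show False
      proof cases
        case 1
        then show False using no_light_leaf[OF Nb la] by blast
      next
        case (2 y)
        show False
        proof (cases "light N y")
          case True
          show False by (rule no_light_triple_end[OF b'(2) la True 2(2)]) (use 2 aM Nb in auto)
        next
          case False
          then show False using no_light_leaf[OF Nb la] 2 by blast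
        qed
      qed
    qed
    then obtain e where e: "e \<noteq> a" "N b = {a, e}" using light_cases[OF b'(2) a] by metis
    have inW: "z \<in> W" if z: "z \<in> {a, e}" for z
    proof -
      obtain w where w: "N b = {z, w}" "z \<noteq> w" using z e by blast
      have lz: "light N z" "light N w" using b'(3) w by auto
      have zb: "b \<in> N z" using w sym by auto
      have zM: "z \<in> V - M" using M_light'[OF _ lz(1) b'(1)] w by auto
      have nz: "\<not> (N z = {b} \<or> (\<exists>v. N z = {b, v} \<and> \<not> light N v))"
        using no_light_triple_end[OF lz(1) b'(2) lz(2) w] b'(1) by blast
      then obtain v where "N z = {b, v}" "light N v" using light_cases[OF lz(1) zb] by metis
      then show ?thesis using lz zM b' by (auto simp: W_def)
    qed
    show ?thesis using e inW by (intro exI[of _ a] exI[of _ e]) auto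
  qed
  have bW: "b \<in> W" using assms n by (auto simp: W_def)
  obtain a e where ae: "N b = {a, e}" "a \<noteq> e" "a \<in> W" "e \<in> W" using step[OF bW] by blast
  have cl: "N w \<subseteq> W" if "w \<in> W" for w using step[OF that] by auto
  have WV: "W \<subseteq> V" "\<And>w. w \<in> W \<Longrightarrow> light N w" by (auto simp: W_def)
  have ne: "a \<noteq> b" "b \<noteq> e" using ae irr[of b] by auto
  have i: "b \<in> N a" "b \<in> N e" using ae sym by auto
  have "card (N a - {a,e,b}) \<le> card (N a - {b})" "card (N e - {a,e,b}) \<le> card (N e - {b})" by (auto intro: card_mono)
  then have "card (N a - {a,e,b}) \<le> 1" "card (N e - {a,e,b}) \<le> 1" using i WV(2)[OF ae(3)] WV(2)[OF ae(4)] by (auto simp: light_def)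
  then have "\<not> sparse c (V - {a,e,b}) (del {a,e,b} N)"
    by (intro remove_three_not_sparse) (use ae ne bW WV in auto)
  then obtain A where A: "bad {a,e,b} A" by (rule not_sparse_bad)
  have AW: "A \<inter> (W - {a,e,b}) = {}"
  proof (rule badD(7)[OF A])
    show "W - {a,e,b} \<subseteq> V - {a,e,b}" using WV by auto
  next
    fix w assume w: "w \<in> W - {a,e,b}"
    have "card (N w - {a,e,b}) \<le> card (N w)" by (rule card_mono) auto
    then show "card (N w - {a,e,b}) \<le> 2" using w WV(2)[of w] by (auto simp: light_def)
    show "N w - {a,e,b} \<subseteq> W - {a,e,b}" using cl w by auto
  qed
  have "loss {a,e,b} N u = 0" if "u \<in> A" for u
  proof (rule loss_0)
    show us: "u \<notin> {a,e,b}" using that badD(1)[OF A] by auto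
    then have uW: "u \<notin> W" using AW that by auto
    show "N u \<inter> {a,e,b} = {}" using cl[OF ae(3)] cl[OF ae(4)] cl[OF bW] uW sym[of a u] sym[of e u] sym[of b u] by auto
  qed
  then show False using bad_not_sparse_loss[OF sp A] by blast
qed

end

section \<open>Reducible configurations\<close>

definition add_edge :: "'a \<Rightarrow> 'a \<Rightarrow> ('a \<Rightarrow> 'a set) \<Rightarrow> 'a \<Rightarrow> 'a set" where
  "add_edge x y N v = (if v = x then insert y (N v) else if v = y then insert x (N v) else N v)"

context nbr_graph
begin

lemma add_edge_graph:
  assumes "x \<in> V" "y \<in> V" "x \<noteq> y" shows "nbr_graph V (add_edge x y N) c"
  by unfold_locales (use fin sub sym irr c23 assms in \<open>auto simp: add_edge_def split: if_splits\<close>)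

text \<open>The edge gains 2c when both ends lie in \<open>A\<close>, and each end in
  \<open>A\<close> of degree at most 1 gives up a missing half-edge worth c. If both ends have
  degree at most 1, no potential rises.\<close>

lemma pot_add_edge:
  assumes "x \<noteq> y" "y \<notin> N x" "A \<subseteq> V"
  shows "pot c (add_edge x y N) A = pot c N A + (if x \<in> A \<and> y \<in> A then 2*c else 0)
    - c * (if x \<in> A \<and> card (N x) \<le> 1 then 1 else 0) - c * (if y \<in> A \<and> card (N y) \<le> 1 then 1 else 0)"
proof -
  have fA: "finite A" using assms finV by blast
  have yx: "x \<notin> N y" using assms sym by blast
  define N' where "N' = add_edge x y N"
  have d1: "defect N' x = defect N x - (if card (N x) \<le> 1 then 1 else 0)"
    using assms by (simp add: N'_def add_edge_def defect_def)
  have d2: "defect N' y = defect N y - (if card (N y) \<le> 1 then 1 else 0)"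
    using assms yx by (simp add: N'_def add_edge_def defect_def)
  have d3: "defect N' v = defect N v" if "v \<noteq> x" "v \<noteq> y" for v
    using that by (simp add: N'_def add_edge_def defect_def)
  have c1: "int (card (N' x \<inter> A)) = int (card (N x \<inter> A)) + (if y \<in> A then 1 else 0)"
    using assms by (simp add: N'_def add_edge_def Int_insert_left)
  have c2: "int (card (N' y \<inter> A)) = int (card (N y \<inter> A)) + (if x \<in> A then 1 else 0)"
    using assms yx by (simp add: N'_def add_edge_def Int_insert_left)
  have c3: "N' v \<inter> A = N v \<inter> A" if "v \<noteq> x" "v \<noteq> y" for v using that by (simp add: N'_def add_edge_def)
  have "pot c N' A = (\<Sum>v\<in>A. (c * (int (card (N v \<inter> A)) + defect N v) - (2 * c + 1))
      + ((if v = x then c * ((if y \<in> A then 1 else 0) - (if card (N x) \<le> 1 then 1 else 0)) else 0)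
      + (if v = y then c * ((if x \<in> A then 1 else 0) - (if card (N y) \<le> 1 then 1 else 0)) else 0)))"
    unfolding pot_def
  proof (rule sum.cong)
    fix v
    consider "v = x" | "v = y" "v \<noteq> x" | "v \<noteq> x" "v \<noteq> y" by blast
    then show "c * (int (card (N' v \<inter> A)) + defect N' v) - (2 * c + 1) =
      c * (int (card (N v \<inter> A)) + defect N v) - (2 * c + 1)
      + ((if v = x then c * ((if y \<in> A then 1 else 0) - (if card (N x) \<le> 1 then 1 else 0)) else 0)
      + (if v = y then c * ((if x \<in> A then 1 else 0) - (if card (N y) \<le> 1 then 1 else 0)) else 0))"
    proof cases
      case 1
      then show ?thesis using assms(1) by (simp add: c1 d1 algebra_simps)
    next
      case 2
      then show ?thesis by (simp add: c2 d2 algebra_simps)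
    next
      case 3
      then show ?thesis by (simp add: c3 d3)
    qed
  qed simp
  also have "\<dots> = pot c N A + ((if x \<in> A then c * ((if y \<in> A then 1 else 0) - (if card (N x) \<le> 1 then 1 else 0)) else 0)
      + (if y \<in> A then c * ((if x \<in> A then 1 else 0) - (if card (N y) \<le> 1 then 1 else 0)) else 0))"
    unfolding sum.distrib pot_def using fA by simp
  finally show ?thesis unfolding N'_def by auto
qed

text \<open>No charge outside \<open>S\<close> increases, since light vertices stay at -1, and each
  vertex of \<open>X\<close> drops by at least c.\<close>

lemma pot_del_V:
  assumes "S \<subseteq> V" "X \<subseteq> V - S" "\<And>x. x \<in> X \<Longrightarrow> \<not> light N x \<and> N x \<inter> S \<noteq> {}"
  shows "pot c (del S N) (V - S) \<le> pot c N V - (\<Sum>v\<in>S. charge v) - c * int (card X)"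
proof -
  interpret D: nbr_graph "V - S" "del S N" c by (rule del_graph)
  have le: "D.charge u + (if u \<in> X then c else 0) \<le> charge u" if "u \<in> V - S" for u
  proof (cases "u \<in> X")
    case True
    have "0 < card (N u \<inter> S)" using assms(3)[OF True] by (simp add: card_gt_0_iff)
    then have "card (N u - S) < card (N u)" using card_split[of u S] by linarith
    moreover have "3 \<le> card (N u)" using assms(3)[OF True] heavy_ge3 by blast
    ultimately have "max (int (card (del S N u))) 2 + 1 \<le> max (int (card (N u))) 2"
      using that by (simp add: del_def)
    then have "c * (max (int (card (del S N u))) 2 + 1) \<le> c * max (int (card (N u))) 2" using c23 by auto
    then show ?thesis using True D.charge_def[of u] charge_def[of u] by (simp add: algebra_simps)
  next
    case False
    have "card (del S N u) \<le> card (N u)" by (rule card_mono) (auto simp: del_def)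
    then have "c * max (int (card (del S N u))) 2 \<le> c * max (int (card (N u))) 2" using c23 by auto
    then show ?thesis using False D.charge_def[of u] charge_def[of u] by simp
  qed
  have "pot c (del S N) (V - S) + c * int (card X) = (\<Sum>u\<in>V - S. D.charge u) + (\<Sum>u\<in>V - S. if u \<in> X then c else 0)"
    using assms(2) fin by (simp add: D.pot_total sum.If_cases Int_absorb1)
  also have "\<dots> \<le> (\<Sum>u\<in>V - S. charge u)" unfolding sum.distrib[symmetric] by (rule sum_mono) (rule le)
  also have "\<dots> = pot c N V - (\<Sum>v\<in>S. charge v)"
    using pot_total sum.subset_diff[OF assms(1) fin, of charge] by simp
  finally show ?thesis by simp
qed

end

section \<open>Configurations around a heavy vertex outside \<open>M\<close>\<close>

context irreducible_graph
begin

text \<open>After the deletion \<open>x\<close> is attached by one edge only, so removing it from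
  the bad set, which has potential at least 3 - c in the original graph, gains 1.\<close>

lemma bad_single:
  assumes A: "bad S A" and x: "x \<in> A" "x \<in> V" "2 \<le> card (N x)"
    and L: "(\<Sum>u\<in>A. loss S N u) \<le> 1" and d: "card (N x - S) \<le> 1"
  obtains w where "N x - S = {w}" "w \<in> A" "w \<noteq> x" "4 - c \<le> pot c N (A - {x})"
proof -
  have AV: "A \<subseteq> V" "A \<inter> S = {}" using badD(1)[OF A] by auto
  have "N x - S \<noteq> {}" using badD(4)[OF A x(1)] .
  then have "card (N x - S) = 1" using d by (metis One_nat_def Suc_leI card_gt_0_iff finN finite_Diff le_antisym)
  then obtain w where w: "N x - S = {w}" by (auto simp: card_1_singleton_iff)
  then have wA: "w \<in> A" using badD(3)[OF A x(1)] by auto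
  have "N x \<inter> A = {w}" using w wA AV by auto
  moreover have "c * (\<Sum>u\<in>A. loss S N u) \<le> c" using L c23 by auto
  then have "3 - c \<le> pot c N A" using badD(2)[OF A] by linarith
  ultimately have "4 - c \<le> pot c N (A - {x})"
    using pot_remove[OF AV(1) x(1)] x(3) by (simp add: defect_def)
  moreover have "w \<noteq> x" using w irr by auto
  ultimately show ?thesis using that w wA by blast
qed

lemma loss_card_bound:
  assumes "A \<subseteq> V - S" "\<And>u. u \<in> A \<Longrightarrow> u \<notin> J \<Longrightarrow> loss S N u = 0" "\<And>u. u \<in> J \<Longrightarrow> u \<in> A \<Longrightarrow> loss S N u \<le> 1"
  shows "(\<Sum>u\<in>A. loss S N u) \<le> int (card (A \<inter> J))"
proof -
  have "finite A" using assms(1) finV by blast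
  then have "(\<Sum>u\<in>A. loss S N u) = (\<Sum>u\<in>A \<inter> J. loss S N u)" by (rule loss_sum_restrict) (use assms in auto)
  also have "\<dots> \<le> (\<Sum>u\<in>A \<inter> J. 1)" by (rule sum_mono) (use assms in auto)
  finally show ?thesis by simp
qed

text \<open>In a bad set only light neighbours of \<open>v\<close> lose something, one half-edge
  each. With \<open>j\<close> >= 1 of them, putting back \<open>v\<close>, \<open>a\<close>,
  \<open>b\<close> gives 3 - cj + 2cj - (2c + 1) - 1 + (2c - 1) = cj >= 2, too much for a set
  containing \<open>v\<close>.\<close>

lemma no_light_triangle:
  assumes v: "v \<in> V - M" and a: "a \<in> N v" "light N a" and b: "b \<in> N v" "light N b" "b \<in> N a"
    and d: "card (N v) \<le> (if c = 3 then 4 else 5)"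
  shows False
proof -
  have V: "v \<in> V" "a \<in> V" "b \<in> V" using v a b inV by blast+
  have ne: "v \<noteq> a" "v \<noteq> b" "a \<noteq> b" using a b irr by auto
  have Na: "N a = {v, b}" using light_two[OF a(2) _ b(3)] a(1) sym ne by blast
  have Nb: "N b = {v, a}" using light_two[OF b(2), of v a] b(1,3) sym ne by blast
  define S where "S = {v, a, b}"
  have "N v - S = N v - {a, b}" using irr by (auto simp: S_def)
  moreover have "card (N v - {a,b}) = card (N v) - 2" using a b ne by (simp add: card_Diff_subset)
  ultimately have ov: "card (N v - S) \<le> (if c = 3 then 2 else 3)" using d by (auto split: if_splits)
  have oa: "N a - S = {}" using Na by (auto simp: S_def)
  have "\<not> sparse c (V - S) (del S N)"
  proof -
    have "card (N a - S) \<le> 1" unfolding oa by simp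
    moreover have "N b \<subseteq> S" using Nb by (simp add: S_def)
    ultimately show ?thesis unfolding S_def using remove_three_not_sparse[of v a b] ne V ov[unfolded S_def] by (simp add: S_def)
  qed
  then obtain A where A: "bad S A" by (rule not_sparse_bad)
  have AV: "A \<subseteq> V - S" "A \<subseteq> V" using badD(1)[OF A] by auto
  define J where "J = {u \<in> N v. light N u}"
  have NS: "N u \<inter> S \<subseteq> {v}" if "u \<in> A" for u
    using that AV sym[of a u] sym[of b u] Na Nb by (auto simp: S_def)
  have "(\<Sum>u\<in>A. loss S N u) \<le> int (card (A \<inter> J))"
  proof (rule loss_card_bound[OF AV(1)])
    fix u assume u: "u \<in> A" "u \<notin> J"
    show "loss S N u = 0"
    proof (cases "light N u")
      case True
      then have "v \<notin> N u" using u sym[of v u] by (auto simp: J_def)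
      then show ?thesis using NS[OF u(1)] u AV by (intro loss_0) auto
    next
      case False
      then show ?thesis using NS[OF u(1)] u AV by (intro two_heavy_nbrs_loss) auto
    qed
  next
    fix u assume u: "u \<in> J" "u \<in> A"
    have "card (N u \<inter> S) \<le> card {v}" by (rule card_mono) (use NS u in auto)
    moreover have "loss S N u \<le> int (card (N u \<inter> S))" by (rule loss_le) (use u AV in auto)
    ultimately show "loss S N u \<le> 1" by simp
  qed
  moreover have "0 < (\<Sum>u\<in>A. loss S N u)" by (rule bad_loss_pos[OF sp A])
  ultimately have j: "1 \<le> int (card (A \<inter> J))" and sl: "(\<Sum>u\<in>A. loss S N u) \<le> int (card (A \<inter> J))" by linarith+
  define j where "j = int (card (A \<inter> J))"
  have "c * (\<Sum>u\<in>A. loss S N u) \<le> c * j" using sl c23 by (auto simp: j_def)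
  then have "3 \<le> pot c N A + c * j" using badD(2)[OF A] by linarith
  moreover have "pot c N A + 2*c*j - (2*c+1) \<le> pot c N (insert v A)"
    unfolding j_def by (rule pot_addn) (use AV V in \<open>auto simp: J_def S_def\<close>)
  moreover have "pot c N (insert v A) - 1 \<le> pot c N (insert a (insert v A))"
    by (rule pot_add1[of _ _ v]) (use AV V Na ne in \<open>auto simp: S_def\<close>)
  moreover have "pot c N (insert a (insert v A)) + 2*c - 1 \<le> pot c N (insert b (insert a (insert v A)))"
    by (rule pot_add2[of _ _ v a]) (use AV V Nb ne in \<open>auto simp: S_def\<close>)
  moreover have "pot c N (insert b (insert a (insert v A))) \<le> 1"
    by (rule pot_outside_le1) (use AV V v in auto)
  moreover have "c * 1 \<le> c * j" using c23 j by (auto simp: j_def)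
  moreover have "2*c*j = c*j + c*j" by simp
  ultimately show False using c23 by linarith
qed

text \<open>Let \<open>y\<close> be the heavy neighbour of \<open>b\<close> and \<open>j\<close> the
  number of light neighbours of \<open>v\<close> in the bad set. If \<open>y\<close> lies in the bad
  set and is adjacent to \<open>v\<close>, putting back \<open>v\<close>, \<open>a\<close>,
  \<open>b\<close> gives at least c (j + 1). Otherwise \<open>y\<close> loses nothing: for j >= 2
  putting back \<open>v\<close> alone suffices, and for j = 1 the single loser is removed. What
  remains has potential at least 4 - c, so for c = 2 it lies in \<open>M\<close> although
  \<open>nM\<close> keeps the neighbours of the loser out of \<open>M\<close>; in the other case it
  is positive.\<close>

lemma no_light_pair_at:
  assumes v: "v \<in> V - M" and a: "a \<in> N v" "light N a" and b: "light N b" "b \<in> N a" "b \<notin> N v"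
    and hv: "\<not> light N v" and d: "card (N v) \<le> (if c = 3 then 3 else 4)"
    and nM: "\<And>u. u \<in> N v \<Longrightarrow> light N u \<Longrightarrow> N u \<inter> M = {}"
    and cc: "c = 2 \<or> (\<forall>A\<subseteq>V. pot c N A \<le> 0)"
  shows False
proof -
  have V: "v \<in> V" "a \<in> V" "b \<in> V" using v a b inV by blast+
  have ne: "v \<noteq> a" "v \<noteq> b" "a \<noteq> b" using a b irr hv by auto
  have vNa: "v \<in> N a" using a(1) sym by blast
  have Na: "N a = {v, b}" using light_two[OF a(2) vNa b(2) ne(2)] .
  have aM: "a \<in> V - M" using M_light'[OF a(1,2) v] .
  have bM: "b \<in> V - M" using M_light'[OF b(2,1) aM] .
  obtain y where y: "y \<in> N b" "\<not> light N y" using light_has_heavy[OF bM b(1)] by blast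
  have aNb: "a \<in> N b" using b(2) sym by blast
  have yn: "y \<noteq> a" "y \<noteq> b" "y \<noteq> v" using y a b irr sym[of v b] by auto
  have Nb: "N b = {a, y}" using light_two[OF b(1) aNb y(1)] yn by auto
  have yV: "y \<in> V" using y inV by blast
  define S where "S = {v, b, a}"
  have "card (N v - S) \<le> card (N v - {a})" by (rule card_mono) (auto simp: S_def)
  moreover have "card (N v - {a}) = card (N v) - 1" using a by simp
  ultimately have ov: "card (N v - S) \<le> (if c = 3 then 2 else 3)" using d by (auto split: if_splits)
  have "card (N b - S) \<le> card {y}" by (rule card_mono) (use Nb in \<open>auto simp: S_def\<close>)
  then have ob: "card (N b - S) \<le> 1" by simp
  have "\<not> sparse c (V - S) (del S N)"
  proof -
    have "N a \<subseteq> S" using Na by (simp add: S_def)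
    then show ?thesis unfolding S_def using remove_three_not_sparse[of v b a] ne V ov[unfolded S_def] ob[unfolded S_def] by (simp add: S_def)
  qed
  then obtain A where A: "bad S A" by (rule not_sparse_bad)
  have AV: "A \<subseteq> V - S" "A \<subseteq> V" using badD(1)[OF A] by auto
  define J where "J = {u \<in> N v. light N u}"
  have NS: "N u \<inter> S \<subseteq> {v, b}" if "u \<in> A" for u
    using that AV sym[of a u] Na by (auto simp: S_def)
  have NS': "N u \<inter> S \<subseteq> {v}" if "u \<in> A" "u \<noteq> y" for u
    using NS[OF that(1)] that(2) AV sym[of b u] Nb that(1) by (auto simp: S_def)
  have out: "loss S N u = 0" if u: "u \<in> A" "u \<notin> J" "u \<noteq> y" for u
  proof (cases "light N u")
    case True
    then have "v \<notin> N u" using u sym[of v u] by (auto simp: J_def)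
    then show ?thesis using NS'[OF u(1,3)] u AV by (intro loss_0) auto
  next
    case False
    then show ?thesis using NS'[OF u(1,3)] u AV by (intro two_heavy_nbrs_loss) auto
  qed
  have yJ: "y \<notin> J" using y by (auto simp: J_def)
  have one: "loss S N u \<le> 1" if u: "u \<in> J" "u \<in> A" for u
  proof -
    have "u \<noteq> y" using u yJ by auto
    then have "card (N u \<inter> S) \<le> card {v}" by (intro card_mono) (use NS' u in auto)
    moreover have "loss S N u \<le> int (card (N u \<inter> S))" by (rule loss_le) (use u AV in auto)
    ultimately show ?thesis by simp
  qed
  define j where "j = int (card (A \<inter> J))"
  have j0: "0 \<le> j" by (simp add: j_def)
  have jj: "2*c*j = c*j + c*j" by simp
  show False
  proof (cases "y \<in> A \<and> y \<in> N v")
    case True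
    have "card (N y \<inter> S) \<le> card {v, b}" by (rule card_mono) (use NS True in auto)
    then have "loss S N y \<le> 1" using loss_heavy_le[of y S] y True AV ne by auto
    then have "(\<Sum>u\<in>A. loss S N u) \<le> int (card (A \<inter> insert y J))"
      by (intro loss_card_bound[OF AV(1)]) (use out one in auto)
    also have c1: "card (A \<inter> insert y J) = card (A \<inter> J) + 1"
      using True yJ finV[OF AV(2)] by (simp add: Int_insert_right)
    finally have "c * (\<Sum>u\<in>A. loss S N u) \<le> c * (j + 1)" using c23 by (auto simp: j_def)
    then have "3 \<le> pot c N A + c * (j + 1)" using badD(2)[OF A] by linarith
    moreover have "pot c N A + 2*c*int (card (A \<inter> insert y J)) - (2*c+1) \<le> pot c N (insert v A)"
      by (rule pot_addn) (use AV V True in \<open>auto simp: J_def S_def\<close>)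
    then have "pot c N A + 2*c*(j + 1) - (2*c+1) \<le> pot c N (insert v A)" unfolding c1 j_def by (simp add: add.commute)
    moreover have "pot c N (insert v A) - 1 \<le> pot c N (insert a (insert v A))"
      by (rule pot_add1[of _ _ v]) (use AV V Na ne in \<open>auto simp: S_def\<close>)
    moreover have "pot c N (insert a (insert v A)) + 2*c - 1 \<le> pot c N (insert b (insert a (insert v A)))"
      by (rule pot_add2[of _ _ a y]) (use AV V Nb ne yn True in \<open>auto simp: S_def\<close>)
    moreover have "pot c N (insert b (insert a (insert v A))) \<le> 1"
      by (rule pot_outside_le1) (use AV V v in auto)
    moreover have "0 \<le> c * j" using c23 j0 by auto
    moreover have "2*c*(j+1) = c*j + c*j + 2*c" "c*(j+1) = c*j + c" by (simp_all add: algebra_simps)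
    ultimately show False using c23 by linarith
  next
    case False
    have ly: "loss S N y = 0" if "y \<in> A"
    proof -
      have "N y \<inter> S \<subseteq> {b}" using NS[OF that] False that sym[of v y] by auto
      then show ?thesis using y that AV by (intro two_heavy_nbrs_loss) auto
    qed
    have sl: "(\<Sum>u\<in>A. loss S N u) \<le> j" unfolding j_def
      by (rule loss_card_bound[OF AV(1)]) (use out one ly in blast)+
    then have "c * (\<Sum>u\<in>A. loss S N u) \<le> c * j" using c23 by auto
    then have pA: "3 \<le> pot c N A + c * j" using badD(2)[OF A] by linarith
    have "0 < j" using sl bad_loss_pos[OF sp A] by linarith
    then consider "j = 1" | "2 \<le> j" by linarith
    then show False
    proof cases
      case 2
      have "pot c N A + 2*c*j - (2*c+1) \<le> pot c N (insert v A)"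
        unfolding j_def by (rule pot_addn) (use AV V in \<open>auto simp: J_def S_def\<close>)
      moreover have "pot c N (insert v A) \<le> 1"
        by (rule pot_outside_le1) (use AV V v in auto)
      moreover have "2 * c \<le> c * j" using c23 2 by auto
      ultimately show False using pA jj by linarith
    next
      case 1
      then have "card (A \<inter> J) = 1" by (simp add: j_def)
      then obtain x where x: "A \<inter> J = {x}" by (auto simp: card_1_singleton_iff)
      then have xx: "x \<in> A" "x \<in> N v" "light N x" by (auto simp: J_def)
      have vx: "v \<in> N x" using xx sym by blast
      have "N x - S \<noteq> {}" using badD(4)[OF A xx(1)] .
      then have "N x \<noteq> {v}" by (auto simp: S_def)
      then obtain w where w: "w \<noteq> v" "N x = {v, w}" using light_cases[OF xx(3) vx] by metis
      have "card (N x - S) \<le> card {w}" by (rule card_mono) (use w in \<open>auto simp: S_def\<close>)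
      then have "card (N x - S) \<le> 1" by simp
      moreover have "2 \<le> card (N x)" using w by simp
      ultimately obtain w' where w': "N x - S = {w'}" "w' \<in> A" "w' \<noteq> x" "4 - c \<le> pot c N (A - {x})"
        using bad_single[OF A xx(1) inV(1)[OF xx(2)]] sl 1 by metis
      have sub: "A - {x} \<subseteq> V" using AV by auto
      have wN: "w' \<in> N x" using w'(1) by blast
      from cc show False
      proof
        assume "c = 2"
        then have "A - {x} \<subseteq> M" using pot_outside_le1[OF sub] w'(4) by force
        then have "w' \<in> N x \<inter> M" using w'(2,3) wN by auto
        then show False using nM[OF xx(2,3)] by auto
      next
        assume "\<forall>A\<subseteq>V. pot c N A \<le> 0"
        then have "pot c N (A - {x}) \<le> 0" using sub by blast
        then show False using w'(4) c23 by auto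
      qed
    qed
  qed
qed

text \<open>After deleting \<open>v, b, a\<close> the other two neighbours of \<open>v\<close> are joined by an edge. Compared with the path through \<open>v\<close> this raises the
  potential of a set by only 1.\<close>

lemma no_star_of_lights_3:
  assumes c3: "c = 3" and v: "v \<in> V - M" and d: "card (N v) = 3" and lv: "\<And>u. u \<in> N v \<Longrightarrow> light N u"
    and a: "a \<in> N v" and b: "light N b" "b \<in> N a" and nt: "\<And>p q. p \<in> N v \<Longrightarrow> q \<in> N v \<Longrightarrow> q \<notin> N p"
  shows False
proof -
  have hv: "\<not> light N v" using d by (simp add: light_def)
  have la: "light N a" using lv a by blast
  have V: "v \<in> V" "a \<in> V" "b \<in> V" using v a b inV by blast+
  have bv: "b \<notin> N v" using nt[OF a] b by blast
  have ne: "v \<noteq> a" "v \<noteq> b" "a \<noteq> b" using a b irr hv by auto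
  have vNa: "v \<in> N a" using a sym by blast
  have Na: "N a = {v, b}" using light_two[OF la vNa b(2) ne(2)] .
  have aM: "a \<in> V - M" using M_light'[OF a la v] .
  have bM: "b \<in> V - M" using M_light'[OF b(2,1) aM] .
  obtain y where y: "y \<in> N b" "\<not> light N y" using light_has_heavy[OF bM b(1)] by blast
  have aNb: "a \<in> N b" using b(2) sym by blast
  have yn: "y \<noteq> a" "y \<noteq> b" "y \<noteq> v" using y la irr sym[of v b] bv b by auto
  have Nb: "N b = {a, y}" using light_two[OF b(1) aNb y(1)] yn by auto
  have "card (N v - {a}) = 2" using d a by simp
  then obtain p q where pq: "N v - {a} = {p, q}" "p \<noteq> q" by (auto simp: card_2_iff)
  then have Nv: "N v = {a, p, q}" "p \<noteq> a" "q \<noteq> a" using a by auto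
  define S where "S = {v, b, a}"
  have pN: "p \<in> N v" "q \<in> N v" using Nv by auto
  have pqS: "p \<in> V - S" "q \<in> V - S" using pN bv irr inV Nv by (auto simp: S_def)
  interpret D: nbr_graph "V - S" "del S N" c by (rule del_graph)
  define N' where "N' = add_edge p q (del S N)"
  have g: "nbr_graph (V - S) N' c" unfolding N'_def by (rule D.add_edge_graph[OF pqS pq(2)])
  have qp: "q \<notin> del S N p" using nt[OF pN] pqS by (auto simp: del_def)
  have cd: "card (del S N u) \<le> 1" if "u \<in> {p, q}" for u
  proof -
    have "light N u" "v \<in> N u" using that lv pN sym by blast+
    then have "card (N u - {v}) \<le> 1" by (simp add: light_def)
    moreover have "card (del S N u) \<le> card (N u - {v})" by (rule card_mono) (auto simp: del_def S_def)
    ultimately show ?thesis by linarith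
  qed
  have NS: "N u \<inter> S \<subseteq> {b}" if "u \<in> V - S" "u \<notin> {p, q}" for u
    using that sym[of a u] sym[of v u] Na Nv by (auto simp: S_def)
  have out: "loss S N u = 0" if u: "u \<in> V - S" "u \<notin> {p, q}" for u
  proof (cases "u = y")
    case True
    then show ?thesis using NS[OF u] u y by (intro two_heavy_nbrs_loss) auto
  next
    case False
    then have "b \<notin> N u" using sym[of b u] Nb u by (auto simp: S_def)
    then show ?thesis using NS[OF u] u by (intro loss_0) auto
  qed
  have one: "loss S N u \<le> 1" if "u \<in> {p, q}" for u
  proof -
    have us: "u \<notin> S" "u \<in> N v" using that pqS pN by auto
    have "b \<notin> N u" using sym[of b u] Nb us y lv[OF us(2)] pqS that Nv by auto
    moreover have "a \<notin> N u" using nt[OF us(2) a] .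
    ultimately have "card (N u \<inter> S) \<le> card {v}" by (intro card_mono) (auto simp: S_def)
    then show ?thesis using loss_le[OF us(1)] by simp
  qed
  have "sparse c (V - S) N'"
    unfolding sparse_def
  proof (intro allI impI)
    fix A assume A: "A \<subseteq> V - S"
    have fA: "finite A" using A finV by blast
    have AV: "A \<subseteq> V" using A by auto
    have "(\<Sum>u\<in>A. loss S N u) \<le> int (card (A \<inter> {p, q}))"
      by (rule loss_card_bound[OF A]) (use out one A in auto)
    also have "int (card (A \<inter> {p, q})) = (if p \<in> A then 1 else 0) + (if q \<in> A then 1 else 0)"
      using pq(2) by (auto simp: Int_insert_right)
    finally have "pot c (del S N) A \<le> pot c N A + c * ((if p \<in> A then 1 else 0) + (if q \<in> A then 1 else 0))"
      using pot_del[OF A] c3 by simp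
    \<comment> \<open>The half-edges that \<open>p\<close> and \<open>q\<close> lose by the deletion
      are filled again by the new edge, so only its 2c remain.\<close>
    then have e: "pot c N' A \<le> pot c N A + (if p \<in> A \<and> q \<in> A then 2*c else 0)"
      unfolding N'_def D.pot_add_edge[OF pq(2) qp A] using cd c3 by auto
    show "pot c N' A \<le> 2"
    proof (cases "p \<in> A \<and> q \<in> A")
      case True
      \<comment> \<open>The path through \<open>v\<close> gains 2c - 1 and ends at no more than 1,
        because \<open>v\<close> is outside \<open>M\<close>; hence \<open>A\<close> has room for
        the 2c of the new edge.\<close>
      have "pot c N A + 2*c - 1 \<le> pot c N (insert v A)"
        by (rule pot_add2[of _ _ p q]) (use True A V pN pq in \<open>auto simp: S_def\<close>)
      moreover have "pot c N (insert v A) \<le> 1" by (rule pot_outside_le1) (use AV v in auto)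
      ultimately show ?thesis using e True by simp
    next
      case False
      then have "pot c N' A \<le> pot c N A" using e by auto
      also have "\<dots> \<le> 2" using sparseD[OF sp AV] .
      finally show ?thesis .
    qed
  qed
  then have ic: "in_class c (V - S) N'" using c3 by (simp add: in_class_def)
  have "card (N v - S) \<le> card (N v - {a})" by (rule card_mono) (auto simp: S_def)
  then have ov: "card (N v - S) \<le> 2" using \<open>card (N v - {a}) = 2\<close> by simp
  have "card (N b - S) \<le> card {y}" by (rule card_mono) (use Nb in \<open>auto simp: S_def\<close>)
  then have ob: "card (N b - S) \<le> 1" by simp
  have oa: "N a - S = {}" using Na by (auto simp: S_def)
  have gr: "greedy 3 N S 0 [v, b, a]" using ov ob by (simp add: oa)
  have set: "set [v, b, a] = S" by (simp add: S_def)
  have "reducible" unfolding reducible_def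
  proof (intro exI[of _ "[v, b, a]"] exI[of _ N'] conjI)
    show "distinct [v, b, a]" using ne by auto
    show "\<forall>u. del (set [v, b, a]) N u \<subseteq> N' u" unfolding set N'_def by (auto simp: add_edge_def)
  qed (use V gr c3 g ic set in \<open>auto simp: kof_def\<close>)
  then show False using irred by blast
qed

text \<open>For c = 2 a block must also leave potential at most 0. By \<open>pot_del_V\<close> it
  suffices that its charges, together with 2 for each heavy vertex of \<open>X\<close>, add up to
  something nonnegative.\<close>

lemma remove_four_not_sparse:
  assumes c2: "c = 2" and us: "distinct us" "set us = S" "length us = 4" "S \<subseteq> V" "greedy 4 N S 0 us"
    and X: "X \<subseteq> V - S" "\<And>x. x \<in> X \<Longrightarrow> \<not> light N x \<and> N x \<inter> S \<noteq> {}"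
    and w: "0 \<le> (\<Sum>v\<in>S. charge v) + 2 * int (card X)"
  shows "\<not> sparse c (V - S) (del S N)"
proof
  assume "sparse c (V - S) (del S N)"
  moreover have "pot c (del S N) (V - S) \<le> 0" using pot_del_V[OF us(4) X] w p0 c2 by simp
  ultimately have "reducible"
    by (intro reducibleI[of us]) (use us c2 in \<open>auto simp: kof_def in_class_def\<close>)
  then show False using irred by blast
qed

text \<open>In a tidy graph the two vertices would be adjacent, and \<open>x\<close> would be a
  light vertex without heavy neighbour.\<close>

lemma leaf_unique:
  assumes "x \<in> V - M" "y \<in> V - M" "card (N x) \<le> 1" "card (N y) \<le> 1" shows "x = y"
proof (rule ccontr)
  assume ne: "x \<noteq> y"
  then have y: "y \<in> N x" using td assms unfolding tidy_def by auto
  have "light N x" "light N y" using assms by (auto simp: light_def)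
  moreover have "N x = {y}" using y assms(3) by (metis card_le_Suc0_iff_eq finN One_nat_def insertI1 empty_iff insertE subsetI subset_antisym)
  ultimately show False using light_has_heavy[OF assms(1)] by auto
qed

text \<open>Two blocks are tried. Deleting \<open>v\<close> with its neighbours can be blocked only
  by a heavy \<open>y\<close> that shares two of them, \<open>s\<close> and \<open>t\<close>, and
  whose only other surviving neighbour \<open>e\<close> lies in \<open>M\<close>. Then the 4-cycle
  \<open>y\<close>, \<open>v\<close>, \<open>s\<close>, \<open>t\<close> is deleted; this could be
  blocked only by the third neighbour of \<open>v\<close>, which would need a neighbour in
  \<open>M\<close>.\<close>

lemma no_claw_of_single_lights:
  assumes c2: "c = 2" and v: "v \<in> V - M" and d: "card (N v) = 3" and lv: "\<And>u. u \<in> N v \<Longrightarrow> light N u"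
    and nM: "\<And>u. u \<in> N v \<Longrightarrow> N u \<inter> M = {}" and nl: "\<And>u w. u \<in> N v \<Longrightarrow> w \<in> N u \<Longrightarrow> \<not> light N w"
  shows False
proof -
  have hv: "\<not> light N v" using d by (simp add: light_def)
  have wv: "charge v = 1" using charge_heavy[OF hv] d c2 by simp
  have vV: "v \<in> V" using v by simp
  obtain p q r where pqr: "N v = {p, q, r}" "p \<noteq> q" "p \<noteq> r" "q \<noteq> r" using d by (auto simp: card_3_iff)
  have V: "p \<in> V" "q \<in> V" "r \<in> V" using pqr inV by blast+
  have uM: "u \<in> V - M" if "u \<in> N v" for u using M_light'[OF that lv[OF that] v] .
  have vn: "v \<notin> N v" by (rule irr)
  define S where "S = insert v (N v)"
  have SV: "S \<subseteq> V" using vV sub by (auto simp: S_def)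
  have vu: "v \<in> N u" if "u \<in> N v" for u using that sym by blast
  have nn: "N u \<inter> N v = {}" if "u \<in> N v" for u using nl[OF that] lv by blast
  have o: "card (N u - S) \<le> 1" if "u \<in> N v" for u
  proof -
    have "card (N u - S) \<le> card (N u - {v})" by (rule card_mono) (auto simp: S_def)
    also have "\<dots> \<le> 1" using vu[OF that] lv[OF that] by (simp add: light_def)
    finally show ?thesis .
  qed
  have set: "set [p, q, r, v] = S" using pqr by (auto simp: S_def)
  have v0: "N v - S = {}" by (auto simp: S_def)
  have "card (N p - S) \<le> 1" "card (N q - S) \<le> 1" "card (N r - S) \<le> 1" using o pqr(1) by blast+
  moreover have "card (N v - S) = 0" using v0 by simp
  ultimately have gr: "greedy 4 N S 0 [p, q, r, v]" by simp
  have wS: "(\<Sum>u\<in>S. charge u) = -2"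
  proof -
    have "(\<Sum>u\<in>S. charge u) = charge v + (\<Sum>u\<in>N v. charge u)" unfolding S_def using vn by simp
    also have "(\<Sum>u\<in>N v. charge u) = (\<Sum>u\<in>N v. -1)" by (rule sum.cong) (use charge_light lv in auto)
    finally show ?thesis using wv d by simp
  qed
  \<comment> \<open>The block has charge 1 - 3 = -2, so some heavy vertex outside has to lose an
    edge. At most one of \<open>p\<close>, \<open>q\<close> is a leaf, and the other one leads to
    such a vertex.\<close>
  have "\<exists>u\<in>{p, q}. 2 \<le> card (N u)"
  proof (rule ccontr)
    assume "\<not> ?thesis"
    then have "card (N p) \<le> 1" "card (N q) \<le> 1" by auto
    then show False using leaf_unique[of p q] uM pqr by auto
  qed
  then obtain u0 where u0: "u0 \<in> N v" "2 \<le> card (N u0)" using pqr by auto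
  have "N u0 \<noteq> {v}" using u0 by auto
  then obtain w where w: "w \<noteq> v" "N u0 = {v, w}" using light_cases[OF lv[OF u0(1)] vu[OF u0(1)]] by metis
  have hw: "\<not> light N w" using nl[OF u0(1)] w by blast
  have "w \<notin> N v" using hw lv by blast
  moreover have "u0 \<in> N w" using w sym by blast
  ultimately have X: "{w} \<subseteq> V - S" "\<And>x. x \<in> {w} \<Longrightarrow> \<not> light N x \<and> N x \<inter> S \<noteq> {}"
    using w u0 hw inV by (auto simp: S_def)
  have "\<not> sparse c (V - S) (del S N)"
    by (rule remove_four_not_sparse[OF c2 _ set _ SV gr X]) (use pqr vn wS in auto)
  then obtain A where A: "bad S A" by (rule not_sparse_bad)
  have AV: "A \<subseteq> V - S" "A \<subseteq> V" using badD(1)[OF A] by auto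
  have hyA: "\<not> light N u \<and> N u \<inter> S = N u \<inter> N v" if "u \<in> A" "loss S N u \<noteq> 0" for u
  proof -
    have u: "u \<notin> S" using that AV by auto
    then have "v \<notin> N u" using sym[of v u] by (auto simp: S_def)
    then have e: "N u \<inter> S = N u \<inter> N v" by (auto simp: S_def)
    moreover have "N u \<inter> S \<noteq> {}" using loss_0[of u S] that u by blast
    ultimately obtain x where "x \<in> N u" "x \<in> N v" by blast
    then have "\<not> light N u" using nl sym by blast
    then show ?thesis using e by blast
  qed
  obtain y where y: "y \<in> A" "loss S N y \<noteq> 0" using bad_not_sparse_loss[OF sp A] by blast
  have hy: "\<not> light N y" and ey: "N y \<inter> S = N y \<inter> N v" using hyA[OF y] by auto
  have yS: "y \<notin> S" "y \<in> V" using y AV by auto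
  have two: "2 \<le> card (N y \<inter> N v)"
  proof (rule ccontr)
    assume "\<not> ?thesis"
    then have "card (N y \<inter> S) \<le> 1" using ey by simp
    then show False using loss_heavy1[OF yS(1) hy] y by blast
  qed
  then have "\<not> N y \<inter> N v \<subseteq> {}" "N y \<inter> N v \<noteq> {}" by auto
  obtain s t where st: "s \<in> N y" "s \<in> N v" "t \<in> N y" "t \<in> N v" "s \<noteq> t"
  proof -
    have "\<not> (\<forall>s\<in>N y \<inter> N v. \<forall>t\<in>N y \<inter> N v. s = t)"
      using two card_le_Suc0_iff_eq[of "N y \<inter> N v"] by auto
    then show ?thesis using that by blast
  qed
  have yv: "y \<noteq> v" using yS by (auto simp: S_def)
  have "y \<in> N s" "y \<in> N t" using st sym by blast+
  then have Nst: "N s = {v, y}" "N t = {v, y}"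
    using light_two[OF lv[OF st(2)] vu[OF st(2)]] light_two[OF lv[OF st(4)] vu[OF st(4)]] yv by blast+
  have lab: "loss S N u = 0" if "u \<in> A" "u \<noteq> y" for u
  proof (rule ccontr)
    assume l: "loss S N u \<noteq> 0"
    have h: "\<not> light N u" "N u \<inter> S = N u \<inter> N v" using hyA[OF that(1) l] by auto
    have "s \<notin> N u" "t \<notin> N u" using sym[of s u] sym[of t u] Nst that AV by (auto simp: S_def)
    then have "card (N u \<inter> N v) \<le> card (N v - {s, t})" by (intro card_mono) auto
    also have "card (N v - {s, t}) = 1" using d st by (simp add: card_Diff_subset)
    finally show False using loss_heavy1[of u S] h l that AV by auto
  qed
  have "(\<Sum>u\<in>A. loss S N u) = (\<Sum>u\<in>A \<inter> {y}. loss S N u)"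
    by (rule loss_sum_restrict) (use lab finV AV in auto)
  then have sy: "(\<Sum>u\<in>A. loss S N u) = loss S N y" using y by simp
  have "N y - S \<noteq> {}" using badD(4)[OF A y(1)] .
  then have ne1: "1 \<le> card (N y - S)" by (simp add: Suc_leI card_gt_0_iff)
  have ny: "card (N y - S) \<le> 1" using loss_ge2[OF yS(1)] y(2) by fastforce
  have "defect (del S N) y \<le> 1" using ne1 yS by (simp add: defect_def del_def)
  then have l1: "loss S N y \<le> 1" by (simp add: loss_def defect_def)
  obtain e where e: "N y - S = {e}" "e \<in> A" "e \<noteq> y" "4 - c \<le> pot c N (A - {y})"
    by (rule bad_single[OF A y(1) yS(2)]) (use heavy_ge3[OF hy] sy l1 ny in auto)
  have "A - {y} \<subseteq> V" using AV by auto
  then have "A - {y} \<subseteq> M" using pot_outside_le1[of "A - {y}"] e(4) c2 by force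
  then have eM: "e \<in> M" using e by auto
  have yM: "y \<notin> M" using nM[OF st(2)] st(1) sym by blast
  have eNy: "e \<in> N y" using e by blast
  have he: "\<not> light N e" using M_light[OF eM] eNy sym yM by blast
  \<comment> \<open>The charges of \<open>s\<close> and \<open>t\<close> are -1, that of
    \<open>v\<close> is 1 and that of \<open>y\<close> at least 1, so the rest keeps potential at
    most 0. The vertex \<open>e\<close> is heavy because it lies in \<open>M\<close> and
    \<open>y\<close> does not, so it loses no half-edge.\<close>
  define T where "T = {v, y, s, t}"
  have distT: "distinct [y, v, s, t]" using yv st hy lv hv by auto
  have TV: "T \<subseteq> V" using yS vV st inV by (auto simp: T_def)
  have setT: "set [y, v, s, t] = T" by (auto simp: T_def)
  have oy: "card (N y - T) \<le> 2"
  proof -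
    have "N y - T \<subseteq> (N y - S) \<union> (N v - {s, t})" using ey by (auto simp: T_def S_def)
    then have "card (N y - T) \<le> card ((N y - S) \<union> (N v - {s,t}))" by (rule card_mono[rotated]) auto
    also have "\<dots> \<le> card (N y - S) + card (N v - {s,t})" by (rule card_Un_le)
    also have "card (N v - {s, t}) = 1" using d st by (simp add: card_Diff_subset)
    finally show ?thesis using ny by simp
  qed
  have "card (N v - T) \<le> card (N v - {s, t})" by (rule card_mono) (auto simp: T_def)
  also have "card (N v - {s, t}) = 1" using d st by (simp add: card_Diff_subset)
  finally have ov: "card (N v - T) \<le> 1" .
  have ost: "N s - T = {}" "N t - T = {}" using Nst by (auto simp: T_def)
  have grT: "greedy 4 N T 0 [y, v, s, t]" using oy ov by (simp add: ost)
  have "charge s = -1" "charge t = -1" using charge_light lv st by auto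
  moreover have "(\<Sum>u\<in>T. charge u) = charge y + charge v + charge s + charge t" using distT unfolding T_def by (auto simp: insert_commute)
  ultimately have wT: "0 \<le> (\<Sum>u\<in>T. charge u) + 2 * int (card ({}::'a set))" using wv charge_heavy_ge[OF hy] by simp
  have "\<not> sparse c (V - T) (del T N)"
    by (rule remove_four_not_sparse[OF c2 distT setT _ TV grT _ _ wT]) auto
  then obtain B where B: "bad T B" by (rule not_sparse_bad)
  have BV: "B \<subseteq> V - T" "B \<subseteq> V" using badD(1)[OF B] by auto
  obtain z where z: "z \<in> B" "loss T N z \<noteq> 0" using bad_not_sparse_loss[OF sp B] by blast
  have zT: "z \<notin> T" "z \<in> V" using z BV by auto
  have only: "u \<in> N v - {s, t}" if u: "u \<in> B" "loss T N u \<noteq> 0" for u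
  proof (rule ccontr)
    assume n: "u \<notin> N v - {s, t}"
    have uT: "u \<notin> T" using u BV by auto
    have "v \<notin> N u" "s \<notin> N u" "t \<notin> N u"
      using n sym[of v u] sym[of s u] sym[of t u] Nst uT by (auto simp: T_def)
    then have sub: "N u \<inter> T \<subseteq> {y}" by (auto simp: T_def)
    have "y \<in> N u" using loss_0[OF _ uT] sub u by blast
    then have uN: "u \<in> N y" using sym by blast
    then have "u = e" using e n uT ey by (auto simp: T_def S_def)
    then show False using two_heavy_nbrs_loss[of u T y] he sub uT u by blast
  qed
  have z1: "N v - {s, t} = {z}"
  proof -
    have "card (N v - {s, t}) = 1" using d st by (simp add: card_Diff_subset)
    then obtain z' where z': "N v - {s, t} = {z'}" by (rule card_1_singletonE)
    have "z \<in> {z'}" using only[OF z] unfolding z' .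
    then show ?thesis using z' by simp
  qed
  then have zN: "z \<in> N v" by blast
  have lz: "light N z" using lv zN by blast
  have "(\<Sum>u\<in>B. loss T N u) = (\<Sum>u\<in>B \<inter> {z}. loss T N u)"
    by (rule loss_sum_restrict) (use only z1 finV BV in auto)
  then have sz: "(\<Sum>u\<in>B. loss T N u) = loss T N z" using z by simp
  have "N z - T \<noteq> {}" using badD(4)[OF B z(1)] .
  then obtain u where u: "u \<in> N z" "u \<notin> T" by blast
  have uv: "u \<noteq> v" using u by (auto simp: T_def)
  then have Nz: "N z = {v, u}" using light_two[OF lz vu[OF zN] u(1)] by blast
  have nz: "N z - T = {u}" "N z \<inter> T = {v}" using Nz u by (auto simp: T_def)
  have lz1: "loss T N z \<le> 1" using loss_le[OF zT(1)] nz by simp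
  obtain u' where u': "N z - T = {u'}" "u' \<in> B" "u' \<noteq> z" "4 - c \<le> pot c N (B - {z})"
    by (rule bad_single[OF B z(1) zT(2)]) (use nz Nz uv sz lz1 in auto)
  have "B - {z} \<subseteq> V" using BV by auto
  then have "B - {z} \<subseteq> M" using pot_outside_le1[of "B - {z}"] u'(4) c2 by force
  then have "u' \<in> N z \<inter> M" using u' by auto
  then show False using nM[OF zN] by blast
qed

text \<open>The block \<open>y\<close>, \<open>v\<close>, \<open>x'\<close>, \<open>x\<close> has
  total charge 0. As no potential is positive, a bad set loses at least two half-edges. The only
  light loser is \<open>u\<close>; a heavy loser is adjacent to two of \<open>v\<close>,
  \<open>y\<close>, \<open>x'\<close>, and two such vertices would share one of these three, which
  has just one heavy neighbour in the bad set. So the losers are \<open>u\<close> and one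
  \<open>h\<close>, the bad set has potential at least -1, and the block put back brings six edges:
  24 - 20 = 4.\<close>

lemma no_double_star:
  assumes c2: "c = 2" and all0: "\<forall>A\<subseteq>V. pot c N A \<le> 0"
    and Nv: "N v = {x, x', g}" "x \<noteq> x'" "x \<noteq> g" "x' \<noteq> g" and lx: "light N x" "light N x'" and hg: "\<not> light N g"
    and Nx: "N x = {v, y}" and Ny: "N y = {x, u, g'}" "x \<noteq> u" "x \<noteq> g'" "u \<noteq> g'" and lu: "light N u" and hg': "\<not> light N g'"
    and nl: "\<And>w. w \<in> N x' \<Longrightarrow> \<not> light N w" "\<And>w. w \<in> N u \<Longrightarrow> \<not> light N w"
    and yv: "y \<noteq> v"
  shows False
proof -
  have V: "v \<in> V" "x \<in> V" "x' \<in> V" "g \<in> V" "y \<in> V" "u \<in> V" "g' \<in> V" using Nv Nx Ny inV by blast+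
  have d: "card (N v) = 3" "card (N y) = 3" using Nv Ny by auto
  have hv: "\<not> light N v" "\<not> light N y" using d by (auto simp: light_def)
  have xg: "x' \<noteq> y" "x' \<noteq> v" "x \<noteq> y" "x \<noteq> v" "u \<noteq> v" "u \<noteq> y" using lx lu hv by auto
  define S where "S = {y, v, x', x}"
  have dist: "distinct [y, v, x', x]" using yv xg Nv by auto
  have SV: "S \<subseteq> V" using V by (auto simp: S_def)
  have set: "set [y, v, x', x] = S" by (auto simp: S_def)
  have "card (N y - S) \<le> card {u, g'}" by (rule card_mono) (use Ny in \<open>auto simp: S_def\<close>)
  then have oy: "card (N y - S) \<le> 2" using Ny by simp
  have "card (N v - S) \<le> card {g}" by (rule card_mono) (use Nv in \<open>auto simp: S_def\<close>)
  then have ov: "card (N v - S) \<le> 1" by simp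
  have vx': "v \<in> N x'" using Nv sym by auto
  have "card (N x' - S) \<le> card (N x' - {v})" by (rule card_mono) (auto simp: S_def)
  also have "\<dots> \<le> 1" using vx' lx by (simp add: light_def)
  finally have ox': "card (N x' - S) \<le> 1" .
  have ox: "N x - S = {}" using Nx by (auto simp: S_def)
  have gr: "greedy 4 N S 0 [y, v, x', x]" using oy ov ox' by (simp add: ox)
  have "charge y = 1" "charge v = 1" "charge x = -1" "charge x' = -1" using charge_heavy hv d charge_light lx c2 by auto
  moreover have "(\<Sum>u\<in>S. charge u) = charge y + charge v + charge x' + charge x" using dist unfolding S_def by auto
  ultimately have wS: "0 \<le> (\<Sum>u\<in>S. charge u) + 2 * int (card ({}::'a set))" by simp
  have "\<not> sparse c (V - S) (del S N)"
    by (rule remove_four_not_sparse[OF c2 dist set _ SV gr _ _ wS]) auto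
  then obtain A where A: "bad S A" by (rule not_sparse_bad)
  have AV: "A \<subseteq> V - S" "A \<subseteq> V" using badD(1)[OF A] by auto
  have pA: "pot c N A \<le> 0" using all0 AV by blast
  have l2: "2 \<le> (\<Sum>w\<in>A. loss S N w)" using badD(2)[OF A] pA unfolding c2 by linarith
  have xn: "x \<notin> N w" if "w \<in> A" for w using that sym[of x w] Nx AV by (auto simp: S_def)
  have NwS: "N w \<inter> S \<subseteq> {v, y, x'}" if "w \<in> A" for w using xn[OF that] by (auto simp: S_def)
  have wv: "v \<in> N w \<Longrightarrow> w = g" if "w \<in> A" for w using sym[of v w] Nv that AV by (auto simp: S_def)
  have wy: "y \<in> N w \<Longrightarrow> w = u \<or> w = g'" if "w \<in> A" for w using sym[of y w] Ny that AV by (auto simp: S_def)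
  have wx': "x' \<in> N w \<Longrightarrow> \<not> light N w" for w using nl(1) sym by blast
  have hl1: "loss S N h \<le> 1" if "h \<in> A" for h
  proof -
    have "N h - S \<noteq> {}" using badD(4)[OF A that] .
    then have "1 \<le> card (N h - S)" by (simp add: Suc_leI card_gt_0_iff)
    moreover have "h \<notin> S" using that AV by auto
    ultimately have "defect (del S N) h \<le> 1" by (simp add: defect_def del_def)
    then show ?thesis by (simp add: loss_def defect_def)
  qed
  have heavy2: "\<exists>p\<in>{v, y, x'}. N h \<inter> S \<subseteq> {v, y, x'} \<and> {v,y,x'} - {p} \<subseteq> N h" if h: "h \<in> A" "\<not> light N h" "loss S N h \<noteq> 0" for h
  proof -
    have hS: "h \<notin> S" using h AV by auto
    have "\<not> N h \<inter> S \<subseteq> {v}" "\<not> N h \<inter> S \<subseteq> {y}" "\<not> N h \<inter> S \<subseteq> {x'}"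
      using two_heavy_nbrs_loss[OF h(2) hS] h(3) by blast+
    then show ?thesis using NwS[OF h(1)] by blast
  qed
  have light1: "w = u" if "w \<in> A" "light N w" "loss S N w \<noteq> 0" for w
  proof -
    have wS: "w \<notin> S" using that AV by auto
    have "N w \<inter> S \<noteq> {}" using loss_0[OF _ wS] that by blast
    moreover have "v \<notin> N w" using wv[OF that(1)] hg that by blast
    moreover have "x' \<notin> N w" using wx' that by blast
    ultimately have "y \<in> N w" using NwS[OF that(1)] by blast
    then show ?thesis using wy[OF that(1)] hg' that by blast
  qed
  have uniq: "h = h'" if h: "h \<in> A" "\<not> light N h" "loss S N h \<noteq> 0" and h': "h' \<in> A" "\<not> light N h'" "loss S N h' \<noteq> 0" for h h'
  proof -
    obtain p where p: "p\<in>{v, y, x'}" "{v,y,x'} - {p} \<subseteq> N h" using heavy2[OF h] by blast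
    obtain p' where p': "p'\<in>{v, y, x'}" "{v,y,x'} - {p'} \<subseteq> N h'" using heavy2[OF h'] by blast
    have x2: "x' \<in> N h \<Longrightarrow> x' \<in> N h' \<Longrightarrow> h = h'"
    proof -
      assume "x' \<in> N h" "x' \<in> N h'"
      then have i: "h \<in> N x'" "h' \<in> N x'" using sym by blast+
      have "v \<noteq> h" "v \<noteq> h'" using h h' AV by (auto simp: S_def)
      then have "N x' = {v, h}" using light_two[OF lx(2) vx' i(1)] by blast
      then show "h = h'" using i \<open>v \<noteq> h'\<close> by auto
    qed
    have v2: "v \<in> N h \<Longrightarrow> v \<in> N h' \<Longrightarrow> h = h'" using wv h h' by blast
    have y2: "y \<in> N h \<Longrightarrow> y \<in> N h' \<Longrightarrow> h = h'" using wy h h' lu by blast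
    have "(v \<in> N h \<and> v \<in> N h') \<or> (y \<in> N h \<and> y \<in> N h') \<or> (x' \<in> N h \<and> x' \<in> N h')"
      using p p' yv xg dist by auto
    then show ?thesis using x2 v2 y2 by blast
  qed
  define J where "J = {w\<in>A. loss S N w \<noteq> 0}"
  have fJ: "finite J" using AV finV by (auto simp: J_def)
  have "(\<Sum>w\<in>A. loss S N w) \<le> int (card (A \<inter> J))"
    by (rule loss_card_bound[OF AV(1)]) (use hl1 in \<open>auto simp: J_def\<close>)
  also have "A \<inter> J = J" by (auto simp: J_def)
  finally have J2: "2 \<le> card J" and sJ: "(\<Sum>w\<in>A. loss S N w) \<le> int (card J)" using l2 by linarith+
  have "\<exists>h\<in>J. h \<noteq> u"
  proof (rule ccontr)
    assume "\<not> ?thesis"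
    then have "J \<subseteq> {u}" by blast
    then have "card J \<le> card {u}" by (rule card_mono[rotated]) simp
    then show False using J2 by simp
  qed
  then obtain h where h: "h \<in> J" "h \<noteq> u" by blast
  then have hh: "h \<in> A" "\<not> light N h" "loss S N h \<noteq> 0" using light1 by (auto simp: J_def)
  have Juh: "J \<subseteq> {u, h}"
  proof
    fix w assume w: "w \<in> J"
    then have "w \<in> A" "loss S N w \<noteq> 0" by (auto simp: J_def)
    then show "w \<in> {u, h}" using light1 uniq[OF _ _ _ hh] by blast
  qed
  then have "card J \<le> card {u, h}" by (rule card_mono[rotated]) simp
  then have cJ: "card J \<le> 2" using card_insert_le_m1[of 2 "{h}" u] by simp
  have uJ: "u \<in> J"
  proof (rule ccontr)
    assume "u \<notin> J"
    then have "J \<subseteq> {h}" using Juh by blast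
    then have "card J \<le> card {h}" by (rule card_mono[rotated]) simp
    then show False using J2 by simp
  qed
  have uA: "u \<in> A" using uJ by (simp add: J_def)
  have "(\<Sum>w\<in>A. loss S N w) \<le> 2" using sJ cJ by linarith
  then have lo: "-1 \<le> pot c N A" using badD(2)[OF A] unfolding c2 by linarith
  have nS: "y \<notin> A" "v \<notin> A" "x' \<notin> A" "x \<notin> A" using AV by (auto simp: S_def)
  obtain p where p: "p\<in>{v, y, x'}" "{v,y,x'} - {p} \<subseteq> N h" using heavy2[OF hh] by blast
  have hi: "w \<in> N h \<Longrightarrow> h \<in> N w" for w using sym by blast
  have "pot c N A + 4 \<le> pot c N (insert x (insert v (insert x' (insert y A))))"
  proof -
    consider "p = x'" | "p = y" | "p = v" using p by blast
    then show ?thesis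
    proof cases
      case 1
      then have i: "h \<in> N v" "h \<in> N y" using p hi dist by auto
      have "pot c N A + 2*c - 1 \<le> pot c N (insert y A)"
        by (rule pot_add2[of _ _ u h]) (use AV V nS i Ny uA hh h in auto)
      moreover have "pot c N (insert y A) - 1 \<le> pot c N (insert v (insert y A))"
        by (rule pot_add1[of _ _ h]) (use AV V nS i hh yv in auto)
      moreover have "pot c N (insert v (insert y A)) - 1 \<le> pot c N (insert x' (insert v (insert y A)))"
        by (rule pot_add1[of _ _ v]) (use AV V nS vx' xg in auto)
      moreover have "pot c N (insert x' (insert v (insert y A))) + 2*c - 1 \<le> pot c N (insert x (insert x' (insert v (insert y A))))"
        by (rule pot_add2[of _ _ v y]) (use AV V nS Nx xg yv Nv in auto)
      moreover have "insert x (insert x' (insert v (insert y A))) = insert x (insert v (insert x' (insert y A)))" by auto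
      ultimately show ?thesis using c2 by simp
    next
      case 2
      then have i: "h \<in> N v" "h \<in> N x'" using p hi dist by auto
      have "pot c N A - 1 \<le> pot c N (insert y A)"
        by (rule pot_add1[of _ _ u]) (use AV V nS i Ny uA in auto)
      moreover have "pot c N (insert y A) - 1 \<le> pot c N (insert v (insert y A))"
        by (rule pot_add1[of _ _ h]) (use AV V nS i hh yv in auto)
      moreover have "pot c N (insert v (insert y A)) + 2*c - 1 \<le> pot c N (insert x' (insert v (insert y A)))"
        by (rule pot_add2[of _ _ v h]) (use AV V nS vx' xg i hh in auto)
      moreover have "pot c N (insert x' (insert v (insert y A))) + 2*c - 1 \<le> pot c N (insert x (insert x' (insert v (insert y A))))"
        by (rule pot_add2[of _ _ v y]) (use AV V nS Nx xg yv Nv in auto)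
      moreover have "insert x (insert x' (insert v (insert y A))) = insert x (insert v (insert x' (insert y A)))" by auto
      ultimately show ?thesis using c2 by simp
    next
      case 3
      then have i: "h \<in> N y" "h \<in> N x'" using p hi dist by auto
      have "pot c N A + 2*c - 1 \<le> pot c N (insert y A)"
        by (rule pot_add2[of _ _ u h]) (use AV V nS i Ny uA hh h in auto)
      moreover have "pot c N (insert y A) - 1 \<le> pot c N (insert x' (insert y A))"
        by (rule pot_add1[of _ _ h]) (use AV V nS i hh xg in auto)
      moreover have "pot c N (insert x' (insert y A)) - 1 \<le> pot c N (insert v (insert x' (insert y A)))"
        by (rule pot_add1[of _ _ x']) (use AV V nS Nv xg yv in auto)
      moreover have "pot c N (insert v (insert x' (insert y A))) + 2*c - 1 \<le> pot c N (insert x (insert v (insert x' (insert y A))))"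
        by (rule pot_add2[of _ _ v y]) (use AV V nS Nx xg yv Nv in auto)
      ultimately show ?thesis using c2 by simp
    qed
  qed
  moreover have "insert x (insert v (insert x' (insert y A))) \<subseteq> V" using AV V by auto
  then have "pot c N (insert x (insert v (insert x' (insert y A)))) \<le> 0" using all0 by blast
  ultimately show False using lo by linarith
qed

text \<open>The block consists of \<open>v\<close>, two neighbours \<open>a\<close>,
  \<open>a'\<close> and the partner \<open>b\<close> of \<open>a\<close>, with charge 5 - 3 = 2. Any
  other neighbour of \<open>v\<close> keeps one light neighbour only, and for c = 2 a minimal bad
  set has no such vertex. So only the partner of \<open>a'\<close> can lose a half-edge; this is
  worth 2 and cannot lift a nonpositive potential to 3.\<close>

lemma no_five_star:
  assumes c2: "c = 2" and all0: "\<forall>A\<subseteq>V. pot c N A \<le> 0" and Me: "M = {}"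
    and d: "card (N v) = 5" and lv: "\<And>u. u \<in> N v \<Longrightarrow> light N u" and lp: "\<And>u. u \<in> N v \<Longrightarrow> \<exists>w\<in>N u. light N w"
    and vV: "v \<in> V"
  shows False
proof -
  have hv: "\<not> light N v" using d by (simp add: light_def)
  have partner: "\<exists>b. N a = {v, b} \<and> b \<noteq> v \<and> light N b \<and> b \<notin> N v \<and> (\<exists>y. N b = {a, y} \<and> \<not> light N y \<and> y \<noteq> v)" if a: "a \<in> N v" for a
  proof -
    obtain b where b: "b \<in> N a" "light N b" using lp[OF a] by blast
    have bv: "b \<noteq> v" using b hv by auto
    have va: "v \<in> N a" using a sym by blast
    have Na: "N a = {v, b}" using light_two[OF lv[OF a] va b(1)] bv by auto
    have bn: "b \<notin> N v"
      using no_light_triangle[of v a b] a lv b vV d c2 Me by auto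
    have aV: "b \<in> V - M" using Me b inV by blast
    obtain y where y: "y \<in> N b" "\<not> light N y" using light_has_heavy[OF aV b(2)] by blast
    have ab: "a \<in> N b" using b sym by blast
    have "a \<noteq> y" using y lv[OF a] by auto
    then have "N b = {a, y}" using light_two[OF b(2) ab y(1)] by blast
    moreover have "y \<noteq> v" using bn y sym by blast
    ultimately show ?thesis using Na bv b bn y by blast
  qed
  have "N v \<noteq> {}" using d by auto
  then obtain a where a: "a \<in> N v" by blast
  have "card (N v - {a}) = 4" using d a by simp
  then have "N v - {a} \<noteq> {}" by (metis card.empty zero_neq_numeral)
  then obtain a' where a': "a' \<in> N v" "a' \<noteq> a" by blast
  obtain b y where b: "N a = {v, b}" "b \<noteq> v" "light N b" "b \<notin> N v" "N b = {a, y}" "\<not> light N y" "y \<noteq> v" using partner[OF a] by blast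
  obtain b' y' where b': "N a' = {v, b'}" "b' \<noteq> v" "light N b'" "b' \<notin> N v" "N b' = {a', y'}" "\<not> light N y'" "y' \<noteq> v" using partner[OF a'(1)] by blast
  have V: "a \<in> V" "a' \<in> V" "b \<in> V" "b' \<in> V" using a a' b b' inV by blast+
  have la: "light N a" "light N a'" using lv a a' by auto
  have bb: "b \<noteq> b'"
  proof
    assume "b = b'"
    then have "a' \<in> {a, y}" using b b' by auto
    then show False using a' b la by auto
  qed
  have dist: "distinct [v, a', b, a]" using a a' b irr[of v] by auto
  define S where "S = {v, a', b, a}"
  have SV: "S \<subseteq> V" using V vV by (auto simp: S_def)
  have set: "set [v, a', b, a] = S" by (auto simp: S_def)
  have "card (N v - S) \<le> card (N v - {a, a'})" by (rule card_mono) (auto simp: S_def)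
  also have "\<dots> = 3" using d a a' by (simp add: card_Diff_subset)
  finally have ov: "card (N v - S) \<le> 3" .
  have "card (N a' - S) \<le> card {b'}" by (rule card_mono) (use b' in \<open>auto simp: S_def\<close>)
  then have oa': "card (N a' - S) \<le> 1" by simp
  have "card (N b - S) \<le> card {y}" by (rule card_mono) (use b in \<open>auto simp: S_def\<close>)
  then have ob: "card (N b - S) \<le> 1" by simp
  have oa: "N a - S = {}" using b by (auto simp: S_def)
  have gr: "greedy 4 N S 0 [v, a', b, a]" using ov oa' ob by (simp add: oa)
  have "charge v = 5" "charge a = -1" "charge a' = -1" "charge b = -1" using charge_heavy hv d charge_light la b c2 by auto
  moreover have "(\<Sum>u\<in>S. charge u) = charge v + charge a' + charge b + charge a" using dist unfolding S_def by auto
  ultimately have wS: "0 \<le> (\<Sum>u\<in>S. charge u) + 2 * int (card ({}::'a set))" by simp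
  have "\<not> sparse c (V - S) (del S N)"
    by (rule remove_four_not_sparse[OF c2 dist set _ SV gr _ _ wS]) auto
  then obtain A where A: "bad S A" by (rule not_sparse_bad)
  have AV: "A \<subseteq> V - S" "A \<subseteq> V" using badD(1)[OF A] by auto
  have pA: "pot c N A \<le> 0" using all0 AV by blast
  have out: "loss S N w = 0" if w: "w \<in> A" "w \<noteq> b'" for w
  proof -
    have wS: "w \<notin> S" using w AV by auto
    have an: "a \<notin> N w" "a' \<notin> N w" using sym[of a w] sym[of a' w] b b' wS w by (auto simp: S_def)
    have wN: "w \<notin> N v"
    proof
      assume wv: "w \<in> N v"
      obtain b2 y2 where b2: "N w = {v, b2}" "b2 \<noteq> v" "light N b2" "b2 \<notin> N v" "N b2 = {w, y2}" "\<not> light N y2" using partner[OF wv] by blast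
      have "b2 \<noteq> b"
      proof
        assume "b2 = b"
        then have "w \<in> {a, y}" using b2 b by auto
        then show False using b(6) lv[OF wv] wS by (auto simp: S_def)
      qed
      then have "b2 \<notin> S" using b2 a a' by (auto simp: S_def)
      then have e: "N w - S = {b2}" using b2 by (auto simp: S_def)
      have "card (N b2 - S) \<le> card (N b2)" by (rule card_mono) auto
      then have "card (N b2 - S) \<le> 2" using b2(3) by (simp add: light_def)
      then have "c = 3" using badD(5)[OF A w(1) e] by blast
      then show False using c2 by simp
    qed
    then have "v \<notin> N w" using sym by blast
    then have sub: "N w \<inter> S \<subseteq> {b}" using an by (auto simp: S_def)
    show ?thesis
    proof (cases "b \<in> N w")
      case True
      then have "w \<in> N b" using sym by blast
      then have "w = y" using b wS by (auto simp: S_def)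
      then show ?thesis using two_heavy_nbrs_loss[of w S b] b wS sub by blast
    next
      case False
      then show ?thesis using sub wS by (intro loss_0) auto
    qed
  qed
  have "(\<Sum>w\<in>A. loss S N w) \<le> int (card (A \<inter> {b'}))"
  proof (rule loss_card_bound[OF AV(1)])
    fix w assume w: "w \<in> {b'}" "w \<in> A"
    have "y' \<noteq> b" using b' b by auto
    then have "card (N w \<inter> S) \<le> card {a'}" by (intro card_mono) (use w b' la in \<open>auto simp: S_def\<close>)
    then show "loss S N w \<le> 1" using loss_le[of w S] w AV by auto
  qed (use out in auto)
  also have "card (A \<inter> {b'}) \<le> card {b'}" by (rule card_mono) auto
  finally have "(\<Sum>w\<in>A. loss S N w) \<le> 1" by simp
  then show False using badD(2)[OF A] pA unfolding c2 by linarith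
qed

section \<open>Discharging\<close>

text \<open>All charges are doubled. A light vertex has charge \<open>-2\<close>; it receives \<open>paid x\<close> from each of its heavy neighbours outside \<open>M\<close>, while a
  neighbour in \<open>M\<close> gives it \<open>2c\<close>.\<close>

definition paid :: "'a \<Rightarrow> int" where
  "paid x = (if N x \<inter> M \<noteq> {} then -2 else if \<exists>y\<in>N x. light N y then 2 else 1)"

definition heavies :: "'a set" where "heavies = {v\<in>V - M. \<not> light N v}"
definition lights :: "'a set" where "lights = {v\<in>V - M. light N v}"

definition final_charge :: "'a \<Rightarrow> int" where
  "final_charge v = 2 * (charge v + c * int (card (N v \<inter> M))) - (\<Sum>x\<in>N v \<inter> lights. paid x)"

text \<open>After the transfers every light vertex outside \<open>M\<close> is nonnegative, except
  that a leaf may end at -1; hence the last term.\<close>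

lemma discharge:
  "(\<Sum>v\<in>heavies. final_charge v) \<le> 2 * (pot c N V - pot c N M) + int (card {x\<in>lights. card (N x) = 1})"
proof -
  have f: "finite heavies" "finite lights" using fin by (auto simp: heavies_def lights_def)
  have HL: "V - M = heavies \<union> lights" "heavies \<inter> lights = {}" by (auto simp: heavies_def lights_def)
  define f2 where "f2 = (\<lambda>v. 2 * (charge v + c * int (card (N v \<inter> M))))"
  have tot: "2 * (pot c N V - pot c N M) = (\<Sum>v\<in>heavies. f2 v) + (\<Sum>v\<in>lights. f2 v)"
    unfolding pot_diff[OF MV(1)] HL(1) sum.union_disjoint[OF f HL(2)] f2_def by (simp add: sum_distrib_left)
  have sw: "(\<Sum>v\<in>heavies. \<Sum>x\<in>N v \<inter> lights. paid x) = (\<Sum>x\<in>lights. paid x * int (card (N x \<inter> heavies)))"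
  proof -
    have "(\<Sum>v\<in>heavies. \<Sum>x\<in>N v \<inter> lights. paid x) = (\<Sum>v\<in>heavies. \<Sum>x\<in>lights. if x \<in> N v then paid x else 0)"
    proof (rule sum.cong)
      fix v
      show "(\<Sum>x\<in>N v \<inter> lights. paid x) = (\<Sum>x\<in>lights. if x \<in> N v then paid x else 0)"
        using sum.inter_restrict[OF f(2), of paid "N v"] by (simp add: Int_commute)
    qed simp
    also have "\<dots> = (\<Sum>x\<in>lights. \<Sum>v\<in>heavies. if x \<in> N v then paid x else 0)" by (rule sum.swap)
    also have "\<dots> = (\<Sum>x\<in>lights. \<Sum>v\<in>heavies. if v \<in> N x then paid x else 0)" by (simp add: sym_iff)
    also have "\<dots> = (\<Sum>x\<in>lights. paid x * int (card (N x \<inter> heavies)))"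
      using f by (intro sum.cong) (auto simp: sum.If_cases Int_commute)
    finally show ?thesis .
  qed
  have per: "- (if card (N x) = 1 then 1 else 0) \<le> f2 x + paid x * int (card (N x \<inter> heavies))" if x: "x \<in> lights" for x
  proof -
    have lx: "light N x" "x \<in> V - M" using x by (auto simp: lights_def)
    obtain h where h: "h \<in> N x" "\<not> light N h" using light_has_heavy[OF lx(2,1)] by blast
    have w: "charge x = -1" by (rule charge_light[OF lx(1)])
    have cs: "card (N x \<inter> M) + card (N x \<inter> heavies) \<le> card (N x)"
    proof -
      have "card ((N x \<inter> M) \<union> (N x \<inter> heavies)) = card (N x \<inter> M) + card (N x \<inter> heavies)"
        by (rule card_Un_disjoint) (auto simp: heavies_def)
      moreover have "card ((N x \<inter> M) \<union> (N x \<inter> heavies)) \<le> card (N x)" by (rule card_mono) auto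
      ultimately show ?thesis by simp
    qed
    have c2: "card (N x) \<le> 2" using lx by (simp add: light_def)
    show ?thesis
    proof (cases "N x \<inter> M = {}")
      \<comment> \<open>An edge to \<open>M\<close> brings 2c >= 4, which covers the charge -2 and
        leaves 2 for the at most one heavy neighbour outside \<open>M\<close>. This is why
        \<open>paid\<close> is negative here.\<close>
      case False
      then have m: "1 \<le> card (N x \<inter> M)" by (simp add: Suc_leI card_gt_0_iff)
      have "2 * int (card (N x \<inter> M)) \<le> c * int (card (N x \<inter> M))" using c23 by auto
      moreover have "int (card (N x \<inter> M)) + int (card (N x \<inter> heavies)) \<le> 2" using cs c2 by linarith
      moreover have "1 \<le> int (card (N x \<inter> M))" using m by simp
      ultimately have "0 \<le> 2 * (c * int (card (N x \<inter> M))) - 2 - 2 * int (card (N x \<inter> heavies))" by linarith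
      then have "0 \<le> f2 x + paid x * int (card (N x \<inter> heavies))" using w False by (simp add: f2_def paid_def)
      then show ?thesis by (rule order_trans[rotated]) simp
    next
      case True
      have hh: "h \<in> N x \<inter> heavies" using h True inV by (auto simp: heavies_def)
      then have n1: "1 \<le> card (N x \<inter> heavies)" by (metis Suc_leI One_nat_def card_gt_0_iff emptyE finN finite_Int)
      show ?thesis
      \<comment> \<open>With a light neighbour, \<open>x\<close> still has a heavy one by
        \<open>light_has_heavy\<close>, and its payment 2 suffices. Otherwise all neighbours pay 1,
        and only a leaf is left at -1.\<close>
      proof (cases "\<exists>y\<in>N x. light N y")
        case t: True
        then show ?thesis using True n1 w unfolding f2_def paid_def by simp
      next
        case t: False
        then have "N x \<inter> heavies = N x" using True inV by (auto simp: heavies_def)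
        then show ?thesis using True t n1 w unfolding f2_def paid_def by auto
      qed
    qed
  qed
  have "(\<Sum>x\<in>lights. - (if card (N x) = 1 then 1 else 0::int)) \<le> (\<Sum>x\<in>lights. f2 x + paid x * int (card (N x \<inter> heavies)))"
    by (rule sum_mono) (rule per)
  moreover have "(\<Sum>x\<in>lights. - (if card (N x) = 1 then 1 else 0::int)) = - int (card {x\<in>lights. card (N x) = 1})"
    using f by (simp add: sum_negf sum.If_cases Collect_conj_eq Int_commute)
  moreover have "(\<Sum>v\<in>heavies. final_charge v) = (\<Sum>v\<in>heavies. f2 v) - (\<Sum>x\<in>lights. paid x * int (card (N x \<inter> heavies)))"
    unfolding final_charge_def f2_def[symmetric] sum_subtractf sw by simp
  ultimately show ?thesis using tot by (simp add: sum.distrib)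
qed

lemma leaves_le1: "card {x\<in>lights. card (N x) = 1} \<le> 1"
proof -
  have "finite {x\<in>lights. card (N x) = 1}" using fin by (auto simp: lights_def)
  then show ?thesis using card_le_Suc0_iff_eq[of "{x\<in>lights. card (N x) = 1}"] leaf_unique
    by (auto simp: lights_def)
qed

lemma lights_nbr: "v \<in> V - M \<Longrightarrow> N v \<inter> lights = {u \<in> N v. light N u}"
  using M_light' by (auto simp: lights_def)

lemma no_light_pair_near:
  assumes v: "v \<in> heavies" and d: "card (N v) \<le> (if c = 3 then 3 else 4)"
    and nM: "\<And>u. u \<in> N v \<Longrightarrow> light N u \<Longrightarrow> N u \<inter> M = {}" and cc: "c = 2 \<or> (\<forall>A\<subseteq>V. pot c N A \<le> 0)"
    and a: "a \<in> N v" "light N a" and b: "b \<in> N a"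
  shows "\<not> light N b"
proof
  assume lb: "light N b"
  have vv: "v \<in> V - M" "\<not> light N v" using v by (auto simp: heavies_def)
  show False
  proof (cases "b \<in> N v")
    case True
    show False by (rule no_light_triangle[OF vv(1) a True lb b]) (use d in \<open>auto split: if_splits\<close>)
  next
    case False
    show False by (rule no_light_pair_at[OF vv(1) a lb b False vv(2) d nM cc])
  qed
qed

lemma paid_le2: "paid x \<le> 2" by (simp add: paid_def)

lemma final_eq: "v \<in> heavies \<Longrightarrow> final_charge v = 2 * (c * int (card (N v)) - (2*c+1)) + 2 * (c * int (card (N v \<inter> M))) - (\<Sum>x\<in>N v \<inter> lights. paid x)"
  by (simp add: final_charge_def heavies_def charge_heavy algebra_simps)

lemma nbr_count: "card (N v \<inter> M) + card (N v \<inter> lights) \<le> card (N v)"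
proof -
  have "card ((N v \<inter> M) \<union> (N v \<inter> lights)) = card (N v \<inter> M) + card (N v \<inter> lights)"
    by (rule card_Un_disjoint) (auto simp: lights_def)
  moreover have "card ((N v \<inter> M) \<union> (N v \<inter> lights)) \<le> card (N v)" by (rule card_mono) auto
  ultimately show ?thesis by simp
qed

lemma paid_sum_le: "(\<Sum>x\<in>N v \<inter> lights. paid x) \<le> 2 * int (card (N v \<inter> lights))"
proof -
  have "(\<Sum>x\<in>N v \<inter> lights. paid x) \<le> (\<Sum>x\<in>N v \<inter> lights. 2)" by (rule sum_mono) (rule paid_le2)
  then show ?thesis by simp
qed

text \<open>With degree d, m neighbours in \<open>M\<close> and total payment P the value is 4d - 10
  + 4m - P, where P is at most 2 per light neighbour. One light neighbour next to \<open>M\<close>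
  saves 4. Otherwise d >= 5 suffices by itself, and for d = 3, 4 there are no light pairs nearby, so
  each light neighbour costs 1; three of them at d = 3 are a forbidden claw. The value 0 leaves just
  the two shapes stated.\<close>

lemma final_two:
  assumes c2: "c = 2" and v: "v \<in> heavies"
  shows "0 \<le> final_charge v"
    and "M = {} \<Longrightarrow> final_charge v = 0 \<Longrightarrow> 
      (card (N v) = 3 \<and> card {u\<in>N v. light N u} = 2 \<and> (\<forall>u\<in>N v. light N u \<longrightarrow> (\<forall>w\<in>N u. \<not> light N w))) \<or>
      (card (N v) = 5 \<and> (\<forall>u\<in>N v. light N u \<and> (\<exists>w\<in>N u. light N w)))"
proof -
  define d where "d = int (card (N v))"
  define m where "m = int (card (N v \<inter> M))"
  define n where "n = int (card (N v \<inter> lights))"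
  define P where "P = (\<Sum>x\<in>N v \<inter> lights. paid x)"
  have vv: "v \<in> V - M" "\<not> light N v" using v by (auto simp: heavies_def)
  have fe: "final_charge v = 4 * d - 10 + 4 * m - P"
    using final_eq[OF v] c2 by (simp add: P_def m_def d_def)
  have d3: "3 \<le> d" using heavy_ge3[OF vv(2)] by (simp add: d_def)
  have mn: "m + n \<le> d" "0 \<le> m" "0 \<le> n" using nbr_count[of v] by (simp_all add: d_def m_def n_def)
  have P2: "P \<le> 2 * n" unfolding P_def n_def by (rule paid_sum_le)
  have Lv: "N v \<inter> lights = {u \<in> N v. light N u}" by (rule lights_nbr[OF vv(1)])
  have main: "0 \<le> final_charge v \<and> (M = {} \<longrightarrow> final_charge v = 0 \<longrightarrow> 
      (card (N v) = 3 \<and> card {u\<in>N v. light N u} = 2 \<and> (\<forall>u\<in>N v. light N u \<longrightarrow> (\<forall>w\<in>N u. \<not> light N w))) \<or>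
      (card (N v) = 5 \<and> (\<forall>u\<in>N v. light N u \<and> (\<exists>w\<in>N u. light N w))))"
  proof (cases "\<exists>x\<in>N v \<inter> lights. N x \<inter> M \<noteq> {}")
    case True
    then obtain x where x: "x \<in> N v \<inter> lights" "N x \<inter> M \<noteq> {}" by blast
    have "P = paid x + (\<Sum>x\<in>N v \<inter> lights - {x}. paid x)" unfolding P_def by (rule sum.remove) (use x in auto)
    also have "(\<Sum>x\<in>N v \<inter> lights - {x}. paid x) \<le> (\<Sum>x\<in>N v \<inter> lights - {x}. 2)" by (rule sum_mono) (rule paid_le2)
    also have "\<dots> = 2 * (n - 1)"
    proof -
      have "0 < card (N v \<inter> lights)" using x by (auto simp: card_gt_0_iff)
      moreover have "card (N v \<inter> lights - {x}) = card (N v \<inter> lights) - 1" using x by simp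
      ultimately show ?thesis by (simp add: n_def)
    qed
    also have "paid x = -2" using x by (simp add: paid_def)
    finally have "P \<le> 2 * n - 4" by simp
    moreover have "M \<noteq> {}" using x by auto
    ultimately show ?thesis using fe mn d3 by auto
  next
    case nM: False
    have nM': "N u \<inter> M = {}" if "u \<in> N v" "light N u" for u using nM that Lv by blast
    consider "6 \<le> d" | "d = 5" | "d = 4" | "d = 3" using d3 by linarith
    then show ?thesis
    proof cases
      case 1
      then show ?thesis using fe mn P2 by auto
    next
      case 2
      have "0 \<le> final_charge v" using 2 fe mn P2 by auto
      moreover have "card (N v) = 5 \<and> (\<forall>u\<in>N v. light N u \<and> (\<exists>w\<in>N u. light N w))" if "M = {}" "final_charge v = 0"
      proof -
        have m0: "m = 0" using that by (simp add: m_def)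
        have P10: "P = 10" using fe that 2 m0 by simp
        then have n5: "n = 5" using P2 mn 2 by linarith
        then have "card (N v \<inter> lights) = card (N v)" using 2 by (simp add: n_def d_def)
        then have NL: "N v \<inter> lights = N v" by (simp add: card_subset_eq)
        have "paid u = 2" if u: "u \<in> N v" for u
        proof (rule ccontr)
          assume "paid u \<noteq> 2"
          then have "paid u < 2" using paid_le2[of u] by simp
          then have "P < (\<Sum>x\<in>N v \<inter> lights. 2)" unfolding P_def
            by (intro sum_strict_mono_ex1) (use paid_le2 u NL in auto)
          then show False using P10 n5 by (simp add: n_def)
        qed
        then have "\<exists>w\<in>N u. light N w" if u: "u \<in> N v" for u
          using \<open>\<And>u. u \<in> N v \<Longrightarrow> paid u = 2\<close>[OF u] unfolding paid_def by (auto split: if_splits)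
        then show ?thesis using NL 2 Lv by (auto simp: d_def)
      qed
      ultimately show ?thesis by blast
    next
      case 3
      have nt: "\<not> light N b" if "a \<in> N v" "light N a" "b \<in> N a" for a b
        by (rule no_light_pair_near[OF v _ nM' _ that]) (use 3 c2 in \<open>auto simp: d_def\<close>)
      have "P = (\<Sum>x\<in>N v \<inter> lights. 1)" unfolding P_def
        by (rule sum.cong) (use nt nM in \<open>auto simp: paid_def Lv\<close>)
      then have "P = n" by (simp add: n_def)
      then show ?thesis using fe mn 3 by auto
    next
      case 4
      have nt: "\<not> light N b" if "a \<in> N v" "light N a" "b \<in> N a" for a b
        by (rule no_light_pair_near[OF v _ nM' _ that]) (use 4 c2 in \<open>auto simp: d_def\<close>)
      have "P = (\<Sum>x\<in>N v \<inter> lights. 1)" unfolding P_def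
        by (rule sum.cong) (use nt nM in \<open>auto simp: paid_def Lv\<close>)
      then have P: "P = n" by (simp add: n_def)
      have "n \<noteq> 3"
      proof
        assume "n = 3"
        then have "card (N v \<inter> lights) = card (N v)" using 4 by (simp add: n_def d_def)
        then have "N v \<inter> lights = N v" by (simp add: card_subset_eq)
        then have al: "light N u" if "u \<in> N v" for u using that Lv by blast
        have "card (N v) = 3" using 4 by (simp add: d_def)
        moreover have "\<And>u. u \<in> N v \<Longrightarrow> N u \<inter> M = {}" using nM' al by blast
        moreover have "\<And>u w. u \<in> N v \<Longrightarrow> w \<in> N u \<Longrightarrow> \<not> light N w" using nt al by blast
        ultimately show False using no_claw_of_single_lights[OF c2 vv(1) _ al] by blast
      qed
      then have n2: "n \<le> 2" using mn 4 by linarith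
      have "card (N v) = 3" using 4 by (simp add: d_def)
      moreover have "card {u \<in> N v. light N u} = 2" if "final_charge v = 0" "M = {}"
        using that fe 4 P n2 mn Lv by (simp add: n_def m_def)
      moreover have "0 \<le> final_charge v" using fe 4 P n2 mn by simp
      ultimately show ?thesis using nt by (intro conjI impI disjI1) blast+
    qed
  qed
  from main show "0 \<le> final_charge v" by (rule conjunct1)
  from main show "(card (N v) = 3 \<and> card {u\<in>N v. light N u} = 2 \<and> (\<forall>u\<in>N v. light N u \<longrightarrow> (\<forall>w\<in>N u. \<not> light N w))) \<or>
      (card (N v) = 5 \<and> (\<forall>u\<in>N v. light N u \<and> (\<exists>w\<in>N u. light N w)))" if "M = {}" "final_charge v = 0"
    using that by (elim conjE impE)
qed

text \<open>The value is 6d - 14 + 6m - P with the notation of the proof, which is negative only for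
  d = 3 and P >= 5, that is, three light neighbours one of which has a light neighbour. If no
  potential is positive, light pairs are excluded altogether at d = 3, so P is at most 3 and the
  value at least 1.\<close>

lemma final_three:
  assumes c3: "c = 3" and v: "v \<in> heavies"
  shows "0 \<le> final_charge v"
    and "(\<forall>A\<subseteq>V. pot c N A \<le> 0) \<Longrightarrow> M = {} \<Longrightarrow> 1 \<le> final_charge v \<and> (final_charge v \<le> 1 \<longrightarrow> card (N v) = 3 \<and> (\<forall>u\<in>N v. light N u \<and> (\<forall>w\<in>N u. \<not> light N w)))"
proof -
  define d where "d = int (card (N v))"
  define m where "m = int (card (N v \<inter> M))"
  define n where "n = int (card (N v \<inter> lights))"
  define P where "P = (\<Sum>x\<in>N v \<inter> lights. paid x)"
  have vv: "v \<in> V - M" "\<not> light N v" using v by (auto simp: heavies_def)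
  have fe: "final_charge v = 6 * d - 14 + 6 * m - P"
    using final_eq[OF v] c3 by (simp add: P_def m_def d_def)
  have d3: "3 \<le> d" using heavy_ge3[OF vv(2)] by (simp add: d_def)
  have mn: "m + n \<le> d" "0 \<le> m" "0 \<le> n" using nbr_count[of v] by (simp_all add: d_def m_def n_def)
  have P2: "P \<le> 2 * n" unfolding P_def n_def by (rule paid_sum_le)
  have Lv: "N v \<inter> lights = {u \<in> N v. light N u}" by (rule lights_nbr[OF vv(1)])
  show "0 \<le> final_charge v"
  proof (rule ccontr)
    assume neg: "\<not> ?thesis"
    then have d: "d = 3" "m = 0" using fe mn P2 d3 by linarith+
    then have P5: "5 \<le> P" using neg fe by simp
    then have n3: "n = 3" using P2 mn d by linarith
    then have "card (N v \<inter> lights) = card (N v)" using d by (simp add: n_def d_def)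
    then have NL: "N v \<inter> lights = N v" by (simp add: card_subset_eq)
    then have al: "light N u" if "u \<in> N v" for u using that Lv by blast
    have c3': "card (N v) = 3" using d by (simp add: d_def)
    have "\<exists>a\<in>N v. \<exists>b\<in>N a. light N b"
    proof (rule ccontr)
      assume n: "\<not> ?thesis"
      have "P \<le> (\<Sum>x\<in>N v \<inter> lights. 1)" unfolding P_def
        by (rule sum_mono) (use n in \<open>auto simp: paid_def\<close>)
      then show False using P5 n3 by (simp add: n_def)
    qed
    then obtain a b where ab: "a \<in> N v" "b \<in> N a" "light N b" by blast
    have nt: "q \<notin> N p" if "p \<in> N v" "q \<in> N v" for p q
      using no_light_triangle[OF vv(1) that(1) al[OF that(1)] that(2) al[OF that(2)]] c3' c3 by auto
    show False by (rule no_star_of_lights_3[OF c3 vv(1) c3' al ab(1,3,2) nt])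
  qed
  assume all0: "\<forall>A\<subseteq>V. pot c N A \<le> 0" and Me: "M = {}"
  have m0: "m = 0" using Me by (simp add: m_def)
  show "1 \<le> final_charge v \<and> (final_charge v \<le> 1 \<longrightarrow> card (N v) = 3 \<and> (\<forall>u\<in>N v. light N u \<and> (\<forall>w\<in>N u. \<not> light N w)))"
  proof (cases "d = 3")
    case False
    then show ?thesis using fe mn P2 d3 m0 by auto
  next
    case True
    have nt: "\<not> light N b" if "a \<in> N v" "light N a" "b \<in> N a" for a b
      by (rule no_light_pair_near[OF v _ _ _ that]) (use True c3 all0 Me in \<open>auto simp: d_def\<close>)
    have "N x \<inter> M = {}" for x by (subst Me) simp
    then have "P = (\<Sum>x\<in>N v \<inter> lights. 1)" unfolding P_def
      by (intro sum.cong refl) (use nt in \<open>auto simp: paid_def Lv\<close>)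
    then have P: "P = n" by (simp add: n_def)
    have "1 \<le> final_charge v" using fe True P mn m0 by simp
    moreover have "card (N v) = 3 \<and> (\<forall>u\<in>N v. light N u \<and> (\<forall>w\<in>N u. \<not> light N w))" if "final_charge v \<le> 1"
    proof -
      have "n = 3" using that fe True P mn m0 by simp
      then have "card (N v \<inter> lights) = card (N v)" using True by (simp add: n_def d_def)
      then have "N v \<inter> lights = N v" by (simp add: card_subset_eq)
      then have al: "light N u" if "u \<in> N v" for u using that Lv by blast
      then show ?thesis using nt True by (simp add: d_def)
    qed
    ultimately show ?thesis by blast
  qed
qed

lemma final_nonneg: "v \<in> heavies \<Longrightarrow> 0 \<le> final_charge v"
  using final_two(1) final_three(1) c23 by blast

text \<open>If \<open>M\<close> is the largest maximizer, the strict inequality gives -2, against at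
  most 1 from a leaf. If \<open>M\<close> is empty, there is no slack: for c = 2 all final charges
  vanish and the two remaining shapes are reducible, for c = 3 there is a single heavy vertex whose
  three neighbours would all be leaves.\<close>

lemma no_irreducible_graph: False
proof -
  define B where "B = {x\<in>lights. card (N x) = 1}"
  have fH: "finite heavies" "finite B" using fin by (auto simp: heavies_def lights_def B_def)
  have B1: "card B \<le> 1" using leaves_le1 by (simp add: B_def)
  have ds: "(\<Sum>v\<in>heavies. final_charge v) \<le> 2 * (pot c N V - pot c N M) + int (card B)"
    using discharge by (simp add: B_def)
  have s0: "0 \<le> (\<Sum>v\<in>heavies. final_charge v)" by (rule sum_nonneg) (rule final_nonneg)
  from strong show False
  proof
    assume h: "(\<forall>A\<subseteq>V. \<not> A \<subseteq> M \<longrightarrow> pot c N A < pot c N M) \<and> (\<forall>A\<subseteq>V. pot c N A \<le> pot c N M)"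
    have "\<not> V \<subseteq> M" using MV by auto
    then have "pot c N V < pot c N M" using h by blast
    then have "2 * (pot c N V - pot c N M) \<le> -2" by simp
    moreover have "int (card B) \<le> 1" using B1 by simp
    ultimately have "(\<Sum>v\<in>heavies. final_charge v) < 0" using ds by linarith
    then show False using s0 by linarith
  next
    assume h: "M = {} \<and> (\<forall>A\<subseteq>V. pot c N A \<le> 0)"
    then have Me: "M = {}" and all0: "\<forall>A\<subseteq>V. pot c N A \<le> 0" by auto
    have nM0: "x \<notin> M" for x using Me by simp
    have "pot c N M = 0" unfolding Me by simp
    then have ds: "(\<Sum>v\<in>heavies. final_charge v) \<le> 2 * pot c N V + int (card B)" using ds by simp
    have "V \<noteq> {}" using MV Me by auto
    have hv: "heavies \<noteq> {}"
    proof -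
      obtain x where x: "x \<in> V" using \<open>V \<noteq> {}\<close> by blast
      show ?thesis
      proof (cases "light N x")
        case True
        then obtain w where "w \<in> N x" "\<not> light N w" using light_has_heavy[of x] x nM0 by blast
        then have "w \<in> heavies" unfolding heavies_def using nM0 inV by auto
        then show ?thesis by blast
      next
        case False
        then have "x \<in> heavies" unfolding heavies_def using x nM0 by auto
        then show ?thesis by blast
      qed
    qed
    have Bv: "u \<in> B" if "light N u" "N u = {w}" for u w
    proof -
      have "u \<in> V" using that(2) inV by blast
      then show ?thesis using that nM0 by (simp add: B_def lights_def)
    qed
    from c23 show False
    proof
      assume c2: "c = 2"
      \<comment> \<open>A leaf would force potential exactly 0. But with exactly one missing
        half-edge and 4 dividing the order, the potential 2 (2q + 1) - 20j is 2 modulo 4.\<close>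
      have B0: "B = {}"
      proof (rule ccontr)
        assume "B \<noteq> {}"
        then have cB: "card B = 1" using B1 fH by (metis One_nat_def Suc_leI card_gt_0_iff le_antisym)
        have "0 \<le> pot c N V" using ds s0 cB by linarith
        then have pV: "pot c N V = 0" using p0 by simp
        have nd: "defect N v = (if v \<in> B then 1 else 0)" if v: "v \<in> V" for v
        proof -
          have "N v \<noteq> {}" using no_isolated[OF v] .
          then have "1 \<le> card (N v)" by (simp add: Suc_leI card_gt_0_iff)
          moreover have "v \<in> B \<longleftrightarrow> card (N v) = 1" using v nM0 by (auto simp: B_def lights_def light_def)
          ultimately show ?thesis by (auto simp: defect_def)
        qed
        have "(\<Sum>v\<in>V. defect N v) = (\<Sum>v\<in>V. if v \<in> B then 1 else 0)" by (rule sum.cong) (use nd in auto)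
        also have "\<dots> = int (card (V \<inter> B))" using fin by (simp add: sum.If_cases)
        also have "V \<inter> B = B" by (auto simp: B_def lights_def)
        finally have sd: "(\<Sum>v\<in>V. defect N v) = 1" using cB by simp
        obtain q where q: "(\<Sum>v\<in>V. card (N v \<inter> V)) = 2 * q" using even_degree_sum[of V] by auto
        then have "(\<Sum>v\<in>V. int (card (N v \<inter> V))) = 2 * int q" by (metis of_nat_mult of_nat_numeral of_nat_sum)
        then have "c * (2 * int q + 1) - (2*c+1) * int (card V) = 0"
          using pV unfolding pot_eq_sum sum.distrib sd by simp
        then have e: "2 * (2 * int q + 1) - 5 * int (card V) = 0" using c2 by simp
        obtain j where j: "card V = 4 * j" using kd(1) c2 by (auto simp: kof_def)
        have "2 * (2 * int q + 1) - 5 * (4 * int j) = 0" using e j by simp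
        then show False by presburger
      qed
      then have "(\<Sum>v\<in>heavies. final_charge v) = 0" using ds s0 p0 by simp
      then have z: "final_charge v = 0" if "v \<in> heavies" for v
        using sum_nonneg_eq_0_iff[OF fH(1), of final_charge] final_nonneg that by blast
      have types: "(card (N v) = 3 \<and> card {u\<in>N v. light N u} = 2 \<and> (\<forall>u\<in>N v. light N u \<longrightarrow> (\<forall>w\<in>N u. \<not> light N w))) \<or>
        (card (N v) = 5 \<and> (\<forall>u\<in>N v. light N u \<and> (\<exists>w\<in>N u. light N w)))" if "v \<in> heavies" for v
        using final_two(2)[OF c2 that Me z[OF that]] .
      obtain v where v: "v \<in> heavies" using hv by blast
      have vV: "v \<in> V" using v by (simp add: heavies_def)
      from types[OF v] show False
      proof
        assume "card (N v) = 5 \<and> (\<forall>u\<in>N v. light N u \<and> (\<exists>w\<in>N u. light N w))"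
        then show False using no_five_star[OF c2 all0 Me _ _ _ vV] by blast
      next
        assume t: "card (N v) = 3 \<and> card {u\<in>N v. light N u} = 2 \<and> (\<forall>u\<in>N v. light N u \<longrightarrow> (\<forall>w\<in>N u. \<not> light N w))"
        have shape: "\<exists>x x' g. N w = {x, x', g} \<and> x \<noteq> x' \<and> x \<noteq> g \<and> x' \<noteq> g \<and> x = x0 \<and> light N x' \<and> \<not> light N g"
          if w: "card (N w) = 3" "card {u\<in>N w. light N u} = 2" "x0 \<in> N w" "light N x0" for w x0
        proof -
          define K where "K = {u\<in>N w. light N u}"
          have KN: "K \<subseteq> N w" "x0 \<in> K" using w by (auto simp: K_def)
          have "card (K - {x0}) = 1" using w KN by (simp add: K_def)
          then obtain x' where x': "K - {x0} = {x'}" by (rule card_1_singletonE)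
          have "card (N w - K) = 1" using w KN by (simp add: card_Diff_subset K_def)
          then obtain g where g: "N w - K = {g}" by (rule card_1_singletonE)
          have "N w = {x0, x', g}" using x' g KN by blast
          moreover have "x' \<in> K" "x' \<noteq> x0" "g \<notin> K" "g \<in> N w" using x' g by blast+
          ultimately show ?thesis using KN by (auto simp: K_def)
        qed
        have "{u\<in>N v. light N u} \<noteq> {}" using t by (metis card.empty zero_neq_numeral)
        then obtain x where x: "x \<in> N v" "light N x" by blast
        obtain x' g where g: "N v = {x, x', g}" "x \<noteq> x'" "x \<noteq> g" "x' \<noteq> g" "light N x'" "\<not> light N g"
          using shape[of v x] t x by blast
        have vx: "v \<in> N x" using x sym by blast
        have "N x \<noteq> {v}" using Bv[OF x(2)] B0 by blast
        then obtain y where y: "y \<noteq> v" "N x = {v, y}" using light_cases[OF x(2) vx] by metis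
        have hy: "\<not> light N y" using t x y by blast
        have yH: "y \<in> heavies" unfolding heavies_def using hy y nM0 inV by auto
        have xy: "x \<in> N y" using y sym by blast
        have t2: "card (N y) = 3 \<and> card {u\<in>N y. light N u} = 2 \<and> (\<forall>u\<in>N y. light N u \<longrightarrow> (\<forall>w\<in>N u. \<not> light N w))"
          using types[OF yH] t x xy by blast
        obtain u g' where u: "N y = {x, u, g'}" "x \<noteq> u" "x \<noteq> g'" "u \<noteq> g'" "light N u" "\<not> light N g'"
          using shape[of y x] t2 x(2) xy by blast
        have "x' \<in> N v" "u \<in> N y" using g u by auto
        then have nl: "\<And>w. w \<in> N x' \<Longrightarrow> \<not> light N w" "\<And>w. w \<in> N u \<Longrightarrow> \<not> light N w" using t t2 g u by blast+
        show False by (rule no_double_star[OF c2 all0 g(1-4) x(2) g(5,6) y(2) u nl y(1)])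
      qed
    next
      assume c3: "c = 3"
      have ge1: "1 \<le> final_charge v" if "v \<in> heavies" for v using final_three(2)[OF c3 that all0 Me] by blast
      have "(\<Sum>v\<in>heavies. 1) \<le> (\<Sum>v\<in>heavies. final_charge v)" by (rule sum_mono) (rule ge1)
      then have cH: "int (card heavies) \<le> int (card B)" using ds p0 by simp
      then have "card heavies \<le> 1" using B1 by linarith
      obtain v where v: "v \<in> heavies" using hv by blast
      have Hv: "heavies = {v}" using \<open>card heavies \<le> 1\<close> v card_le_Suc0_iff_eq[OF fH(1)] by auto
      have "final_charge v \<le> 1" using ds p0 B1 Hv by simp
      then have t: "card (N v) = 3" "\<And>u. u \<in> N v \<Longrightarrow> light N u" "\<And>u w. u \<in> N v \<Longrightarrow> w \<in> N u \<Longrightarrow> \<not> light N w"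
        using final_three(2)[OF c3 v all0 Me] by blast+
      have "N v \<subseteq> B"
      proof
        fix u assume u: "u \<in> N v"
        have "N u \<subseteq> {v}"
        proof
          fix w assume w: "w \<in> N u"
          then have "w \<in> heavies" using t(3)[OF u w] nM0 inV by (auto simp: heavies_def)
          then show "w \<in> {v}" using Hv by simp
        qed
        moreover have "v \<in> N u" using u sym by blast
        ultimately have "N u = {v}" by blast
        then show "u \<in> B" using Bv t(2)[OF u] by blast
      qed
      then have "card (N v) \<le> card B" by (rule card_mono[OF fH(2)])
      then show False using t(1) B1 by simp
    qed
  qed
qed

end

section \<open>Choice of \<open>M\<close> and tidy supergraphs\<close>

context nbr_graph
begin

text \<open>By supermodularity the maximizers are closed under union, so one of largest cardinality
  contains all others.\<close>

lemma largest_maximizer: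
  "\<exists>M\<subseteq>V. (\<forall>A\<subseteq>V. \<not> A \<subseteq> M \<longrightarrow> pot c N A < pot c N M) \<and> (\<forall>A\<subseteq>V. pot c N A \<le> pot c N M)"
proof -
  define p where "p = Max (pot c N ` Pow V)"
  have f: "finite (pot c N ` Pow V)" "pot c N ` Pow V \<noteq> {}" using fin by auto
  have mx: "pot c N A \<le> p" if "A \<subseteq> V" for A unfolding p_def using that f by (intro Max_ge) auto
  define F where "F = {A\<in>Pow V. pot c N A = p}"
  have "p \<in> pot c N ` Pow V" unfolding p_def using f by (rule Max_in)
  then have "F \<noteq> {}" "finite F" using fin by (auto simp: F_def)
  then have "Max (card ` F) \<in> card ` F" by (intro Max_in) auto
  then obtain M where M: "M \<in> F" "card M = Max (card ` F)" by (metis imageE)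
  have MV: "M \<subseteq> V" "pot c N M = p" using M by (auto simp: F_def)
  have "pot c N A < pot c N M" if A: "A \<subseteq> V" "\<not> A \<subseteq> M" for A
  proof (rule ccontr)
    assume "\<not> ?thesis"
    then have "p \<le> pot c N A" using MV by simp
    moreover have "pot c N A + pot c N M \<le> pot c N (A \<union> M) + pot c N (A \<inter> M)" by (rule pot_supermod[OF A(1) MV(1)])
    moreover have "pot c N (A \<inter> M) \<le> p" by (rule mx) (use A in auto)
    moreover have "pot c N (A \<union> M) \<le> p" by (rule mx) (use A MV in auto)
    ultimately have "pot c N (A \<union> M) = p" using MV by linarith
    then have "A \<union> M \<in> F" using A MV by (simp add: F_def)
    then have "card (A \<union> M) \<le> Max (card ` F)" using \<open>finite F\<close> by (intro Max_ge) auto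
    moreover have "card M < card (A \<union> M)" by (rule psubset_card_mono) (use A MV finV[of "A \<union> M"] in auto)
    ultimately show False using M by simp
  qed
  then show ?thesis using MV mx by blast
qed

lemma reducible_if_zero:
  assumes sp: "sparse c V N" and td: tidy and kd: "kof c dvd card V" "kof c < card V" and p0: "pot c N V \<le> 0"
  shows reducible
proof (rule ccontr)
  assume ir: "\<not> reducible"
  obtain M where M: "M \<subseteq> V" "\<forall>A\<subseteq>V. \<not> A \<subseteq> M \<longrightarrow> pot c N A < pot c N M" "\<forall>A\<subseteq>V. pot c N A \<le> pot c N M"
    using largest_maximizer by blast
  show False
  proof (cases "M = V")
    case False
    have st: "(\<forall>A\<subseteq>V. \<not> A \<subseteq> M \<longrightarrow> pot c N A < pot c N M) \<and> (\<forall>A\<subseteq>V. pot c N A \<le> pot c N M) \<or> M = {} \<and> (\<forall>A\<subseteq>V. pot c N A \<le> 0)"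
      using M(2,3) by (intro disjI1 conjI)
    interpret irreducible_graph V N c M by (unfold_locales; fact sp td kd p0 M(1) False st ir)
    show False by (rule no_irreducible_graph)
  next
    case True
    have ne: "{} \<noteq> V" using kd by auto
    have "\<forall>A\<subseteq>V. pot c N A \<le> 0" using M(3) True p0 order_trans by blast
    then have st: "(\<forall>A\<subseteq>V. \<not> A \<subseteq> {} \<longrightarrow> pot c N A < pot c N {}) \<and> (\<forall>A\<subseteq>V. pot c N A \<le> pot c N {}) \<or> ({}::'a set) = {} \<and> (\<forall>A\<subseteq>V. pot c N A \<le> 0)"
      by (intro disjI2 conjI refl)
    interpret irreducible_graph V N c "{}" by (unfold_locales; (rule empty_subsetI | fact sp td kd p0 ne st ir))
    show False by (rule no_irreducible_graph)
  qed
qed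

lemma colorable_antimono:
  assumes "colorable k L V N'" "\<And>v. N v \<subseteq> N' v" shows "colorable k L V N"
proof -
  obtain f where "\<forall>v\<in>V. f v \<in> L v" "\<forall>v\<in>V. \<forall>u\<in>N' v. f u \<noteq> f v" "seq_eq k V f"
    using assms(1) by (auto simp: colorable_def)
  then show ?thesis unfolding colorable_def using assms(2) by blast
qed

text \<open>Edges are added one at a time; each lowers the total defect, which is the induction
  measure.\<close>

lemma tidy_extension:
  assumes "in_class c V N"
  shows "\<exists>N'. nbr_graph V N' c \<and> (\<forall>v. N v \<subseteq> N' v) \<and> in_class c V N' \<and> nbr_graph.tidy V N'"
proof -
  have "\<exists>N'. nbr_graph V N' c \<and> (\<forall>v. M v \<subseteq> N' v) \<and> in_class c V N' \<and> nbr_graph.tidy V N'"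
    if "nbr_graph V M c" "in_class c V M" "d = nat (\<Sum>v\<in>V. defect M v)" for M d
    using that
  proof (induction d arbitrary: M rule: less_induct)
    case (less d)
    interpret D: nbr_graph V M c by (rule less.prems(1))
    show ?case
    proof (cases "D.tidy")
      case True
      then show ?thesis using less.prems by blast
    next
      case False
      then obtain x y where xy: "x \<in> V" "y \<in> V" "x \<noteq> y" "card (M x) \<le> 1" "card (M y) \<le> 1" "y \<notin> M x"
        unfolding D.tidy_def by blast
      define M' where "M' = add_edge x y M"
      have g: "nbr_graph V M' c" unfolding M'_def by (rule D.add_edge_graph[OF xy(1-3)])
      have le: "pot c M' A \<le> pot c M A" if "A \<subseteq> V" for A
        unfolding M'_def D.pot_add_edge[OF xy(3,6) that] using xy c23 by auto
      have sp: "sparse c V M" using less.prems(2) by (simp add: in_class_def)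
      have "sparse c V M'" unfolding sparse_def using le D.sparseD[OF sp] order_trans by blast
      then have ic: "in_class c V M'" using less.prems(2) le[of V] by (auto simp: in_class_def)
      have dle: "defect M' v \<le> defect M v" for v
      proof -
        have "card (M v) \<le> card (M' v)" by (rule card_mono) (auto simp: M'_def add_edge_def)
        then show ?thesis by (simp add: defect_def)
      qed
      have "x \<notin> M x" by (rule D.irr)
      have "defect M' x < defect M x" using xy by (simp add: M'_def add_edge_def defect_def)
      then have "(\<Sum>v\<in>V. defect M' v) < (\<Sum>v\<in>V. defect M v)"
        by (intro sum_strict_mono_ex1) (use fin dle xy in auto)
      moreover have "0 \<le> (\<Sum>v\<in>V. defect M' v)" by (rule sum_nonneg) (simp add: defect_def)
      ultimately have "nat (\<Sum>v\<in>V. defect M' v) < d" using less.prems(3) by simp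
      from less.IH[OF this g ic refl] obtain N' where "nbr_graph V N' c" "\<forall>v. M' v \<subseteq> N' v" "in_class c V N'" "nbr_graph.tidy V N'"
        by blast
      moreover have "\<forall>v. M v \<subseteq> M' v" by (auto simp: M'_def add_edge_def)
      ultimately show ?thesis by blast
    qed
  qed
  then show ?thesis using assms nbr_graph_axioms by blast
qed

lemma greedy_full:
  "(\<And>u. u \<in> set us \<Longrightarrow> N u \<subseteq> S) \<Longrightarrow> m + length us \<le> k \<Longrightarrow> greedy k N S m us"
proof (induction us arbitrary: m)
  case (Cons u us)
  have "N u - S = {}" using Cons.prems(1)[of u] by auto
  then have c0: "card (N u - S) = 0" by simp
  have "greedy k N S (Suc m) us" by (rule Cons.IH) (use Cons.prems in auto)
  then show ?case using Cons.prems(2) by (simp add: c0)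
qed simp

end

lemma colorable_empty: "0 < k \<Longrightarrow> colorable k L {} N"
  by (simp add: colorable_def seq_eq_def)

section \<open>The theorem\<close>

text \<open>The residue of the order modulo k decides. Residue 0 calls for a block of k vertices.
  Residue 1 removes one light vertex, for k = 4 with the stronger \<open>remove_light_zero\<close>,
  because the new order is divisible by 4. For k = 4 and residue 2 one vertex is removed, and for
  residue k - 1 > 1 two. For k = 4 the rest then has residue 1, so at most one full class has to be
  avoided.\<close>

theorem class_colorable:
  assumes "nbr_graph V N c" "in_class c V N" "\<forall>v\<in>V. finite (L v) \<and> card (L v) = kof c"
  shows "colorable (kof c) L V N"
  using assms
proof (induction "card V" arbitrary: V N rule: less_induct)
  case less
  interpret G0: nbr_graph V N c by (rule less.prems(1))
  obtain N' where N': "nbr_graph V N' c" "\<And>v. N v \<subseteq> N' v" "in_class c V N'" "nbr_graph.tidy V N'"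
    using G0.tidy_extension[OF less.prems(2)] by blast
  interpret G: nbr_graph V N' c by (rule N'(1))
  define k where "k = kof c"
  have sp: "sparse c V N'" using N'(3) by (simp add: in_class_def)
  have L: "\<forall>v\<in>V. finite (L v) \<and> card (L v) = k" using less.prems(3) by (simp add: k_def)
  have k0: "0 < k" by (simp add: k_def kof_def)
  have td: "G.tidy" by (rule N'(4))
  have IH: "colorable k L (V - S) M" if "S \<subseteq> V" "S \<noteq> {}" "nbr_graph (V - S) M c" "in_class c (V - S) M" for S M
    unfolding k_def
  proof (rule less.hyps)
    show "card (V - S) < card V" by (rule psubset_card_mono) (use that G.fin in auto)
  qed (use that less.prems(3) in auto)
  have IHd: "colorable k L (V - S) (del S N')" if "S \<subseteq> V" "S \<noteq> {}" "in_class c (V - S) (del S N')" for S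
    by (rule IH[OF that(1,2) G.del_graph that(3)])
  have cdel: "card (V - S) = card V - card S" if "S \<subseteq> V" for S using that G.finV card_Diff_subset by blast
  have "colorable k L V N'"
  proof (cases "card V \<le> k")
    case True
    show ?thesis
    proof (cases "V = {}")
      case True
      then show ?thesis using colorable_empty[OF k0] by simp
    next
      case False
      obtain us where us: "set us = V" "distinct us" using G.fin finite_distinct_list by blast
      have len: "length us = card V" using us distinct_card by fastforce
      have gr: "greedy k N' V 0 us" by (rule G.greedy_full) (use G.sub len True in auto)
      show ?thesis
        by (rule G.colorable_short[OF us(2,1) subset_refl gr len _ True _ L])
          (use False G.fin colorable_empty[OF k0] in \<open>auto simp: card_gt_0_iff\<close>)
    qed
  next
    case False
    then have kn: "k < card V" by simp
    have ne: "V \<noteq> {}" using kn by auto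
    have single: "colorable k L V N'"
      if x: "x \<in> V" "light N' x" "in_class c (V - {x}) (del {x} N')" and d: "k dvd card V - 1" for x
    proof (rule G.colorable_short[of "[x]" "{x}" k 1 L])
      have "card (N' x - {x}) \<le> card (N' x)" by (rule card_mono) auto
      then show "greedy k N' {x} 0 [x]" using x(2) by (simp add: light_def k_def kof_def)
      show "k dvd card (V - {x})" using d x by simp
      show "colorable k L (V - {x}) (del {x} N')" by (rule IHd) (use x in auto)
    qed (use x k0 L in auto)
    consider "k dvd card V" | "card V mod k = 1" | "c = 2" "card V mod k = 2" | "card V mod k = k - 1" "card V mod k \<noteq> 1"
    proof -
      have "card V mod k < k" using k0 by simp
      moreover have "k = 3 \<or> k = 4 \<and> c = 2" using G.c23 by (auto simp: k_def kof_def)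
      ultimately have "card V mod k = 0 \<or> card V mod k = 1 \<or> (c = 2 \<and> card V mod k = 2) \<or> (card V mod k = k - 1 \<and> card V mod k \<noteq> 1)"
        by auto
      then show ?thesis using that by (auto simp: dvd_eq_mod_eq_0)
    qed
    then show ?thesis
    proof cases
      case 1
      have p0: "pot c N' V \<le> 0"
      proof (cases "c = 3")
        case True
        then have "3 dvd pot c N' V + int (card V)" using G.pot_mod(1) by blast
        moreover have "3 dvd card V" using 1 True by (simp add: k_def kof_def)
        moreover have "pot c N' V \<le> 2" using G.sparseD[OF sp] by simp
        ultimately show ?thesis by presburger
      next
        case False
        then show ?thesis using N'(3) 1 G.c23 by (auto simp: in_class_def k_def kof_def)
      qed
      have "G.reducible" by (rule G.reducible_if_zero[OF sp td _ _ p0]) (use 1 kn in \<open>auto simp: k_def\<close>)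
      then obtain us M where us: "distinct us" "set us \<subseteq> V" "length us = k" "greedy k N' (set us) 0 us"
        "nbr_graph (V - set us) M c" "\<And>v. del (set us) N' v \<subseteq> M v" "in_class c (V - set us) M"
        unfolding G.reducible_def k_def by blast
      have "set us \<noteq> {}" using us(3) k0 by auto
      then have "colorable k L (V - set us) M" by (rule IH[OF us(2) _ us(5,7)])
      then have "colorable k L (V - set us) (del (set us) N')"
        using us(6) by (rule nbr_graph.colorable_antimono[OF G.del_graph])
      then show ?thesis by (rule G.colorable_block[OF us(1) refl us(2,4,3) k0 L])
    next
      case 2
      have d: "k dvd card V - 1" using 2 by (metis dvd_minus_mod)
      show ?thesis
      proof (cases "c = 3")
        case True
        obtain x where x: "x \<in> V" "light N' x" "sparse c (V - {x}) (del {x} N')" using G.remove_light[OF sp ne] by metis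
        then show ?thesis using single[OF x(1,2) _ d] True by (simp add: in_class_def)
      next
        case False
        then have c2: "c = 2" using G.c23 by auto
        have "card V mod 4 = 1" using 2 c2 by (simp add: k_def kof_def)
        then have "odd (card V)" by presburger
        then obtain x where x: "x \<in> V" "light N' x" "sparse c (V - {x}) (del {x} N')" "pot c (del {x} N') (V - {x}) \<le> 0"
          using G.remove_light_zero[OF sp c2] by metis
        have "in_class c (V - {x}) (del {x} N')" unfolding in_class_def using x(3,4) by blast
        then show ?thesis by (rule single[OF x(1,2) _ d])
      qed
    next
      case 3
      obtain x where x: "x \<in> V" "light N' x" "sparse c (V - {x}) (del {x} N')" using G.remove_light[OF sp ne] by metis
      have k4: "k = 4" using 3 by (simp add: k_def kof_def)
      have cx: "card (V - {x}) = card V - 1" using x by simp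
      have "card V mod 4 = 2" using 3(2) unfolding k4 .
      then obtain q where "card V = 4 * q + 2" by (metis mult_div_mod_eq)
      then have m1: "card (V - {x}) mod 4 = 1" unfolding cx by simp
      then have ms: "modstar (card (V - {x})) k = 1" using k4 by (simp add: modstar_def)
      have ic: "in_class c (V - {x}) (del {x} N')" using x m1 by (auto simp: in_class_def)
      have "card (N' x - {x}) \<le> card (N' x)" by (rule card_mono) auto
      then have gr: "greedy k N' {x} (modstar (card (V - {x})) k) [x]" using x(2) ms k4 by (simp add: light_def)
      have "V - {x} \<noteq> {}" using m1 by (metis card.empty mod_0 zero_neq_one)
      then show ?thesis
        by (intro G.colorable_partial[of "[x]" "{x}" k L]) (use gr ms k4 L x IHd[of "{x}"] ic in auto)
    next
      case 4
      have p1: "pot c N' V \<le> 1"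
      proof (cases "c = 3")
        case True
        then have "3 dvd pot c N' V + int (card V)" using G.pot_mod(1) by blast
        moreover have "card V mod 3 = 2" using 4 True by (simp add: k_def kof_def)
        moreover have "pot c N' V \<le> 2" using G.sparseD[OF sp] by simp
        ultimately show ?thesis by presburger
      next
        case False
        then have c2: "c = 2" using G.c23 by auto
        then have "even (pot c N' V + int (card V))" using G.pot_mod(2) by blast
        moreover have "card V mod 4 = 3" using 4 c2 by (simp add: k_def kof_def)
        moreover have "pot c N' V \<le> 2" using G.sparseD[OF sp] by simp
        ultimately show ?thesis by presburger
      qed
      have "2 \<le> card V" using kn by (simp add: k_def kof_def split: if_splits)
      then obtain s t where st: "s \<in> V" "t \<in> V" "s \<noteq> t" "card (N' s - {t}) \<le> 1" "card (N' t - {s}) \<le> 2"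
        "sparse c (V - {s, t}) (del {s, t} N')"
        using G.remove_pair[OF sp p1 td] by metis
      have o: "card (N' s - {s, t}) \<le> 1" "card (N' t - {s, t}) \<le> 2"
      proof -
        have "card (N' s - {s, t}) \<le> card (N' s - {t})" by (rule card_mono) auto
        then show "card (N' s - {s, t}) \<le> 1" using st(4) by linarith
        have "card (N' t - {s, t}) \<le> card (N' t - {s})" by (rule card_mono) auto
        then show "card (N' t - {s, t}) \<le> 2" using st(5) by linarith
      qed
      have cst: "card (V - {s, t}) = card V - 2" using cdel[of "{s,t}"] st by simp
      have S: "set [t, s] = {s, t}" "distinct [t, s]" "{s, t} \<subseteq> V" using st by auto
      show ?thesis
      proof (cases "c = 3")
        case True
        then have k3: "k = 3" by (simp add: k_def kof_def)
        have "card V mod 3 = 2" using 4 k3 by simp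
        then have d: "k dvd card (V - {s, t})" unfolding cst k3 by (metis dvd_minus_mod)
        have ic: "in_class c (V - {s, t}) (del {s, t} N')" using st True by (simp add: in_class_def)
        have gr: "greedy k N' {s, t} 0 [t, s]" using o k3 by simp
        show ?thesis
          by (rule G.colorable_short[OF S(2,1,3) gr _ _ _ d L IHd[OF S(3) _ ic]]) (use k3 in auto)
      next
        case False
        then have c2: "c = 2" using G.c23 by auto
        then have k4: "k = 4" by (simp add: k_def kof_def)
        have m3: "card V mod 4 = 3" using 4 k4 by simp
        obtain q where "card V = 4 * q + 3" using m3 by (metis mult_div_mod_eq)
        then have m1: "card (V - {s, t}) mod 4 = 1" unfolding cst by simp
        then have ms: "modstar (card (V - {s, t})) k = 1" using k4 by (simp add: modstar_def)
        have ic: "in_class c (V - {s, t}) (del {s, t} N')" using st m1 by (auto simp: in_class_def)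
        have gr: "greedy k N' {s, t} (modstar (card (V - {s, t})) k) [t, s]" using o k4 ms by simp
        have "V - {s, t} \<noteq> {}" using m1 by (metis card.empty mod_0 zero_neq_one)
        then show ?thesis
          by (intro G.colorable_partial[OF S(2,1,3) gr _ _ _ L IHd[OF S(3) _ ic]]) (use k4 ms in auto)
      qed
    qed
  qed
  then show ?case unfolding k_def using N'(2) by (rule G0.colorable_antimono)
qed

section \<open>From edge sets to neighbourhood functions\<close>

definition nbrs :: "'a set set \<Rightarrow> 'a \<Rightarrow> 'a set" where
  "nbrs E v = {u. {v, u} \<in> E \<and> u \<noteq> v}"

lemma nbrs_graph:
  assumes "simple_graph V E" "c = 2 \<or> c = 3" shows "nbr_graph V (nbrs E) c"
  by unfold_locales (use assms in \<open>auto simp: simple_graph_def nbrs_def insert_commute\<close>)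

lemma incident_edges:
  assumes "simple_graph V E" "v \<in> A"
  shows "card (nbrs E v \<inter> A) = card {e\<in>{e\<in>E. e \<subseteq> A}. v \<in> e}"
proof (rule bij_betw_same_card)
  show "bij_betw (\<lambda>u. {v, u}) (nbrs E v \<inter> A) {e\<in>{e\<in>E. e \<subseteq> A}. v \<in> e}"
    unfolding bij_betw_def
  proof
    show "inj_on (\<lambda>u. {v, u}) (nbrs E v \<inter> A)" by (auto simp: inj_on_def nbrs_def doubleton_eq_iff)
    show "(\<lambda>u. {v, u}) ` (nbrs E v \<inter> A) = {e\<in>{e\<in>E. e \<subseteq> A}. v \<in> e}"
    proof
      show "(\<lambda>u. {v, u}) ` (nbrs E v \<inter> A) \<subseteq> {e\<in>{e\<in>E. e \<subseteq> A}. v \<in> e}" using assms by (auto simp: nbrs_def)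
      show "{e\<in>{e\<in>E. e \<subseteq> A}. v \<in> e} \<subseteq> (\<lambda>u. {v, u}) ` (nbrs E v \<inter> A)"
      proof
        fix e assume e: "e \<in> {e\<in>{e\<in>E. e \<subseteq> A}. v \<in> e}"
        then have "card e = 2" using assms by (auto simp: simple_graph_def)
        then obtain a b where "e = {a, b}" "a \<noteq> b" by (auto simp: card_2_iff)
        then have "\<exists>u. e = {v, u} \<and> u \<noteq> v" using e by (auto simp: insert_commute)
        then show "e \<in> (\<lambda>u. {v, u}) ` (nbrs E v \<inter> A)" using e by (auto simp: nbrs_def)
      qed
    qed
  qed
qed

lemma degree_nbrs:
  assumes "simple_graph V E" "v \<in> V" shows "degree E v = card (nbrs E v)"
proof -
  have "{e\<in>E. e \<subseteq> V} = E" "nbrs E v \<inter> V = nbrs E v" using assms by (auto simp: simple_graph_def nbrs_def)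
  then show ?thesis using incident_edges[OF assms] by (simp add: degree_def)
qed

lemma nbrs_sum:
  assumes "simple_graph V E" "A \<subseteq> V"
  shows "(\<Sum>v\<in>A. card (nbrs E v \<inter> A)) = 2 * induced_edges E A"
proof -
  define F where "F = {e\<in>E. e \<subseteq> A}"
  have fV: "finite V" "E \<subseteq> Pow V" using assms by (auto simp: simple_graph_def)
  have f: "finite A" "finite F" using finite_subset[OF assms(2)] finite_subset[OF fV(2)] fV by (auto simp: F_def)
  have "(\<Sum>v\<in>A. card (nbrs E v \<inter> A)) = (\<Sum>v\<in>A. card {e\<in>F. v \<in> e})"
    unfolding F_def by (rule sum.cong) (use incident_edges assms in auto)
  also have "\<dots> = (\<Sum>v\<in>A. \<Sum>e\<in>F. if v \<in> e then 1 else 0)"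
    using f by (intro sum.cong) (auto simp: sum.If_cases Collect_conj_eq)
  also have "\<dots> = (\<Sum>e\<in>F. \<Sum>v\<in>A. if v \<in> e then 1 else 0)" by (rule sum.swap)
  also have "\<dots> = (\<Sum>e\<in>F. 2)"
  proof (rule sum.cong)
    fix e assume e: "e \<in> F"
    then have "A \<inter> e = e" "card e = 2" using assms by (auto simp: F_def simple_graph_def)
    then show "(\<Sum>v\<in>A. if v \<in> e then 1 else 0) = (2::nat)" using f by (simp add: sum.If_cases)
  qed simp
  finally show ?thesis by (simp add: F_def induced_edges_def)
qed

text \<open>An isolated vertex counts \<open>-1\<close> in \<^const>\<open>pot\<close> but \<open>-(2c+1)\<close> in \<^const>\<open>rho_set\<close>, so the isolated vertices have to be dropped from the set.\<close>

lemma pot_le_rho_set: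
  assumes G: "simple_graph V E" and A: "A \<subseteq> V" and c: "c = 2 \<and> k = 4 \<or> c = 3 \<and> k = 3"
  shows "\<exists>B\<subseteq>V. real_of_int (pot c (nbrs E) A) \<le> rho_set k V E B"
proof -
  define B where "B = {v\<in>A. nbrs E v \<noteq> {}}"
  interpret nbr_graph V "nbrs E" c using nbrs_graph[OF G] c by auto
  have f: "finite A" "finite B" using finV A by (auto simp: B_def)
  have BV: "B \<subseteq> V" "B \<subseteq> A" using A by (auto simp: B_def)
  have NB: "nbrs E v \<inter> A = nbrs E v \<inter> B" for v using sym unfolding B_def by blast
  have df: "defect (nbrs E) v = (if v \<in> V1 V E then 1 else 0)" if "v \<in> B" for v
  proof -
    have "1 \<le> card (nbrs E v)" using that by (simp add: B_def Suc_leI card_gt_0_iff)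
    moreover have "v \<in> V1 V E \<longleftrightarrow> card (nbrs E v) = 1"
      using that BV(1) degree_nbrs[OF G, of v] by (auto simp: V1_def)
    ultimately show ?thesis by (auto simp: defect_def)
  qed
  define g where "g = (\<lambda>v. c * (int (card (nbrs E v \<inter> A)) + defect (nbrs E) v) - (2*c+1))"
  have "pot c (nbrs E) A = (\<Sum>v\<in>B. g v) + (\<Sum>v\<in>A - B. g v)"
    unfolding pot_def g_def[symmetric] using sum.subset_diff[OF BV(2) f(1), of g] by simp
  also have "(\<Sum>v\<in>A - B. g v) \<le> 0"
    by (rule sum_nonpos) (auto simp: B_def g_def defect_def)
  also have "(\<Sum>v\<in>B. g v) = c * (\<Sum>v\<in>B. int (card (nbrs E v \<inter> B)) + (if v \<in> V1 V E then 1 else 0)) - (2*c+1) * int (card B)"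
  proof -
    have "(\<Sum>v\<in>B. g v) = (\<Sum>v\<in>B. c * (int (card (nbrs E v \<inter> B)) + (if v \<in> V1 V E then 1 else 0)) - (2*c+1))"
      by (rule sum.cong) (auto simp: g_def NB df)
    then show ?thesis by (simp add: sum_subtractf sum_distrib_left)
  qed
  also have "(\<Sum>v\<in>B. int (card (nbrs E v \<inter> B)) + (if v \<in> V1 V E then 1 else 0)) = 2 * int (induced_edges E B) + int (card (B \<inter> V1 V E))"
  proof -
    have "(\<Sum>v\<in>B. int (card (nbrs E v \<inter> B))) = int (2 * induced_edges E B)"
      using nbrs_sum[OF G BV(1)] by (metis of_nat_sum)
    then show ?thesis using f by (simp add: sum.distrib sum.If_cases)
  qed
  finally have "pot c (nbrs E) A \<le> c * (2 * int (induced_edges E B) + int (card (B \<inter> V1 V E))) - (2*c+1) * int (card B)"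
    by simp
  then have "real_of_int (pot c (nbrs E) A) \<le> real_of_int (c * (2 * int (induced_edges E B) + int (card (B \<inter> V1 V E))) - (2*c+1) * int (card B))"
    by (simp only: of_int_le_iff)
  also have "\<dots> = rho_set k V E B"
    using c by (auto simp: rho_set_def eps_def nu_def algebra_simps)
  finally show ?thesis using BV(1) by blast
qed

lemma pot_le_rho:
  assumes G: "simple_graph V E" and A: "A \<subseteq> V" and c: "c = 2 \<and> k = 4 \<or> c = 3 \<and> k = 3"
  shows "real_of_int (pot c (nbrs E) A) \<le> rho k V E"
proof -
  obtain B where B: "B \<subseteq> V" "real_of_int (pot c (nbrs E) A) \<le> rho_set k V E B"
    using pot_le_rho_set[OF assms] by blast
  have e: "{rho_set k V E A |A. A \<subseteq> V} = rho_set k V E ` Pow V" by auto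
  have "finite V" using G by (simp add: simple_graph_def)
  then have "rho_set k V E B \<le> rho k V E" unfolding rho_def e using B by (intro Max_ge) auto
  then show ?thesis using B by linarith
qed

text \<open>For c = 2 and order divisible by 4 the potential of \<open>V\<close> is twice the number
  of degree-1 vertices modulo 4. If that number is even, at most 2 means at most 0; if it is odd,
  the potential is 2 modulo 4, and the bound 1 coming from \<open>sigma\<close> excludes the value
  2.\<close>

lemma rho_in_class:
  assumes G: "simple_graph V E" and c: "c = 2 \<and> k = 4 \<or> c = 3 \<and> k = 3" and r: "rho k V E \<le> 2 - real (sigma k V E)"
  shows "in_class c V (nbrs E)"
proof -
  interpret nbr_graph V "nbrs E" c using nbrs_graph[OF G] c by auto
  have le: "real_of_int (pot c (nbrs E) A) \<le> 2 - real (sigma k V E)" if "A \<subseteq> V" for A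
    using pot_le_rho[OF G that c] r by linarith
  have "pot c (nbrs E) A \<le> 2" if "A \<subseteq> V" for A using le[OF that] by linarith
  moreover have "pot c (nbrs E) V \<le> 0" if c2: "c = 2" and d: "4 dvd card V"
  proof -
    have k4: "k = 4" using c c2 by auto
    \<comment> \<open>Only the parity of the defect matters, and an isolated vertex has defect
      2.\<close>
    have df: "\<exists>i. defect (nbrs E) v = (if v \<in> V1 V E then 1 else 0) + 2 * i" if v: "v \<in> V" for v
    proof (cases "card (nbrs E v) = 0")
      case True
      then show ?thesis using v degree_nbrs[OF G v] by (intro exI[of _ 1]) (auto simp: V1_def defect_def)
    next
      case False
      then have "card (nbrs E v) = 1 \<or> 2 \<le> card (nbrs E v)" by linarith
      then have "defect (nbrs E) v = (if v \<in> V1 V E then 1 else 0)"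
        using v degree_nbrs[OF G v] by (elim disjE) (simp_all add: V1_def defect_def)
      then show ?thesis by (intro exI[of _ 0]) simp
    qed
    then obtain i where i: "\<And>v. v \<in> V \<Longrightarrow> defect (nbrs E) v = (if v \<in> V1 V E then 1 else 0) + 2 * i v" by metis
    have "(\<Sum>v\<in>V. defect (nbrs E) v) = (\<Sum>v\<in>V. (if v \<in> V1 V E then 1 else 0) + 2 * i v)" by (rule sum.cong) (use i in auto)
    also have "\<dots> = int (card (V \<inter> V1 V E)) + 2 * (\<Sum>v\<in>V. i v)"
      using fin by (simp add: sum.distrib sum.If_cases sum_distrib_left)
    also have "V \<inter> V1 V E = V1 V E" by (auto simp: V1_def)
    finally have sd: "(\<Sum>v\<in>V. defect (nbrs E) v) = int (card (V1 V E)) + 2 * (\<Sum>v\<in>V. i v)" .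
    obtain q where q: "(\<Sum>v\<in>V. card (nbrs E v \<inter> V)) = 2 * q" using even_degree_sum[of V] by auto
    then have "(\<Sum>v\<in>V. int (card (nbrs E v \<inter> V))) = 2 * int q" by (metis of_nat_mult of_nat_numeral of_nat_sum)
    then have p: "pot c (nbrs E) V = 2 * (2 * int q + (int (card (V1 V E)) + 2 * (\<Sum>v\<in>V. i v))) - 5 * int (card V)"
    proof -
      define X where "X = 2 * int q + (int (card (V1 V E)) + 2 * (\<Sum>v\<in>V. i v))"
      have "pot c (nbrs E) V = c * X - (2*c+1) * int (card V)"
        unfolding pot_eq_sum sum.distrib sd X_def using \<open>(\<Sum>v\<in>V. int (card (nbrs E v \<inter> V))) = 2 * int q\<close> by simp
      also have "\<dots> = 2 * X - 5 * int (card V)" using c2 by simp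
      finally show ?thesis unfolding X_def .
    qed
    define I where "I = (\<Sum>v\<in>V. i v)"
    obtain n where n: "card V = 4 * n" using d by auto
    have pe: "pot c (nbrs E) V = 2 * int (card (V1 V E)) + 4 * (int q + I - 5 * int n)"
      unfolding p n I_def[symmetric] by simp
    define J where "J = int q + I - 5 * int n"
    have "real_of_int (pot c (nbrs E) V) \<le> 2 - real (card (V1 V E) mod 2)"
      using le[of V] k4 by (simp add: sigma_def)
    then have "pot c (nbrs E) V \<le> 2 - int (card (V1 V E) mod 2)" by linarith
    then have "2 * int (card (V1 V E)) + 4 * J \<le> 2 - int (card (V1 V E)) mod 2"
      unfolding pe J_def[symmetric] by (simp add: zmod_int)
    then show ?thesis unfolding pe J_def[symmetric] by presburger
  qed
  ultimately show ?thesis by (auto simp: in_class_def sparse_def)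
qed

lemma ceiling_div: "0 < k \<Longrightarrow> nat \<lceil>real n / real k\<rceil> = (n + k - 1) div k"
proof -
  assume k: "0 < k"
  have "n + k - 1 = (n + k - 1) div k * k + (n + k - 1) mod k" by simp
  moreover have "(n + k - 1) mod k < k" using k by simp
  ultimately have "n \<le> (n + k - 1) div k * k" "(n + k - 1) div k * k < n + k" using k by linarith+
  then have "real n \<le> real ((n + k - 1) div k) * real k" "real ((n + k - 1) div k) * real k < real n + real k"
    by (metis of_nat_le_iff of_nat_mult, metis of_nat_less_iff of_nat_mult of_nat_add)
  then have "real n / real k \<le> real ((n + k - 1) div k)" "real ((n + k - 1) div k) - 1 < real n / real k"
    using k by (simp_all add: field_simps)
  then have "\<lceil>real n / real k\<rceil> = int ((n + k - 1) div k)" by (simp add: ceiling_eq_iff)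
  then show ?thesis by simp
qed

theorem theorem2p1:
  fixes k :: nat and V :: "'a set" and E :: "'a set set" and L :: "'a \<Rightarrow> 'c set"
  assumes "k \<in> {3, 4}"
    and "simple_graph V E"
    and "rho k V E \<le> 2 - real (sigma k V E)"
    and "list_assignment k V L"
  shows "SE_L_colorable k V E L"
proof (cases "V = {}")
  case True
  then show ?thesis by (simp add: SE_L_colorable_def)
next
  case False
  define c :: int where "c = (if k = 3 then 3 else 2)"
  have c: "c = 2 \<and> k = 4 \<or> c = 3 \<and> k = 3" using assms(1) by (auto simp: c_def)
  have kc: "kof c = k" and k0: "0 < k" using c by (auto simp: kof_def)
  have "nbr_graph V (nbrs E) c" using nbrs_graph[OF assms(2)] c by auto
  moreover have "in_class c V (nbrs E)" by (rule rho_in_class[OF assms(2) c assms(3)])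
  ultimately have "colorable k L V (nbrs E)"
    using class_colorable[of V "nbrs E" c L] assms(4) kc by (simp add: list_assignment_def)
  then obtain f where f: "\<forall>v\<in>V. f v \<in> L v" "\<forall>v\<in>V. \<forall>u\<in>nbrs E v. f u \<noteq> f v" "seq_eq k V f"
    by (auto simp: colorable_def)
  have "f u \<noteq> f v" if e: "e \<in> E" "u \<in> e" "v \<in> e" "u \<noteq> v" for e u v
  proof -
    have e2: "card e = 2" "e \<subseteq> V" using e assms(2) by (auto simp: simple_graph_def)
    then have fe: "finite e" by (metis card.infinite zero_neq_numeral)
    have "{v, u} = e" by (rule card_seteq[OF fe]) (use e e2 in auto)
    then have "u \<in> nbrs E v" "v \<in> V" using e e2 by (auto simp: nbrs_def)
    then show ?thesis using f(2) by blast
  qed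
  then have "L_coloring V E L f" using f(1) unfolding L_coloring_def by blast
  moreover have "strongly_equitable k V f"
    using f(3) False by (simp add: strongly_equitable_def seq_eq_def Let_def color_class_def ceiling_div[OF k0])
  ultimately show ?thesis by (auto simp: SE_L_colorable_def)
qed

end
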